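(* Let $\mathcal{A}$ be a $C^*$-algebra, $\mathcal{N}$ a Hilbert $C^*$-module over $\mathcal{A}$, and $Z\subset\mathcal{N}$ a subset. If $Z$ is $\mathcal{A}$-precompact, then it is $(\mathcal{N},\mathcal{N})$-totally bounded. If, in addition, $\mathcal{N}$ admits a standard frame (for example, if $\mathcal{N}$ is countably generated), then the converse is also true: if $Z$ is $(\mathcal{N},\mathcal{N})$-totally bounded, then it is $\mathcal{A}$-precompact.
   Context: Hilbert $C^*$-modules are right Hilbert modules with $\langle x,ya\rangle=\langle x,y\rangle a$. $\mathcal{A}$-precompactness: a bounded subset $Z\subset\mathcal{N}$ is $\mathcal{A}$-precompact if for every $\varepsilon>0$ there exist $M_\varepsilon>0$ and $z_1,\dots,z_s\in\mathcal{N}$ such that for every $x\in Z$ there exist $a_1,\dots,a_s\in\mathcal{A}$ with $\|a_k\|\le M_\varepsilon$ and $\|x-\sum_{k=1}^sz_ka_k\|<\varepsilon$. Total boundedness: a countable system $X=\{x_i\}$ of elements of $\mathcal{N}$ is $\mathcal{N}$-admissible if for each $x\in\mathcal{N}$ the series $\sum_i\langle x,x_i\rangle\langle x_i,x\rangle$ converges in $\mathcal{A}$, its sum is $\le\langle x,x\rangle$, and $\|x_i\|\le1$ for all $i$. For an admissible $X$ and a countable collection $\Phi=\{\varphi_1,\varphi_2,\dots\}$ of states on $\mathcal{A}$ (positive linear functionals of norm 1), put $$d_{X,\Phi}(x,y)^2=\sup_k\sum_{i=k}^\infty|\varphi_k(\langle x-y,x_i\rangle)|^2,\quad x,y\in\mathcal{N}.$$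 A set $Y\subseteq\mathcal{N}$ is $(\mathcal{N},\mathcal{N})$-totally bounded if for every such $(X,\Phi)$ and every $\varepsilon>0$ there are finitely many $y_1,\dots,y_n\in Y$ such that the sets $\{y\in Y: d_{X,\Phi}(y_i,y)<\varepsilon\}$ cover $Y$. Standard frame: a family $\{x_j\}_{j\in J}$ in $\mathcal{N}$ is a standard frame if there are constants $c_1,c_2>0$ such that for every $x\in\mathcal{N}$ the series $\sum_j\langle x,x_j\rangle\langle x_j,x\rangle$ converges in norm and $c_1\langle x,x\rangle\le\sum_j\langle x,x_j\rangle\langle x_j,x\rangle\le c_2\langle x,x\rangle$. $\mathcal{N}$ is countably generated if the $\mathcal{A}$-linear combinations of some countable collection of its elements are dense. *)

theory Defs
  imports "HOL-Analysis.Analysis"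
begin

text \<open>C*-algebras are not assumed to be unital.\<close>

class complex_normed_vector = real_normed_vector +
  fixes scaleC :: "complex \<Rightarrow> 'a \<Rightarrow> 'a" (infixr "*\<^sub>C" 75)
  assumes scaleC_of_real: "complex_of_real r *\<^sub>C x = r *\<^sub>R x"
    and scaleC_add_right: "c *\<^sub>C (x + y) = c *\<^sub>C x + c *\<^sub>C y"
    and scaleC_add_left: "(c + d) *\<^sub>C x = c *\<^sub>C x + d *\<^sub>C x"
    and scaleC_scaleC: "c *\<^sub>C (d *\<^sub>C x) = (c * d) *\<^sub>C x"
    and norm_scaleC: "norm (c *\<^sub>C x) = cmod c * norm x"

class complex_banach = complex_normed_vector + banach

class cstar_algebra = complex_banach + real_normed_algebra +
  fixes adj :: "'a \<Rightarrow> 'a"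
  assumes scaleC_mult_left: "(c *\<^sub>C a) * b = c *\<^sub>C (a * b)"
    and scaleC_mult_right: "a * (c *\<^sub>C b) = c *\<^sub>C (a * b)"
    and adj_adj: "adj (adj a) = a"
    and adj_add: "adj (a + b) = adj a + adj b"
    and adj_scaleC: "adj (c *\<^sub>C a) = cnj c *\<^sub>C adj a"
    and adj_mult: "adj (a * b) = adj b * adj a"
    and cstar_identity: "norm (adj a * a) = (norm a)\<^sup>2"

definition cstar_pos :: "'a::cstar_algebra \<Rightarrow> bool" where
  "cstar_pos a \<longleftrightarrow> (\<exists>b. a = adj b * b)"

definition cstar_le :: "'a::cstar_algebra \<Rightarrow> 'a \<Rightarrow> bool" (infix "\<preceq>" 50) where
  "a \<preceq> b \<longleftrightarrow> cstar_pos (b - a)"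

definition cstar_state :: "('a::cstar_algebra \<Rightarrow> complex) \<Rightarrow> bool" where
  "cstar_state \<phi> \<longleftrightarrow>
     bounded_linear \<phi> \<and> (\<forall>c a. \<phi> (c *\<^sub>C a) = c * \<phi> a) \<and>
     (\<forall>a. cstar_pos a \<longrightarrow> \<phi> a \<in> \<real>\<^sub>\<ge>\<^sub>0) \<and> onorm \<phi> = 1"

text \<open>
  Right Hilbert modules; the inner product is linear in the second argument. The norm of the
  ambient Banach space is required to be the one induced by the inner product, so that
  completeness of the module is contained in the type class.
\<close>

locale hilbert_module =
  fixes act :: "'n::complex_banach \<Rightarrow> 'a::cstar_algebra \<Rightarrow> 'n"
    and ip :: "'n \<Rightarrow> 'n \<Rightarrow> 'a"
  assumes act_add_left: "act (x + y) a = act x a + act y a"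
    and act_add_right: "act x (a + b) = act x a + act x b"
    and act_mult: "act x (a * b) = act (act x a) b"
    and act_scaleC_left: "act (c *\<^sub>C x) a = c *\<^sub>C act x a"
    and act_scaleC_right: "act x (c *\<^sub>C a) = c *\<^sub>C act x a"
    and ip_add_right: "ip x (y + z) = ip x y + ip x z"
    and ip_scaleC_right: "ip x (c *\<^sub>C y) = c *\<^sub>C ip x y"
    and ip_act_right: "ip x (act y a) = ip x y * a"
    and ip_adj: "adj (ip x y) = ip y x"
    and ip_pos: "cstar_pos (ip x x)"
    and ip_definite: "ip x x = 0 \<Longrightarrow> x = 0"
    and norm_ip: "norm x = sqrt (norm (ip x x))"

definition A_precompact :: "('n::complex_banach \<Rightarrow> 'a::cstar_algebra \<Rightarrow> 'n) \<Rightarrow> 'n set \<Rightarrow> bool" where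
  "A_precompact act Z \<longleftrightarrow> bounded Z \<and>
     (\<forall>\<epsilon>>0. \<exists>M>0. \<exists>(s::nat) z. \<forall>x\<in>Z. \<exists>a.
        (\<forall>k<s. norm (a k) \<le> M) \<and> norm (x - (\<Sum>k<s. act (z k) (a k))) < \<epsilon>)"

text \<open>
  Countable systems and countable collections of states are sequences. Finite ones are
  covered: pad a finite system with zeros, and repeat the last state of a finite nonempty
  collection; neither changes the pseudometric below.
\<close>

definition admissible_system ::
    "('n::complex_banach \<Rightarrow> 'n \<Rightarrow> 'a::cstar_algebra) \<Rightarrow> (nat \<Rightarrow> 'n) \<Rightarrow> bool" where
  "admissible_system ip X \<longleftrightarrow>
     (\<forall>x. summable (\<lambda>i. ip x (X i) * ip (X i) x) \<and>
          (\<Sum>i. ip x (X i) * ip (X i) x) \<preceq> ip x x) \<and>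
     (\<forall>i. norm (X i) \<le> 1)"

text \<open>
  For admissible \<open>X\<close> and states \<open>\<Phi> k\<close> all sums below converge and are bounded by
  the square of the norm of \<open>x - y\<close>, so that the real-valued supremum is the genuine one.
\<close>

definition d_XPhi ::
    "('n::complex_banach \<Rightarrow> 'n \<Rightarrow> 'a::cstar_algebra) \<Rightarrow> (nat \<Rightarrow> 'n) \<Rightarrow> (nat \<Rightarrow> 'a \<Rightarrow> complex)
      \<Rightarrow> 'n \<Rightarrow> 'n \<Rightarrow> real" where
  "d_XPhi ip X \<Phi> x y =
     sqrt (SUP k. \<Sum>i. (cmod (\<Phi> k (ip (x - y) (X (i + k)))))\<^sup>2)"

definition NN_totally_bounded ::
    "('n::complex_banach \<Rightarrow> 'n \<Rightarrow> 'a::cstar_algebra) \<Rightarrow> 'n set \<Rightarrow> bool" where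
  "NN_totally_bounded ip Y \<longleftrightarrow>
     (\<forall>X \<Phi>. admissible_system ip X \<and> (\<forall>k. cstar_state (\<Phi> k)) \<longrightarrow>
        (\<forall>\<epsilon>>0. \<exists>F. finite F \<and> F \<subseteq> Y \<and> Y \<subseteq> (\<Union>z\<in>F. {y \<in> Y. d_XPhi ip X \<Phi> z y < \<epsilon>})))"

text \<open>The index set may be uncountable, hence unordered summation.\<close>

definition standard_frame ::
    "('n::complex_banach \<Rightarrow> 'n \<Rightarrow> 'a::cstar_algebra) \<Rightarrow> 'j set \<Rightarrow> ('j \<Rightarrow> 'n) \<Rightarrow> bool" where
  "standard_frame ip J f \<longleftrightarrow>
     (\<exists>c1>0. \<exists>c2>0. \<forall>x.
        (\<lambda>j. ip x (f j) * ip (f j) x) summable_on J \<and>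
        c1 *\<^sub>R ip x x \<preceq> (\<Sum>\<^sub>\<infinity>j\<in>J. ip x (f j) * ip (f j) x) \<and>
        (\<Sum>\<^sub>\<infinity>j\<in>J. ip x (f j) * ip (f j) x) \<preceq> c2 *\<^sub>R ip x x)"

definition countably_generated_module ::
    "('n::complex_banach \<Rightarrow> 'a::cstar_algebra \<Rightarrow> 'n) \<Rightarrow> bool" where
  "countably_generated_module act \<longleftrightarrow>
     (\<exists>G. countable G \<and>
        closure {(\<Sum>g\<in>F. act g (a g)) | F a. finite F \<and> F \<subseteq> G} = UNIV)"

end

theory Submission
  imports Defs
begin

text \<open>
  \<^emph>\<open>Precompact sets are totally bounded.\<close>  For a state \<open>\<phi>\<close> one has \<open>|\<phi> c|\<^sup>2 \<le> \<phi> (c * adj c)\<close>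
  (\<open>cstar_state_norm_square_le\<close>), so the sum of \<open>|\<phi> (ip x (X i))|\<^sup>2\<close> over \<open>i \<ge> m\<close> is at most the norm
  of the tail of the series \<open>ip x (X i) * ip (X i) x\<close>.  Replacing \<open>x\<close> by \<open>x a\<close> conjugates that tail by
  \<open>a\<close>.  Hence the tails are small uniformly over all states and over all combinations of finitely
  many vectors with bounded coefficients, and only finitely many bounded coordinates remain.

  \<^emph>\<open>The converse.\<close>  Given a sequence of points \<open>z k\<close> that refutes the claim, one builds an admissible
  system \<open>X k\<close> and states \<open>\<Phi> k\<close> for which \<open>\<Phi> k (ip (z k) (X k))\<close> stays away from zero, or is
  unbounded, whereas for a fixed vector \<open>y\<close> the elements \<open>ip y (X k)\<close> tend to zero, or are bounded.  The
  states exist because every nonzero positive element attains its norm at some state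
  (\<open>cstar_state_exists\<close>).  This is used twice: for boundedness of \<open>Z\<close> (\<open>bounded_of_totally_bounded\<close>),
  and to see that the tails of the frame series are uniformly small on \<open>Z\<close>
  (\<open>totally_bounded_uniform_tail\<close>), where \<open>X k\<close> is a block of the frame expansion of \<open>z k\<close> and the
  Cauchy-Schwarz inequality \<open>B x y * B y x \<le> norm (B y y) B x x\<close> for algebra-valued positive forms
  gives admissibility.  Then the frame operator, which is bounded below, is approximately inverted
  by a partial sum of a Neumann series, and this turns truncated frame expansions into
  approximations of the points of \<open>Z\<close>.

  \<^emph>\<open>Frames of countably generated modules.\<close>  A Parseval frame comes from a Gram-Schmidt
  procedure for the residual form \<open>R x y = ip x y - (\<Sum>j<n. ip x (f j) * ip (f j) y)\<close>.  To treat a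
  generator \<open>h\<close> one wants the new vector to be the residual of \<open>h\<close> times \<open>w^(-1/2)\<close>, \<open>w = R h h\<close>.  The
  inverse of \<open>w\<close> is replaced by a polynomial \<open>q\<close> in \<open>w\<close> with \<open>w q = 1 - (1 - w)^m\<close>, which makes the new
  residual \<open>w (1 - w)^m\<close>, of norm at most \<open>1 / (m + 1)\<close> (\<open>Bessel_extend\<close>).  Visiting each generator
  infinitely often with growing \<open>m\<close>, the residuals tend to zero everywhere.

  The C*-algebra theory behind this (sums of positive elements, \<open>adj b * b \<ge> 0\<close>, monotonicity of the
  norm, states) is obtained in the unitization without spectra: positivity of a hermitian \<open>a\<close> is
  compared with \<open>norm (t - a) \<le> t\<close>, square roots are limits of an explicit iteration, and norm
  estimates come from unitaries \<open>b + i s\<close> with \<open>b\<^sup>2 + s\<^sup>2 = 1\<close>.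
\<close>

section \<open>Elementary algebra in a C*-algebra\<close>

lemma scaleC_zero_left [simp]: "0 *\<^sub>C (x::'a::complex_normed_vector) = 0"
  using scaleC_of_real[of 0 x] by simp

lemma scaleC_one [simp]: "1 *\<^sub>C (x::'a::complex_normed_vector) = x"
  using scaleC_of_real[of 1 x] by simp

lemma scaleC_zero_right [simp]: "c *\<^sub>C (0::'a::complex_normed_vector) = 0"
  using norm_scaleC[of c "0::'a"] by simp

lemma scaleC_minus_right: "c *\<^sub>C (- x) = - (c *\<^sub>C (x::'a::complex_normed_vector))"
  using scaleC_add_right[of c x "- x"] by (simp add: eq_neg_iff_add_eq_0 add.commute)

lemma scaleC_minus_left: "(- c) *\<^sub>C x = - (c *\<^sub>C (x::'a::complex_normed_vector))"
  using scaleC_add_left[of c "- c" x] by (simp add: eq_neg_iff_add_eq_0 add.commute)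

lemma scaleC_diff_right: "c *\<^sub>C (x - y) = c *\<^sub>C x - c *\<^sub>C (y::'a::complex_normed_vector)"
  using scaleC_add_right[of c x "- y"] by (simp add: scaleC_minus_right)

lemma scaleC_scaleR: "c *\<^sub>C (r *\<^sub>R x) = r *\<^sub>R (c *\<^sub>C (x::'a::complex_normed_vector))"
  by (simp add: scaleC_of_real[symmetric] scaleC_scaleC mult.commute)

lemma adj_scaleR: "adj (r *\<^sub>R a) = r *\<^sub>R adj (a::'a::cstar_algebra)"
  using adj_scaleC[of "complex_of_real r" a] by (simp add: scaleC_of_real)

lemma adj_zero [simp]: "adj (0::'a::cstar_algebra) = 0"
  using adj_scaleR[of 0 "0::'a"] by simp

lemma adj_minus: "adj (- a) = - adj (a::'a::cstar_algebra)"
  using adj_scaleR[of "-1" a] by simp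

lemma adj_diff: "adj (a - b) = adj a - adj (b::'a::cstar_algebra)"
  using adj_add[of a "- b"] by (simp add: adj_minus)

lemma adj_sum: "adj (sum f A) = (\<Sum>i\<in>A. adj (f i :: 'a::cstar_algebra))"
  by (induction A rule: infinite_finite_induct) (auto simp: adj_add)

lemma norm_adj [simp]: "norm (adj a) = norm (a::'a::cstar_algebra)"
proof -
  have le: "norm b \<le> norm (adj b)" for b :: 'a
  proof (cases "b = 0")
    case False
    have "norm b * norm b \<le> norm (adj b) * norm b"
      using cstar_identity[of b] norm_mult_ineq[of "adj b" b] by (simp add: power2_eq_square)
    then show ?thesis using False by simp
  qed simp
  show ?thesis using le[of a] le[of "adj a"] by (simp add: adj_adj)
qed

lemma bounded_linear_adj: "bounded_linear (adj :: 'a::cstar_algebra \<Rightarrow> 'a)"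
  by (rule bounded_linear_intro[where K=1]) (simp_all add: adj_add adj_scaleR)

lemma cstar_identity': "norm (a * adj a) = (norm (a::'a::cstar_algebra))\<^sup>2"
  using cstar_identity[of "adj a"] by (simp add: adj_adj)

lemma hermitian_norm_square: "adj a = a \<Longrightarrow> norm (a * a) = (norm (a::'a::cstar_algebra))\<^sup>2"
  using cstar_identity[of a] by simp

lemma cstar_pos_hermitian: "cstar_pos a \<Longrightarrow> adj a = a"
  by (auto simp: cstar_pos_def adj_mult adj_adj)

lemma cstar_pos_0 [simp]: "cstar_pos 0"
  unfolding cstar_pos_def by (rule exI[of _ 0]) simp

lemma cstar_pos_scaleR:
  assumes "cstar_pos a" "r \<ge> 0" shows "cstar_pos (r *\<^sub>R a)"
proof -
  obtain b where b: "a = adj b * b" using assms(1) by (auto simp: cstar_pos_def)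
  have "r *\<^sub>R a = adj (sqrt r *\<^sub>R b) * (sqrt r *\<^sub>R b)"
    using assms(2) b by (simp add: adj_scaleR)
  then show ?thesis unfolding cstar_pos_def by blast
qed

lemma cstar_pos_conj:
  assumes "cstar_pos a" shows "cstar_pos (adj c * a * c)"
proof -
  obtain b where "a = adj b * b" using assms(1) by (auto simp: cstar_pos_def)
  then have "adj c * a * c = adj (b * c) * (b * c)" by (simp add: adj_mult mult.assoc)
  then show ?thesis unfolding cstar_pos_def by blast
qed

section \<open>Square roots and positivity in a unital C*-algebra\<close>

class unital_cstar_algebra = cstar_algebra + real_normed_algebra_1

lemma adj_one [simp]: "adj 1 = (1::'a::unital_cstar_algebra)"
  using adj_mult[of "adj 1" "1::'a"] by (simp add: adj_adj)

lemma adj_power: "adj (a ^ n) = adj (a::'a::unital_cstar_algebra) ^ n"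
  by (induction n) (simp_all add: adj_mult power_commutes)

text \<open>
  \<open>1 - y\<close> is the square root of \<open>1 - x\<close> when \<open>y\<close> is the limit of Visser's iteration
  \<open>y \<mapsto> (x + y\<^sup>2) / 2\<close>. Since the iterates are polynomials in \<open>x\<close> with nonnegative coefficients,
  their increments are dominated by those of the scalar iteration for \<open>x = 1\<close>, which is
  increasing and bounded by 1; so the iteration converges even when \<open>norm x = 1\<close>.
\<close>

primrec visser :: "'a::real_normed_algebra_1 \<Rightarrow> nat \<Rightarrow> 'a" where
  "visser x 0 = 0"
| "visser x (Suc n) = (1/2) *\<^sub>R (x + visser x n * visser x n)"

lemma visser_commute:
  assumes "x * z = z * x" shows "visser x n * z = z * visser x n"
proof (induction n)
  case (Suc n)
  have "visser x n * visser x n * z = z * (visser x n * visser x n)"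
    by (metis Suc mult.assoc)
  then show ?case by (simp add: distrib_left distrib_right assms)
qed simp

lemma visser_real_bounds: "0 \<le> visser (1::real) n \<and> visser (1::real) n \<le> 1"
proof (induction n)
  case (Suc n)
  then have "visser (1::real) n * visser (1::real) n \<le> 1" by (intro mult_le_one) auto
  then show ?case using Suc by simp
qed simp

lemma visser_step:
  assumes "norm x \<le> 1"
  shows "norm (visser x n) \<le> visser (1::real) n \<and>
    norm (visser x (Suc n) - visser x n) \<le> visser (1::real) (Suc n) - visser (1::real) n"
proof (induction n)
  case 0 then show ?case using assms by simp
next
  case (Suc n)
  let ?y = "visser x" and ?r = "visser (1::real)"
  have comm: "?y n * ?y (Suc n) = ?y (Suc n) * ?y n"
    by (rule visser_commute, rule visser_commute[symmetric], rule refl)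
  have n1: "norm (?y (Suc n)) \<le> ?r (Suc n)"
    using norm_triangle_ineq[of "?y n" "?y (Suc n) - ?y n"] Suc by (simp del: visser.simps)
  have "?y (Suc (Suc n)) - ?y (Suc n) = (1/2) *\<^sub>R (?y (Suc n) * ?y (Suc n) - ?y n * ?y n)"
    by (simp add: scaleR_add_right scaleR_diff_right del: scaleR_half_double)
  also have "\<dots> = (1/2) *\<^sub>R ((?y (Suc n) - ?y n) * (?y (Suc n) + ?y n))"
    using comm by (simp add: algebra_simps del: visser.simps)
  finally have "norm (?y (Suc (Suc n)) - ?y (Suc n))
      = (1/2) * norm ((?y (Suc n) - ?y n) * (?y (Suc n) + ?y n))"
    by (simp del: visser.simps)
  also have "\<dots> \<le> (1/2) * ((?r (Suc n) - ?r n) * (?r (Suc n) + ?r n))"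
  proof -
    have "norm ((?y (Suc n) - ?y n) * (?y (Suc n) + ?y n))
        \<le> norm (?y (Suc n) - ?y n) * norm (?y (Suc n) + ?y n)" by (rule norm_mult_ineq)
    also have "\<dots> \<le> (?r (Suc n) - ?r n) * (?r (Suc n) + ?r n)"
    proof (rule mult_mono)
      show "norm (?y (Suc n) - ?y n) \<le> ?r (Suc n) - ?r n" using Suc by blast
      show "norm (?y (Suc n) + ?y n) \<le> ?r (Suc n) + ?r n"
        using norm_triangle_ineq[of "?y (Suc n)" "?y n"] n1 Suc by linarith
      show "0 \<le> ?r (Suc n) - ?r n" using Suc norm_ge_zero order_trans by blast
    qed simp
    finally show ?thesis by simp
  qed
  also have "\<dots> = ?r (Suc (Suc n)) - ?r (Suc n)"
    by (simp add: field_simps)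
  finally show ?case using n1 by blast
qed

lemma visser_convergent:
  fixes x :: "'a::{real_normed_algebra_1, banach}"
  assumes "norm x \<le> 1" shows "convergent (visser x)"
proof -
  let ?r = "visser (1::real)"
  have inc: "?r n \<le> ?r (Suc n)" for n
    using visser_step[of "1::real" n] norm_ge_zero by (metis diff_ge_0_iff_ge norm_one order.refl order_trans)
  have "convergent ?r"
    using incseq_SucI[of ?r, OF inc] visser_real_bounds
    by (intro Bseq_mono_convergent BseqI'[where K=1]) (auto simp: incseq_def abs_of_nonneg)
  then have "summable (\<lambda>n. ?r (Suc n) - ?r n)"
    by (intro telescope_summable) (simp add: convergent_LIMSEQ_iff)
  then have "summable (\<lambda>n. norm (visser x (Suc n) - visser x n))"
    by (rule summable_comparison_test'[where N=0]) (use visser_step[OF assms] in auto)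
  then have "summable (\<lambda>n. visser x (Suc n) - visser x n)" by (rule summable_norm_cancel)
  then have "convergent (\<lambda>n. \<Sum>i<n. visser x (Suc i) - visser x i)"
    by (simp add: summable_iff_convergent)
  then show ?thesis by (simp add: sum_lessThan_telescope del: visser.simps(2))
qed

lemma sqrt_one_minus:
  fixes x :: "'a::unital_cstar_algebra"
  assumes "norm x \<le> 1"
  obtains y where "norm y \<le> 1" "(1 - y) * (1 - y) = 1 - x"
    "\<And>z. x * z = z * x \<Longrightarrow> y * z = z * y" "adj x = x \<Longrightarrow> adj y = y"
proof -
  define y where "y = lim (visser x)"
  have lim: "visser x \<longlonglongrightarrow> y"
    using visser_convergent[OF assms] by (simp add: convergent_LIMSEQ_iff y_def)
  have 1: "norm y \<le> 1"
  proof (rule LIMSEQ_le_const2[OF tendsto_norm[OF lim]])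
    show "\<exists>N. \<forall>n\<ge>N. norm (visser x n) \<le> 1"
      using visser_step[OF assms] visser_real_bounds by (meson order_trans)
  qed
  have "(\<lambda>n. visser x (Suc n)) \<longlonglongrightarrow> (1/2) *\<^sub>R (x + y * y)"
    unfolding visser.simps by (intro tendsto_intros lim)
  moreover have "(\<lambda>n. visser x (Suc n)) \<longlonglongrightarrow> y" using lim by (rule LIMSEQ_Suc)
  ultimately have "y = (1/2) *\<^sub>R (x + y * y)" by (metis LIMSEQ_unique)
  then have "2 *\<^sub>R y = x + y * y" by (metis scaleR_half_double scaleR_2 scaleR_right_distrib)
  then have 2: "(1 - y) * (1 - y) = 1 - x" by (simp add: algebra_simps scaleR_2)
  have 3: "y * z = z * y" if "x * z = z * x" for z
  proof (rule LIMSEQ_unique)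
    show "(\<lambda>n. visser x n * z) \<longlonglongrightarrow> y * z" by (intro tendsto_intros lim)
    show "(\<lambda>n. visser x n * z) \<longlonglongrightarrow> z * y"
      unfolding visser_commute[OF that] by (intro tendsto_intros lim)
  qed
  have 4: "adj y = y" if "adj x = x"
  proof (rule LIMSEQ_unique)
    have "adj (visser x n) = visser x n" for n
      by (induction n) (simp_all add: adj_add adj_scaleR adj_mult that)
    then show "visser x \<longlonglongrightarrow> adj y"
      using bounded_linear.tendsto[OF bounded_linear_adj lim] by simp
  qed (rule lim)
  show ?thesis using that 1 2 3 4 by blast
qed

text \<open>
  For a general C*-algebra the cone of elements \<open>adj b * b\<close> is not obviously closed under
  addition.  Its elements are compared with squares of hermitian elements, for which
  \<open>norm (t - a) \<le> t\<close> is an equivalent condition that is visibly convex.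
\<close>

definition hermitian_square :: "'a::unital_cstar_algebra \<Rightarrow> bool" where
  "hermitian_square a \<longleftrightarrow> (\<exists>b. adj b = b \<and> a = b * b)"

lemma hermitian_square_hermitian: "hermitian_square a \<Longrightarrow> adj a = a"
  by (auto simp: hermitian_square_def adj_mult)

text \<open>Take the square root of \<open>1 - x\<close> with \<open>x = 1 - a / t\<close>, a contraction by hypothesis.\<close>

lemma hermitian_square_root:
  fixes a :: "'a::unital_cstar_algebra"
  assumes a: "adj a = a" and t: "t \<ge> 0" and le: "norm (t *\<^sub>R 1 - a) \<le> t"
  obtains b where "adj b = b" "a = b * b" "\<And>z. a * z = z * a \<Longrightarrow> b * z = z * b"
    "norm (sqrt t *\<^sub>R 1 - b) \<le> sqrt t"
proof (cases "t = 0")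
  case True
  then have "a = 0" using le by simp
  then show ?thesis using that[of 0] True by simp
next
  case False
  then have tp: "t > 0" using t by simp
  define x where "x = 1 - (1/t) *\<^sub>R a"
  have "x = (1/t) *\<^sub>R (t *\<^sub>R 1 - a)" using tp by (simp add: x_def scaleR_diff_right)
  then have "norm x = norm (t *\<^sub>R 1 - a) / t" using tp by simp
  then have "norm x \<le> 1" using le tp by simp
  then obtain y where y: "norm y \<le> 1" "(1 - y) * (1 - y) = 1 - x"
    "\<And>z. x * z = z * x \<Longrightarrow> y * z = z * y" "adj x = x \<Longrightarrow> adj y = y"
    using sqrt_one_minus by metis
  define b where "b = sqrt t *\<^sub>R (1 - y)"
  have "adj x = x" using a by (simp add: x_def adj_diff adj_scaleR)
  then have 1: "adj b = b" using y(4) by (simp add: b_def adj_scaleR adj_diff)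
  have "b * b = t *\<^sub>R ((1 - y) * (1 - y))" using t by (simp add: b_def)
  also have "\<dots> = a" using y(2) tp by (simp add: x_def)
  finally have 2: "a = b * b" by simp
  have 3: "b * z = z * b" if "a * z = z * a" for z
  proof -
    have "x * z = z * x" using that by (simp add: x_def left_diff_distrib right_diff_distrib)
    then have "y * z = z * y" by (rule y(3))
    then show ?thesis by (simp add: b_def left_diff_distrib right_diff_distrib)
  qed
  have "sqrt t *\<^sub>R 1 - b = sqrt t *\<^sub>R y" by (simp add: b_def scaleR_diff_right)
  then have 4: "norm (sqrt t *\<^sub>R 1 - b) \<le> sqrt t" using y(1) t
    by (simp add: mult_left_le)
  show ?thesis using that[OF 1 2 3 4] by blast
qed

text \<open>\<open>b + i s\<close> is unitary, and \<open>s\<close> is its imaginary part.\<close>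

lemma norm_le_1_of_squares_sum_1:
  fixes b s :: "'a::unital_cstar_algebra"
  assumes "adj b = b" "adj s = s" "b * s = s * b" "b * b + s * s = 1"
  shows "norm s \<le> 1"
proof -
  define u where "u = b + \<i> *\<^sub>C s"
  have au: "adj u = b - \<i> *\<^sub>C s"
    using assms(1,2) by (simp add: u_def adj_add adj_scaleC scaleC_minus_left)
  have "adj u * u = b * b + s * s"
    unfolding au unfolding u_def using assms(3)
    by (simp add: algebra_simps scaleC_mult_left scaleC_mult_right scaleC_scaleC scaleC_minus_left scaleC_diff_right)
  then have "(norm u)\<^sup>2 = 1" using assms(4) cstar_identity[of u] by simp
  then have nu: "norm u = 1" using norm_ge_zero[of u] by (simp add: power2_eq_1_iff)
  have "u - adj u = (2 * \<i>) *\<^sub>C s"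
    unfolding au unfolding u_def by (simp add: scaleC_add_left[of \<i> \<i>, symmetric])
  then have "2 * norm s = norm (u - adj u)" by (simp add: norm_scaleC norm_mult)
  also have "\<dots> \<le> 2" using norm_triangle_ineq4[of u "adj u"] nu by simp
  finally show ?thesis by simp
qed

text \<open>
  \<open>1 - b\<^sup>2\<close> has a hermitian square root \<open>s\<close> that commutes with \<open>b\<close>, and \<open>s\<close> is a contraction because
  \<open>b\<^sup>2 + s\<^sup>2 = 1\<close>.
\<close>

lemma norm_1_minus_square_le:
  fixes b :: "'a::unital_cstar_algebra"
  assumes "adj b = b" "norm b \<le> 1" shows "norm (1 - b * b) \<le> 1"
proof -
  have "norm (b * b) \<le> 1"
    using norm_mult_ineq[of b b] mult_le_one[OF assms(2) norm_ge_zero assms(2)] by linarith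
  then obtain y where y: "(1 - y) * (1 - y) = 1 - b * b"
    "\<And>z. b * b * z = z * (b * b) \<Longrightarrow> y * z = z * y" "adj (b * b) = b * b \<Longrightarrow> adj y = y"
    using sqrt_one_minus by metis
  have "adj y = y" using y(3) assms by (simp add: adj_mult)
  moreover have "y * b = b * y" by (rule y(2)) (simp add: mult.assoc)
  ultimately have "norm (1 - y) \<le> 1"
    using assms y(1) by (intro norm_le_1_of_squares_sum_1[of b])
       (simp_all add: adj_diff left_diff_distrib right_diff_distrib)
  then have "norm ((1 - y) * (1 - y)) \<le> 1"
    using norm_mult_ineq[of "1 - y" "1 - y"] mult_le_one[of "norm (1 - y)" "norm (1 - y)"] by force
  then show ?thesis using y(1) by simp
qed

lemma hermitian_square_iff:
  fixes a :: "'a::unital_cstar_algebra"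
  shows "hermitian_square a \<longleftrightarrow> adj a = a \<and> (\<exists>t\<ge>0. norm (t *\<^sub>R 1 - a) \<le> t)"
    and hermitian_square_norm_diff_le:
      "hermitian_square a \<Longrightarrow> norm a \<le> t \<Longrightarrow> norm (t *\<^sub>R 1 - a) \<le> t"
proof -
  have sq: "norm (norm a *\<^sub>R 1 - a) \<le> norm a" if h: "hermitian_square a"
  proof (cases "a = 0")
    case False
    obtain b where b: "adj b = b" "a = b * b" using h by (auto simp: hermitian_square_def)
    have nb: "norm a = norm b * norm b" using b hermitian_norm_square[of b] by (simp add: power2_eq_square)
    then have n0: "norm b > 0" using False by fastforce
    have "norm (1 - (1 / norm b) *\<^sub>R b * ((1 / norm b) *\<^sub>R b)) \<le> 1"
      using n0 b by (intro norm_1_minus_square_le) (simp_all add: adj_scaleR)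
    moreover have "norm a *\<^sub>R 1 - a = norm a *\<^sub>R (1 - (1 / norm b) *\<^sub>R b * ((1 / norm b) *\<^sub>R b))"
      using n0 by (simp add: nb b(2)[symmetric] scaleR_diff_right)
    ultimately show ?thesis
      by (simp add: mult_left_le)
  qed simp
  show "norm (t *\<^sub>R 1 - a) \<le> t" if "hermitian_square a" "norm a \<le> t"
  proof -
    have "t *\<^sub>R 1 - a = (t - norm a) *\<^sub>R 1 + (norm a *\<^sub>R 1 - a)" by (simp add: scaleR_diff_left)
    then have "norm (t *\<^sub>R 1 - a) \<le> norm ((t - norm a) *\<^sub>R (1::'a)) + norm (norm a *\<^sub>R 1 - a)"
      by (metis norm_triangle_ineq)
    then show ?thesis using sq[OF that(1)] that(2) by simp
  qed
  show "hermitian_square a \<longleftrightarrow> adj a = a \<and> (\<exists>t\<ge>0. norm (t *\<^sub>R 1 - a) \<le> t)"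
    using sq hermitian_square_hermitian[of a] norm_ge_zero[of a] hermitian_square_root[of a]
    unfolding hermitian_square_def by metis
qed

lemma hermitian_square_add:
  assumes "hermitian_square a" "hermitian_square b" shows "hermitian_square (a + b)"
proof -
  obtain s where s: "s \<ge> 0" "norm (s *\<^sub>R 1 - a) \<le> s" using assms(1) hermitian_square_iff by metis
  obtain t where t: "t \<ge> 0" "norm (t *\<^sub>R 1 - b) \<le> t" using assms(2) hermitian_square_iff by metis
  have e: "(s + t) *\<^sub>R 1 - (a + b) = (s *\<^sub>R 1 - a) + (t *\<^sub>R 1 - b)" by (simp add: scaleR_add_left)
  have "norm ((s + t) *\<^sub>R 1 - (a + b)) \<le> s + t"
    unfolding e using norm_triangle_ineq[of "s *\<^sub>R 1 - a" "t *\<^sub>R 1 - b"] s t by linarith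
  moreover have "adj (a + b) = a + b"
    using assms by (simp add: adj_add hermitian_square_hermitian)
  ultimately show ?thesis unfolding hermitian_square_iff[of "a + b"] using s(1) t(1)
    by (auto intro!: exI[of _ "s + t"])
qed

lemma hermitian_square_scaleR:
  assumes "hermitian_square a" "r \<ge> 0" shows "hermitian_square (r *\<^sub>R a)"
proof -
  obtain b where b: "adj b = b" "a = b * b" using assms(1) by (auto simp: hermitian_square_def)
  have "r *\<^sub>R a = (sqrt r *\<^sub>R b) * (sqrt r *\<^sub>R b)" using assms(2) b by simp
  then show ?thesis unfolding hermitian_square_def using b(1) adj_scaleR by metis
qed

lemma hermitian_square_positive_root:
  assumes "hermitian_square a"
  obtains b where "hermitian_square b" "a = b * b" "\<And>z. a * z = z * a \<Longrightarrow> b * z = z * b"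
proof -
  obtain t where t: "t \<ge> 0" "norm (t *\<^sub>R 1 - a) \<le> t" "adj a = a"
    using assms hermitian_square_iff by metis
  obtain b where b: "adj b = b" "a = b * b" "\<And>z. a * z = z * a \<Longrightarrow> b * z = z * b"
    "norm (sqrt t *\<^sub>R 1 - b) \<le> sqrt t"
    using hermitian_square_root[OF t(3,1,2)] by metis
  have "hermitian_square b"
    unfolding hermitian_square_iff using b(1,4) t(1) by (intro conjI exI[of _ "sqrt t"]) simp_all
  then show ?thesis using that b(2,3) by blast
qed

text \<open>Square roots commute with whatever commutes with the element, so the two roots commute.\<close>

lemma hermitian_square_commuting_mult:
  assumes "hermitian_square a" "hermitian_square b" "a * b = b * a"
  shows "hermitian_square (a * b)"
proof -
  obtain c where c: "hermitian_square c" "a = c * c" "\<And>z. a * z = z * a \<Longrightarrow> c * z = z * c"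
    using hermitian_square_positive_root[OF assms(1)] by metis
  obtain d where d: "hermitian_square d" "b = d * d" "\<And>z. b * z = z * b \<Longrightarrow> d * z = z * d"
    using hermitian_square_positive_root[OF assms(2)] by metis
  have "c * b = b * c" using c(3) assms(3) by blast
  then have cd: "d * c = c * d" using d(3) by metis
  have "a * b = (c * d) * (c * d)" unfolding c(2) d(2) using cd by (metis mult.assoc)
  moreover have "adj (c * d) = c * d"
    using c(1) d(1) cd by (simp add: adj_mult hermitian_square_hermitian)
  ultimately show ?thesis unfolding hermitian_square_def by blast
qed

lemma hermitian_square_1_minus:
  assumes "adj a = a" "norm a \<le> 1" shows "hermitian_square (1 - a)"
  using assms hermitian_square_iff[of "1 - a"] by (auto simp: adj_diff intro!: exI[of _ 1])

text \<open>Again the roots of \<open>x\<close> and of \<open>1 - x\<close> are the parts of a unitary element.\<close>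

lemma hermitian_square_norm_le_1:
  assumes "hermitian_square x" "hermitian_square (1 - x)" shows "norm x \<le> 1"
proof -
  obtain b where b: "hermitian_square b" "x = b * b" "\<And>z. x * z = z * x \<Longrightarrow> b * z = z * b"
    using hermitian_square_positive_root[OF assms(1)] by metis
  obtain c where c: "hermitian_square c" "1 - x = c * c"
      "\<And>z. (1 - x) * z = z * (1 - x) \<Longrightarrow> c * z = z * c"
    using hermitian_square_positive_root[OF assms(2)] by metis
  have cb: "c * b = b * c"
    by (rule c(3)) (simp add: b(2) left_diff_distrib right_diff_distrib mult.assoc)
  have "norm b \<le> 1"
  proof (rule norm_le_1_of_squares_sum_1[of c])
    show "c * c + b * b = 1" using b(2) c(2) by (metis diff_add_cancel)
    show "adj c = c" "adj b = b" using b(1) c(1) by (simp_all add: hermitian_square_hermitian)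
  qed (rule cb)
  then show ?thesis
    using norm_mult_ineq[of b b] mult_le_one[of "norm b" "norm b"] b(2) by force
qed

lemma hermitian_square_norm_mono:
  assumes "hermitian_square x" "hermitian_square (y - x)" shows "norm x \<le> norm y"
proof (rule dense_ge)
  fix N assume N: "norm y < N"
  then have Np: "N > 0" using norm_ge_zero[of y] by linarith
  have hy: "adj y = y"
    using assms[THEN hermitian_square_hermitian] by (simp add: adj_diff)
  have "hermitian_square (1 - (1/N) *\<^sub>R y)"
    using N Np hy by (intro hermitian_square_1_minus) (simp_all add: adj_scaleR)
  moreover have "hermitian_square ((1/N) *\<^sub>R (y - x))"
    using assms(2) Np by (intro hermitian_square_scaleR) simp_all
  ultimately have "hermitian_square (1 - (1/N) *\<^sub>R y + (1/N) *\<^sub>R (y - x))"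
    by (rule hermitian_square_add)
  then have "hermitian_square (1 - (1/N) *\<^sub>R x)" by (simp add: scaleR_diff_right)
  moreover have "hermitian_square ((1/N) *\<^sub>R x)"
    using assms(1) Np by (intro hermitian_square_scaleR) simp_all
  ultimately have "norm ((1/N) *\<^sub>R x) \<le> 1" by (rule hermitian_square_norm_le_1[rotated])
  then show "norm x \<le> N" using Np by simp
qed

lemma hermitian_square_one: "hermitian_square 1"
  unfolding hermitian_square_def by (rule exI[of _ 1]) simp

lemma hermitian_square_square: "adj a = a \<Longrightarrow> hermitian_square (a * a)"
  unfolding hermitian_square_def by blast

text \<open>
  Let \<open>p = - adj c * c\<close> and \<open>q = c * adj c\<close>.  If \<open>p\<close> is a hermitian square, so is \<open>q\<close>, hence
  \<open>norm (1 - q) \<le> 1\<close> after scaling.  But \<open>adj c * (1 - q)^n * c = - p * (1 + p)^n\<close>, whose norm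
  grows at least like \<open>n * norm (p * p)\<close>.
\<close>

lemma no_negative_adj_mult:
  fixes c :: "'a::unital_cstar_algebra"
  assumes "hermitian_square (- (adj c * c))" shows "c = 0"
proof (rule ccontr)
  assume c0: "c \<noteq> 0"
  define d where "d = (1 / norm c) *\<^sub>R c"
  have nd: "norm d = 1" using c0 by (simp add: d_def)
  define p where "p = - (adj d * d)"
  define q where "q = d * adj d"
  have "p = (1 / norm c)\<^sup>2 *\<^sub>R (- (adj c * c))"
    by (simp add: p_def d_def adj_scaleR power2_eq_square)
  then have p: "hermitian_square p" using assms hermitian_square_scaleR[OF assms] by simp
  have q: "hermitian_square q"
  proof -
    \<comment> \<open>The real and imaginary parts of \<open>d\<close>, up to factors, give \<open>d * adj d + adj d * d\<close>.\<close>
    let ?h = "d + adj d" and ?k = "\<i> *\<^sub>C (d - adj d)"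
    have "?h * ?h + ?k * ?k = 2 *\<^sub>R (q - p)"
      by (simp add: p_def q_def scaleC_mult_left scaleC_mult_right scaleC_scaleC scaleC_minus_left
          scaleC_diff_right algebra_simps scaleR_2)
    then have "q = (1/2) *\<^sub>R (?h * ?h + ?k * ?k) + p" by simp
    moreover have "hermitian_square (?h * ?h)"
      by (intro hermitian_square_square) (simp add: adj_add adj_adj add.commute)
    moreover have "hermitian_square (?k * ?k)"
      by (intro hermitian_square_square)
         (simp add: adj_diff adj_adj adj_scaleC scaleC_minus_left scaleC_diff_right)
    ultimately show ?thesis using p
      by (metis hermitian_square_add hermitian_square_scaleR half_gt_zero_iff less_eq_real_def zero_less_one)
  qed
  have nq: "norm (1 - q) \<le> 1"
    using hermitian_square_norm_diff_le[OF q, of 1] nd cstar_identity'[of d] by (simp add: q_def)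
  have hp: "adj p = p" using p by (rule hermitian_square_hermitian)
  have p1: "hermitian_square (1 + p)" using hermitian_square_add[OF hermitian_square_one p] .
  have grow: "norm (p * (1 + p) ^ n) \<le> 1" for n
  proof -
    have swap: "(1 - q) ^ n * d = d * (1 + p) ^ n"
    proof (induction n)
      case (Suc n)
      have "(1 - q) ^ Suc n * d = (1 - q) * d * (1 + p) ^ n"
        by (simp add: Suc mult.assoc)
      also have "(1 - q) * d = d * (1 + p)" by (simp add: p_def q_def algebra_simps)
      finally show ?case by (simp add: mult.assoc)
    qed simp
    have "norm ((1 - q) ^ n) \<le> 1"
      using norm_power_ineq[of "1 - q" n] power_le_one[OF norm_ge_zero nq, of n] by linarith
    then have "norm (adj d * ((1 - q) ^ n * d)) \<le> 1"
      using norm_mult_ineq[of "adj d" "(1 - q) ^ n * d"] norm_mult_ineq[of "(1 - q) ^ n" d] nd by simp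
    moreover have "adj d * ((1 - q) ^ n * d) = - (p * (1 + p) ^ n)"
      unfolding swap by (simp add: p_def mult.assoc)
    ultimately show ?thesis by simp
  qed
  have comm: "(1 + p) ^ n * p = p * (1 + p) ^ n" for n
    by (rule power_commuting_commutes) (simp add: distrib_left distrib_right)
  \<comment> \<open>The part of the binomial expansion of \<open>p * (1 + p)^n\<close> beyond its first two terms.\<close>
  define D where "D n = p * (1 + p) ^ n - p - real n *\<^sub>R (p * p)" for n
  have "D n * p = p * D n" for n
    by (simp add: D_def left_diff_distrib right_diff_distrib mult.assoc comm)
  then have Dcomm: "D n * (1 + p) = (1 + p) * D n" for n
    by (simp add: distrib_left distrib_right)
  have D: "hermitian_square (D n)" for n
  proof (induction n)
    case 0 then show ?case
      by (simp add: D_def) (auto simp: hermitian_square_def intro: exI[of _ 0])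
  next
    case (Suc n)
    have "D (Suc n) = D n * (1 + p) + real n *\<^sub>R (p * (p * p))"
      unfolding D_def power_Suc2 by (simp add: algebra_simps)
    moreover have "hermitian_square (D n * (1 + p))"
      by (rule hermitian_square_commuting_mult[OF Suc p1 Dcomm])
    moreover have "hermitian_square (p * (p * p))"
      by (intro hermitian_square_commuting_mult p hermitian_square_square hp) (simp add: mult.assoc)
    ultimately show ?case by (simp add: hermitian_square_add hermitian_square_scaleR)
  qed
  have "real n * norm (p * p) \<le> 1" for n
  proof -
    have "p * (1 + p) ^ n - real n *\<^sub>R (p * p) = D n + p" by (simp add: D_def)
    then have "hermitian_square (p * (1 + p) ^ n - real n *\<^sub>R (p * p))"
      using hermitian_square_add[OF D p] by simp
    then have "norm (real n *\<^sub>R (p * p)) \<le> norm (p * (1 + p) ^ n)"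
      by (intro hermitian_square_norm_mono hermitian_square_scaleR hermitian_square_square hp) simp_all
    then show ?thesis using grow[of n] by simp
  qed
  then have "norm (p * p) \<le> 0"
    by (metis linorder_not_le reals_Archimedean3)
  then have "norm p = 0" using hermitian_norm_square[OF hp] by simp
  then have "norm (adj d * d) = 0" by (simp add: p_def)
  then show False using cstar_identity[of d] nd by simp
qed

text \<open>
  With \<open>r\<close> the absolute value of \<open>a = adj b * b\<close> and \<open>m = r - a\<close>, the element \<open>c = b * m\<close> has
  \<open>adj c * c = - r * m * m\<close>, so it vanishes, and this forces \<open>m = 0\<close>.
\<close>

theorem cstar_pos_iff_hermitian_square:
  fixes a :: "'a::unital_cstar_algebra"
  shows "cstar_pos a \<longleftrightarrow> hermitian_square a"
proof
  assume "hermitian_square a"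
  then show "cstar_pos a" unfolding hermitian_square_def cstar_pos_def by metis
next
  assume "cstar_pos a"
  then obtain b where b: "a = adj b * b" by (auto simp: cstar_pos_def)
  have ha: "adj a = a" by (simp add: b adj_mult adj_adj)
  obtain r where r: "hermitian_square r" "a * a = r * r"
      "\<And>z. a * a * z = z * (a * a) \<Longrightarrow> r * z = z * r"
    using hermitian_square_positive_root[OF hermitian_square_square[OF ha]] by metis
  have ra: "r * a = a * r" by (rule r(3)) (simp add: mult.assoc)
  define m where "m = r - a"
  have hm: "adj m = m" using r(1) ha by (simp add: m_def adj_diff hermitian_square_hermitian)
  have rm: "r * m = m * r" by (simp add: m_def left_diff_distrib right_diff_distrib ra)
  have am: "a * m = - (r * m)" by (simp add: m_def right_diff_distrib ra r(2))
  have mm: "m * m = 2 *\<^sub>R (r * m)"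
    by (simp add: m_def left_diff_distrib right_diff_distrib ra r(2) scaleR_2)
  have "adj (b * m) * (b * m) = m * (a * m)" by (simp add: adj_mult hm b mult.assoc)
  also have "\<dots> = - (m * r * m)" by (simp add: am mult.assoc)
  also have "\<dots> = - (r * (m * m))" by (simp add: rm[symmetric] mult.assoc)
  finally have e: "- (adj (b * m) * (b * m)) = r * (m * m)" by simp
  have "r * (m * m) = (m * m) * r" by (metis rm mult.assoc)
  then have "hermitian_square (r * (m * m))"
    by (intro hermitian_square_commuting_mult r(1) hermitian_square_square hm)
  then have "b * m = 0" using no_negative_adj_mult[of "b * m"] e by simp
  then have rmm: "r * (m * m) = 0" using e by simp
  have "m * m * (m * m) = 2 *\<^sub>R (r * m) * (m * m)" by (subst (1) mm) (rule refl)
  also have "\<dots> = 2 *\<^sub>R (r * (m * m) * m)" by (simp add: mult.assoc)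
  finally have "m * m * (m * m) = 2 *\<^sub>R (r * (m * m) * m)" .
  then have "m * m * (m * m) = 0" using rmm by simp
  then have "norm (m * m) = 0"
    using hermitian_norm_square[of "m * m"] hm by (simp add: adj_mult)
  then have "m = 0" using hermitian_norm_square[OF hm] by simp
  then show "hermitian_square a" using r(1) by (simp add: m_def)
qed

section \<open>The unitization of a C*-algebra\<close>

text \<open>
  The norm makes \<open>Unitz a c\<close> act on the direct sum of the algebra (by left multiplication) and of
  the complex numbers (by \<open>c\<close>).  The second summand makes it a norm even when the algebra already
  has a unit; the algebra is then an ideal of codimension one in all cases.
\<close>

datatype 'a unitz = Unitz (upart: 'a) (uscal: complex)

definition lmult :: "'a::cstar_algebra unitz \<Rightarrow> 'a \<Rightarrow> 'a" where
  "lmult x b = upart x * b + uscal x *\<^sub>C b"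

lemma bounded_linear_scaleC: "bounded_linear (\<lambda>x::'a::complex_normed_vector. c *\<^sub>C x)"
  by (rule bounded_linear_intro[where K="cmod c"])
     (simp_all add: scaleC_add_right scaleC_scaleR norm_scaleC mult.commute)

lemma bounded_linear_lmult: "bounded_linear (lmult x)"
  unfolding lmult_def
  by (intro bounded_linear_add bounded_linear_mult_right bounded_linear_scaleC)

text \<open>By the C*-identity, left multiplication by \<open>a\<close> attains its norm at \<open>adj a\<close>.\<close>

lemma norm_upart_le: "norm (upart x) \<le> onorm (lmult x) + cmod (uscal x)"
proof (cases "upart x = 0")
  case True
  then show ?thesis using onorm_pos_le[OF bounded_linear_lmult[of x]] by simp
next
  case False
  let ?a = "upart x"
  have "norm ?a * norm ?a = norm (lmult x (adj ?a) - uscal x *\<^sub>C adj ?a)"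
    using cstar_identity'[of ?a] by (simp add: lmult_def power2_eq_square)
  also have "\<dots> \<le> onorm (lmult x) * norm ?a + cmod (uscal x) * norm ?a"
    using norm_triangle_ineq4[of "lmult x (adj ?a)" "uscal x *\<^sub>C adj ?a"]
      onorm[OF bounded_linear_lmult, of x "adj ?a"] by (simp add: norm_scaleC)
  also have "\<dots> = (onorm (lmult x) + cmod (uscal x)) * norm ?a" by (simp add: distrib_right)
  finally show ?thesis using False by simp
qed

lemma onorm_lmult_le: "onorm (lmult x) \<le> norm (upart x) + cmod (uscal x)"
proof (rule onorm_bound)
  show "norm (lmult x b) \<le> (norm (upart x) + cmod (uscal x)) * norm b" for b
    using norm_triangle_ineq[of "upart x * b" "uscal x *\<^sub>C b"] norm_mult_ineq[of "upart x" b]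
    by (simp add: lmult_def norm_scaleC distrib_right)
qed simp

instantiation unitz :: (cstar_algebra) real_normed_vector
begin

definition zero_unitz where "zero_unitz = Unitz 0 0"
definition plus_unitz where "x + y = Unitz (upart x + upart y) (uscal x + uscal y)"
definition uminus_unitz where "- x = Unitz (- upart x) (- uscal x)"
definition minus_unitz where "x - y = Unitz (upart x - upart y) (uscal x - uscal y)"
definition scaleR_unitz where "r *\<^sub>R x = Unitz (r *\<^sub>R upart x) (r *\<^sub>R uscal x)"
definition norm_unitz where "norm x = max (cmod (uscal x)) (onorm (lmult x))"
definition dist_unitz where "dist x y = norm (x - y :: 'a unitz)"
definition sgn_unitz where "sgn x = inverse (norm x) *\<^sub>R (x :: 'a unitz)"
definition uniformity_unitz where
  "(uniformity :: ('a unitz \<times> 'a unitz) filter) = (INF e\<in>{0 <..}. principal {(x, y). dist x y < e})"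
definition open_unitz where
  "open (U :: 'a unitz set) \<longleftrightarrow> (\<forall>x\<in>U. eventually (\<lambda>(x', y). x' = x \<longrightarrow> y \<in> U) uniformity)"

lemma unitz_vector_sel [simp]:
  "upart (0::'a unitz) = 0" "uscal (0::'a unitz) = 0"
  "upart (x + y) = upart x + upart y" "uscal (x + y) = uscal x + uscal y"
  "upart (- x) = - upart x" "uscal (- x) = - uscal x"
  "upart (x - y) = upart x - upart y" "uscal (x - y) = uscal x - uscal y"
  "upart (r *\<^sub>R x) = r *\<^sub>R upart x" "uscal (r *\<^sub>R x) = r *\<^sub>R uscal x"
  for x y :: "'a unitz"
  by (simp_all add: zero_unitz_def plus_unitz_def uminus_unitz_def minus_unitz_def scaleR_unitz_def)

instance
proof
  fix x y z :: "'a unitz" and r s :: real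
  show "x + y + z = x + (y + z)" "x + y = y + x" "0 + x = x" "- x + x = 0" "x - y = x + - y"
    "r *\<^sub>R (x + y) = r *\<^sub>R x + r *\<^sub>R y" "(r + s) *\<^sub>R x = r *\<^sub>R x + s *\<^sub>R x"
    "r *\<^sub>R s *\<^sub>R x = (r * s) *\<^sub>R x" "1 *\<^sub>R x = x"
    by (simp_all add: unitz.expand scaleR_add_right scaleR_add_left)
  show "norm x = 0 \<longleftrightarrow> x = 0"
  proof
    assume "norm x = 0"
    then have "cmod (uscal x) \<le> 0" "onorm (lmult x) \<le> 0" by (simp_all add: norm_unitz_def max_def split: if_splits)
    moreover have "norm (upart x) \<le> 0" using norm_upart_le[of x] calculation by linarith
    ultimately show "x = 0" by (intro unitz.expand) simp
  next
    assume "x = 0"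
    then show "norm x = 0"
      using onorm_lmult_le[of x] onorm_pos_le[OF bounded_linear_lmult[of x]] by (simp add: norm_unitz_def)
  qed
  have "lmult (x + y) = (\<lambda>b. lmult x b + lmult y b)"
    by (simp add: lmult_def fun_eq_iff distrib_right scaleC_add_left)
  then have "onorm (lmult (x + y)) \<le> onorm (lmult x) + onorm (lmult y)"
    using onorm_triangle[OF bounded_linear_lmult bounded_linear_lmult] by metis
  then show "norm (x + y) \<le> norm x + norm y"
    using norm_triangle_ineq[of "uscal x" "uscal y"] by (simp add: norm_unitz_def max_def)
  have "lmult (r *\<^sub>R x) = (\<lambda>b. r *\<^sub>R lmult x b)"
    by (simp add: lmult_def fun_eq_iff scaleC_add_right scaleC_of_real[symmetric] scaleC_mult_left scaleC_scaleC
        scaleR_conv_of_real)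
  then have "onorm (lmult (r *\<^sub>R x)) = \<bar>r\<bar> * onorm (lmult x)"
    using onorm_scaleR[OF bounded_linear_lmult] by metis
  then show "norm (r *\<^sub>R x) = \<bar>r\<bar> * norm x"
    by (simp add: norm_unitz_def max_mult_distrib_left)
qed (simp_all add: dist_unitz_def sgn_unitz_def uniformity_unitz_def open_unitz_def)

end

instantiation unitz :: (cstar_algebra) complex_normed_vector
begin

definition scaleC_unitz where "c *\<^sub>C x = Unitz (c *\<^sub>C upart x) (c * uscal x)"

lemma unitz_scaleC_sel [simp]:
  "upart (c *\<^sub>C x) = c *\<^sub>C upart x" "uscal (c *\<^sub>C x) = c * uscal x" for x :: "'a unitz"
  by (simp_all add: scaleC_unitz_def)

instance
proof
  fix x y :: "'a unitz" and c d :: complex and r :: real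
  show "complex_of_real r *\<^sub>C x = r *\<^sub>R x" "c *\<^sub>C (x + y) = c *\<^sub>C x + c *\<^sub>C y"
    "(c + d) *\<^sub>C x = c *\<^sub>C x + d *\<^sub>C x" "c *\<^sub>C d *\<^sub>C x = (c * d) *\<^sub>C x"
    by (simp_all add: unitz.expand scaleC_of_real scaleC_add_left scaleC_add_right scaleC_scaleC
        distrib_left distrib_right scaleR_conv_of_real)
  have le: "norm (c *\<^sub>C y) \<le> cmod c * norm y" for c and y :: "'a unitz"
  proof -
    have "onorm (lmult (c *\<^sub>C y)) \<le> cmod c * onorm (lmult y)"
    proof (rule onorm_bound)
      fix b
      have "lmult (c *\<^sub>C y) b = c *\<^sub>C lmult y b"
        by (simp add: lmult_def scaleC_add_right scaleC_mult_left scaleC_scaleC)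
      then show "norm (lmult (c *\<^sub>C y) b) \<le> cmod c * onorm (lmult y) * norm b"
        using onorm[OF bounded_linear_lmult[of y], of b]
        by (simp add: norm_scaleC mult.assoc mult_left_mono)
    qed (simp add: onorm_pos_le bounded_linear_lmult)
    then show ?thesis by (simp add: norm_unitz_def norm_mult max_mult_distrib_left)
  qed
  show "norm (c *\<^sub>C x) = cmod c * norm x"
  proof (cases "c = 0")
    case True
    then show ?thesis using le[of 0 x] by simp
  next
    case False
    have "x = inverse c *\<^sub>C (c *\<^sub>C x)"
      using False by (intro unitz.expand) (simp add: scaleC_scaleC)
    then have "norm x \<le> inverse (cmod c) * norm (c *\<^sub>C x)"
      using le[of "inverse c" "c *\<^sub>C x"] by (simp add: norm_inverse)
    then show ?thesis using le[of c x] False by (simp add: field_simps)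
  qed
qed

end

lemma norm_uscal_le: "cmod (uscal x) \<le> norm x"
  by (simp add: norm_unitz_def)

lemma norm_upart_le': "norm (upart x) \<le> 2 * norm x"
  using norm_upart_le[of x] by (auto simp: norm_unitz_def)

lemma norm_unitz_le: "norm x \<le> norm (upart x) + cmod (uscal x)"
  using onorm_lmult_le[of x] by (auto simp: norm_unitz_def)

lemma bounded_linear_upart: "bounded_linear (upart :: 'a::cstar_algebra unitz \<Rightarrow> 'a)"
  by (rule bounded_linear_intro[where K=2]) (use norm_upart_le' in \<open>auto simp: mult.commute\<close>)

lemma bounded_linear_uscal: "bounded_linear (uscal :: 'a::cstar_algebra unitz \<Rightarrow> complex)"
  by (rule bounded_linear_intro[where K=1]) (use norm_uscal_le in auto)

instance unitz :: (cstar_algebra) complex_banach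
proof
  fix X :: "nat \<Rightarrow> 'a unitz" assume X: "Cauchy X"
  have "Cauchy (\<lambda>n. upart (X n))" "Cauchy (\<lambda>n. uscal (X n))"
    by (rule bounded_linear.Cauchy[OF bounded_linear_upart X] bounded_linear.Cauchy[OF bounded_linear_uscal X])+
  then obtain a c where a: "(\<lambda>n. upart (X n)) \<longlonglongrightarrow> a" and c: "(\<lambda>n. uscal (X n)) \<longlonglongrightarrow> c"
    by (auto simp: Cauchy_convergent_iff convergent_def)
  have lim: "(\<lambda>n. norm (upart (X n) - a) + norm (uscal (X n) - c)) \<longlonglongrightarrow> 0"
    using tendsto_add[OF tendsto_norm_zero[OF LIM_zero[OF a]] tendsto_norm_zero[OF LIM_zero[OF c]]]
    by simp
  have "norm (X n - Unitz a c) \<le> norm (upart (X n) - a) + norm (uscal (X n) - c)" for n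
    using norm_unitz_le[of "X n - Unitz a c"] by simp
  then have "(\<lambda>n. X n - Unitz a c) \<longlonglongrightarrow> 0"
    by (intro Lim_null_comparison[OF _ lim] always_eventually allI)
  then show "convergent X" unfolding convergent_def by (blast intro: LIM_zero_cancel)
qed

instantiation unitz :: (cstar_algebra) real_normed_algebra_1
begin

definition times_unitz where
  "x * y = Unitz (upart x * upart y + uscal x *\<^sub>C upart y + uscal y *\<^sub>C upart x) (uscal x * uscal y)"
definition one_unitz where "1 = Unitz 0 1"

lemma unitz_times_sel [simp]:
  "upart (x * y) = upart x * upart y + uscal x *\<^sub>C upart y + uscal y *\<^sub>C upart x"
  "uscal (x * y) = uscal x * uscal y" "upart (1::'a unitz) = 0" "uscal (1::'a unitz) = 1" for x y :: "'a unitz"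
  by (simp_all add: times_unitz_def one_unitz_def)

instance
proof
  fix x y z :: "'a unitz" and r :: real
  note s = unitz.expand scaleC_add_right scaleC_add_left scaleC_scaleC scaleC_mult_left scaleC_mult_right
      distrib_left distrib_right scaleC_scaleR
  show "x * y * z = x * (y * z)" by (simp add: s mult.assoc ac_simps)
  show "(x + y) * z = x * z + y * z" "x * (y + z) = x * y + x * z" by (simp_all add: s)
  show "r *\<^sub>R x * y = r *\<^sub>R (x * y)" "x * r *\<^sub>R y = r *\<^sub>R (x * y)"
    by (simp_all add: s scaleC_of_real[symmetric] scaleR_conv_of_real mult.commute)
  show "1 * x = x" "x * 1 = x" by (simp_all add: s)
  show "(0::'a unitz) \<noteq> 1" by (metis unitz_times_sel(4) unitz_vector_sel(2) zero_neq_one)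
  have "lmult (x * y) = lmult x \<circ> lmult y"
    by (simp add: fun_eq_iff lmult_def s mult.assoc)
  then have "onorm (lmult (x * y)) \<le> onorm (lmult x) * onorm (lmult y)"
    using onorm_compose[OF bounded_linear_lmult bounded_linear_lmult] by metis
  also have "\<dots> \<le> norm x * norm y"
    by (intro mult_mono) (auto simp: norm_unitz_def onorm_pos_le bounded_linear_lmult le_max_iff_disj)
  finally show "norm (x * y) \<le> norm x * norm y"
    by (auto simp: norm_unitz_def norm_mult intro!: mult_mono le_max_iff_disj[THEN iffD2])
  show "norm (1::'a unitz) = 1"
    using onorm_lmult_le[of "1::'a unitz"] by (simp add: norm_unitz_def max_def)
qed

end

instantiation unitz :: (cstar_algebra) unital_cstar_algebra
begin

definition adj_unitz where "adj x = Unitz (adj (upart x)) (cnj (uscal x))"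

lemma unitz_adj_sel [simp]:
  "upart (adj x) = adj (upart x)" "uscal (adj x) = cnj (uscal x)" for x :: "'a unitz"
  by (simp_all add: adj_unitz_def)

instance
proof
  fix x y :: "'a unitz" and c :: complex
  note s = unitz.expand scaleC_add_right scaleC_add_left scaleC_scaleC scaleC_mult_left scaleC_mult_right
      distrib_left distrib_right scaleC_scaleR adj_adj adj_add adj_mult adj_scaleC
  show "c *\<^sub>C x * y = c *\<^sub>C (x * y)" "x * c *\<^sub>C y = c *\<^sub>C (x * y)" "adj (adj x) = x"
    "adj (x + y) = adj x + adj y" "adj (c *\<^sub>C x) = cnj c *\<^sub>C adj x" "adj (x * y) = adj y * adj x"
    by (simp_all add: s mult.commute)
  have ge: "(norm y)\<^sup>2 \<le> norm (adj y * y)" for y :: "'a unitz"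
  proof -
    let ?N = "norm (adj y * y)"
    have "norm (lmult y b) \<le> sqrt ?N * norm b" for b
    proof (rule power2_le_imp_le)
      have "(norm (lmult y b))\<^sup>2 = norm (adj b * lmult (adj y * y) b)"
        unfolding cstar_identity[symmetric]
        by (simp add: lmult_def s mult.assoc add.assoc mult.commute[of "cnj (uscal y)"])
      also have "\<dots> \<le> norm b * (onorm (lmult (adj y * y)) * norm b)"
        using norm_mult_ineq[of "adj b" "lmult (adj y * y) b"]
          mult_left_mono[OF onorm[OF bounded_linear_lmult, of "adj y * y" b] norm_ge_zero[of b]] by simp
      also have "\<dots> \<le> norm b * (?N * norm b)"
        by (intro mult_left_mono mult_right_mono) (simp_all add: norm_unitz_def)
      finally show "(norm (lmult y b))\<^sup>2 \<le> (sqrt ?N * norm b)\<^sup>2"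
        by (simp add: power_mult_distrib power2_eq_square mult.assoc mult.left_commute mult.commute)
    qed simp
    then have "onorm (lmult y) \<le> sqrt ?N" by (rule onorm_bound[rotated]) simp
    moreover have "cmod (uscal y) \<le> sqrt ?N"
      using norm_uscal_le[of "adj y * y"] by (intro real_le_rsqrt) (simp add: norm_mult power2_eq_square)
    ultimately have "norm y \<le> sqrt ?N" by (simp add: norm_unitz_def)
    then have "(norm y)\<^sup>2 \<le> (sqrt ?N)\<^sup>2" by (intro power_mono) simp_all
    then show ?thesis by simp
  qed
  have le: "norm y \<le> norm (adj y)" for y :: "'a unitz"
  proof (cases "norm y = 0")
    case False
    have "norm y * norm y \<le> norm (adj y) * norm y"
      using ge[of y] norm_mult_ineq[of "adj y" y] by (simp add: power2_eq_square)
    then show ?thesis using False by simp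
  qed simp
  have "adj (adj x) = x" by (simp add: s)
  then have "norm (adj x) = norm x" using le[of x] le[of "adj x"] by simp
  then show "norm (adj x * x) = (norm x)\<^sup>2"
    using ge[of x] norm_mult_ineq[of "adj x" x] by (simp add: power2_eq_square)
qed

end

definition unitz_of :: "'a::cstar_algebra \<Rightarrow> 'a unitz" where
  "unitz_of a = Unitz a 0"

lemma unitz_of_sel [simp]: "upart (unitz_of a) = a" "uscal (unitz_of a) = 0"
  by (simp_all add: unitz_of_def)

lemma unitz_of_upart: "uscal x = 0 \<Longrightarrow> unitz_of (upart x) = x"
  by (simp add: unitz_of_def unitz.expand)

lemma unitz_of_eq_iff [simp]: "unitz_of a = unitz_of b \<longleftrightarrow> a = b"
  by (simp add: unitz_of_def)

lemma unitz_of_0 [simp]: "unitz_of 0 = 0"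
  by (intro unitz.expand) simp

lemma unitz_of_simps:
  "unitz_of (a + b) = unitz_of a + unitz_of b" "unitz_of (a - b) = unitz_of a - unitz_of b"
  "unitz_of (a * b) = unitz_of a * unitz_of b" "unitz_of (adj a) = adj (unitz_of a)"
  "unitz_of (r *\<^sub>R a) = r *\<^sub>R unitz_of a" "unitz_of (c *\<^sub>C a) = c *\<^sub>C unitz_of a"
  "unitz_of (- a) = - unitz_of a"
  by (simp_all add: unitz.expand)

lemma norm_unitz_of [simp]: "norm (unitz_of a) = norm a"
proof (rule antisym)
  show "norm (unitz_of a) \<le> norm a" using norm_unitz_le[of "unitz_of a"] by simp
  show "norm a \<le> norm (unitz_of a)"
    using norm_upart_le[of "unitz_of a"] by (simp add: norm_unitz_def)
qed

lemma bounded_linear_unitz_of: "bounded_linear unitz_of"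
  by (rule bounded_linear_intro[where K=1]) (simp_all add: unitz_of_simps)

lemma unitz_of_ideal:
  "uscal x = 0 \<Longrightarrow> uscal (x * y) = 0" "uscal x = 0 \<Longrightarrow> uscal (y * x) = 0"
  by simp_all

section \<open>The order of a C*-algebra\<close>

lemma cstar_pos_unitz_of: "cstar_pos (unitz_of a) \<longleftrightarrow> cstar_pos a"
proof
  assume "cstar_pos a"
  then show "cstar_pos (unitz_of a)" unfolding cstar_pos_def by (metis unitz_of_simps(3,4))
next
  assume "cstar_pos (unitz_of a)"
  then obtain b where b: "adj b = b" "unitz_of a = b * b"
    unfolding cstar_pos_iff_hermitian_square hermitian_square_def by blast
  \<comment> \<open>The scalar part of the root vanishes, so the root lies in the algebra itself.\<close>
  have "uscal b * uscal b = 0" using arg_cong[OF b(2), of uscal] by simp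
  then have "unitz_of (upart b) = b" by (simp add: unitz_of_upart)
  then have "unitz_of a = unitz_of (adj (upart b) * upart b)" using b by (simp add: unitz_of_simps)
  then show "cstar_pos a" unfolding cstar_pos_def by auto
qed

lemma cstar_pos_add:
  assumes "cstar_pos a" "cstar_pos b" shows "cstar_pos (a + b)"
proof -
  have "cstar_pos (unitz_of a + unitz_of b)"
    using assms hermitian_square_add[folded cstar_pos_iff_hermitian_square] cstar_pos_unitz_of by blast
  then show ?thesis unfolding unitz_of_simps[symmetric] cstar_pos_unitz_of .
qed

lemma cstar_pos_sum: "(\<And>i. i \<in> A \<Longrightarrow> cstar_pos (f i)) \<Longrightarrow> cstar_pos (sum f A)"
  by (induction A rule: infinite_finite_induct) (auto intro: cstar_pos_add)

lemma cstar_pos_adj_mult: "cstar_pos (adj b * b)"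
  unfolding cstar_pos_def by blast

lemma cstar_pos_mult_adj: "cstar_pos (b * adj b)"
  using cstar_pos_adj_mult[of "adj b"] by (simp add: adj_adj)

text \<open>In the unitization, positivity is the closed condition \<open>norm (norm x - x) \<le> norm x\<close>.\<close>

lemma closed_cstar_pos: "closed {a::'a::cstar_algebra. cstar_pos a}"
proof -
  have "closed {x::'a unitz. adj x = x \<and> norm (norm x *\<^sub>R 1 - x) \<le> norm x}"
    by (intro closed_Collect_conj closed_Collect_eq closed_Collect_le continuous_intros
        bounded_linear.continuous_on[OF bounded_linear_adj])
  moreover have "adj x = x \<and> norm (norm x *\<^sub>R 1 - x) \<le> norm x \<longleftrightarrow> cstar_pos x" for x :: "'a unitz"
    unfolding cstar_pos_iff_hermitian_square
    using hermitian_square_iff[of x] hermitian_square_norm_diff_le[of x "norm x"] norm_ge_zero[of x] by blast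
  ultimately have "closed {x::'a unitz. cstar_pos x}" by simp
  then have "closed (unitz_of -` {x::'a unitz. cstar_pos x})"
    by (rule closed_vimage) (intro bounded_linear.continuous_on[OF bounded_linear_unitz_of] continuous_intros)
  then show ?thesis by (simp add: vimage_def cstar_pos_unitz_of)
qed

lemma cstar_pos_limit:
  assumes "(f \<longlongrightarrow> l) F" "F \<noteq> bot" "eventually (\<lambda>x. cstar_pos (f x)) F" shows "cstar_pos l"
  using Lim_in_closed_set[OF closed_cstar_pos _ assms(2,1)] assms(3) by simp

lemma cstar_le_refl [simp]: "a \<preceq> a"
  by (simp add: cstar_le_def)

lemma cstar_le_trans: "a \<preceq> b \<Longrightarrow> b \<preceq> c \<Longrightarrow> a \<preceq> c"
  unfolding cstar_le_def using cstar_pos_add[of "b - a" "c - b"] by simp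

lemma cstar_le_sum: "(\<And>i. i \<in> A \<Longrightarrow> f i \<preceq> g i) \<Longrightarrow> sum f A \<preceq> sum g A"
  unfolding cstar_le_def by (simp add: sum_subtractf[symmetric] cstar_pos_sum)

lemma cstar_le_scaleR: "a \<preceq> b \<Longrightarrow> r \<ge> 0 \<Longrightarrow> r *\<^sub>R a \<preceq> r *\<^sub>R b"
  unfolding cstar_le_def using cstar_pos_scaleR[of "b - a" r] by (simp add: scaleR_diff_right)

lemma cstar_le_scaleR_left: "cstar_pos a \<Longrightarrow> r \<le> s \<Longrightarrow> r *\<^sub>R a \<preceq> s *\<^sub>R a"
  unfolding cstar_le_def using cstar_pos_scaleR[of a "s - r"] by (simp add: scaleR_diff_left)

lemma cstar_le_norm:
  assumes "cstar_pos a" "a \<preceq> b" shows "norm a \<le> norm b"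
proof -
  have "cstar_pos (unitz_of b - unitz_of a)" "cstar_pos (unitz_of a)"
    using assms by (simp_all add: cstar_le_def cstar_pos_unitz_of unitz_of_simps(2)[symmetric])
  then show ?thesis
    using hermitian_square_norm_mono[folded cstar_pos_iff_hermitian_square, of "unitz_of a" "unitz_of b"] by simp
qed

lemma cstar_le_sum_subset:
  assumes "finite B" "A \<subseteq> B" "\<And>i. i \<in> B - A \<Longrightarrow> cstar_pos (f i)" shows "sum f A \<preceq> sum f B"
  using assms cstar_pos_sum[of "B - A" f] by (simp add: cstar_le_def sum_diff)

text \<open>In the unitization \<open>a\<close> lies below the scalar \<open>t\<close>, and conjugation preserves the order.\<close>

lemma cstar_conj_le:
  assumes "cstar_pos a" "norm a \<le> t" shows "adj c * a * c \<preceq> t *\<^sub>R (adj c * c)"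
proof -
  have "cstar_pos (t *\<^sub>R 1 - unitz_of a)"
    unfolding cstar_pos_iff_hermitian_square hermitian_square_iff
    using assms cstar_pos_hermitian[OF assms(1)] order_trans[OF norm_ge_zero assms(2)]
    by (intro conjI exI[of _ t]) (simp_all add: adj_diff adj_scaleR unitz_of_simps(4)[symmetric])
  from cstar_pos_conj[OF this, of "unitz_of c"]
  have "cstar_pos (unitz_of (t *\<^sub>R (adj c * c) - adj c * a * c))"
    by (simp add: unitz_of_simps left_diff_distrib right_diff_distrib)
  then show ?thesis by (simp add: cstar_le_def cstar_pos_unitz_of)
qed

lemma norm_le_of_cstar_le_scaleR:
  assumes "cstar_pos a" "a \<preceq> r *\<^sub>R b" "r \<ge> 0" shows "norm a \<le> r * norm b"
  using cstar_le_norm[OF assms(1,2)] assms(3) by simp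

section \<open>Polynomials in a positive contraction and approximate units\<close>

lemmas cstar_pos_commuting_mult =
  hermitian_square_commuting_mult[folded cstar_pos_iff_hermitian_square]
lemmas cstar_pos_1_minus = hermitian_square_1_minus[folded cstar_pos_iff_hermitian_square]
lemmas cstar_pos_norm_le_1 = hermitian_square_norm_le_1[folded cstar_pos_iff_hermitian_square]
lemmas cstar_pos_one = hermitian_square_one[folded cstar_pos_iff_hermitian_square]
lemmas cstar_pos_root = hermitian_square_positive_root[folded cstar_pos_iff_hermitian_square]

lemma cstar_pos_power:
  fixes v :: "'a::unital_cstar_algebra"
  assumes "cstar_pos v" shows "cstar_pos (v ^ n)"
proof (induction n)
  case (Suc n)
  show ?case using cstar_pos_commuting_mult[OF assms Suc] by (simp add: power_commutes)
qed (simp add: cstar_pos_one)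

lemma sum_power_1_minus:
  fixes w :: "'a::ring_1"
  shows "w * (\<Sum>k<n. (1 - w) ^ k) = 1 - (1 - w) ^ n"
  by (induction n) (simp_all add: algebra_simps)

text \<open>
  The scalar bound \<open>w * (1 - w)^n \<le> 1 / (n + 1)\<close> on \<open>[0, 1]\<close>: the sum of the \<open>n + 1\<close> decreasing
  terms \<open>w * (1 - w)^k\<close>, \<open>k \<le> n\<close>, is at most 1.
\<close>

lemma norm_mult_power_1_minus_le:
  fixes w :: "'a::unital_cstar_algebra"
  assumes w: "cstar_pos w" "norm w \<le> 1"
  shows "cstar_pos (w * (1 - w) ^ n)" "norm (w * (1 - w) ^ n) \<le> 1 / (real n + 1)"
proof -
  define v where "v = 1 - w"
  have v: "cstar_pos v" unfolding v_def using w by (intro cstar_pos_1_minus) (simp_all add: cstar_pos_hermitian)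
  have wv: "w * v ^ k = v ^ k * w" for k
    by (rule power_commuting_commutes[symmetric]) (simp add: v_def left_diff_distrib right_diff_distrib)
  have pos: "cstar_pos (w * v ^ k)" for k
    by (intro cstar_pos_commuting_mult w cstar_pos_power v wv)
  have "cstar_pos (1 - v ^ Suc k - (real k + 1) *\<^sub>R (w * v ^ k))" for k
  proof (induction k)
    case 0 then show ?case by (simp add: v_def)
  next
    case (Suc k)
    have ww: "cstar_pos (w * (w * v ^ k))"
      by (rule cstar_pos_commuting_mult[OF w(1) pos]) (simp add: wv[symmetric] mult.assoc)
    have e: "v * x = x - w * x" for x by (simp add: v_def left_diff_distrib)
    have "1 - v ^ Suc (Suc k) - (real (Suc k) + 1) *\<^sub>R (w * v ^ Suc k)
        = (1 - v ^ Suc k - (real k + 1) *\<^sub>R (w * v ^ k)) + (real k + 1) *\<^sub>R (w * (w * v ^ k))"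
      by (simp add: e right_diff_distrib scaleR_diff_right scaleR_add_left scaleR_2)
    then show ?case
      using cstar_pos_add[OF Suc cstar_pos_scaleR[OF ww, of "real k + 1"]] by (simp only:)
  qed
  from cstar_pos_add[OF this cstar_pos_power[OF v]]
  have "cstar_pos (1 - v ^ Suc n - (real n + 1) *\<^sub>R (w * v ^ n) + v ^ Suc n)" .
  then have "cstar_pos (1 - (real n + 1) *\<^sub>R (w * v ^ n))" by (simp add: algebra_simps)
  then have "norm ((real n + 1) *\<^sub>R (w * v ^ n)) \<le> 1"
    by (intro cstar_pos_norm_le_1 cstar_pos_scaleR pos) simp_all
  then have "(real n + 1) * norm (w * v ^ n) \<le> 1" by simp
  then show "norm (w * (1 - w) ^ n) \<le> 1 / (real n + 1)"
    unfolding v_def by (simp add: field_simps)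
  show "cstar_pos (w * (1 - w) ^ n)" using pos unfolding v_def .
qed

text \<open>
  Take \<open>e = 1 - (1 - h)^n\<close> with \<open>h = adj c * c\<close>: it has no constant term, so it lies in the algebra,
  and the square of \<open>norm (c - c * e)\<close> is the norm of \<open>h * (1 - h)^(2 n)\<close>.
\<close>

lemma approximate_right_unit:
  fixes c :: "'a::cstar_algebra"
  assumes "\<epsilon> > 0"
  obtains e where "norm e \<le> 1" "norm (c - c * e) < \<epsilon>"
proof -
  have unit: "\<exists>e. norm e \<le> 1 \<and> norm (c - c * e) < \<epsilon>"
    if c: "norm c \<le> 1" and \<epsilon>: "\<epsilon> > 0" for c :: 'a and \<epsilon> :: real
  proof -
    define h where "h = unitz_of (adj c * c)"
    have h: "cstar_pos h" unfolding h_def cstar_pos_unitz_of by (rule cstar_pos_adj_mult)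
    have nh: "norm h \<le> 1" using c by (simp add: h_def cstar_identity power_le_one)
    obtain n :: nat where n: "1 / (real n + 1) < \<epsilon>\<^sup>2"
      using \<epsilon> reals_Archimedean[of "\<epsilon>\<^sup>2"] by (auto simp: field_simps)
    define v where "v = 1 - h"
    have v: "cstar_pos v" unfolding v_def using h nh by (intro cstar_pos_1_minus) (simp_all add: cstar_pos_hermitian)
    define E where "E = 1 - v ^ n"
    have Eh: "E = h * (\<Sum>k<n. v ^ k)" unfolding E_def v_def by (rule sum_power_1_minus[symmetric])
    have hv: "h * v = v * h" by (simp add: v_def left_diff_distrib right_diff_distrib)
    have hvk: "h * v ^ k = v ^ k * h" for k
      by (rule power_commuting_commutes[symmetric]) (simp add: hv)
    have "cstar_pos E" unfolding Eh
      by (intro cstar_pos_commuting_mult h cstar_pos_sum cstar_pos_power v)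
         (simp add: sum_distrib_left sum_distrib_right hvk)
    then have nE: "norm E \<le> 1"
      by (intro cstar_pos_norm_le_1) (simp_all add: E_def cstar_pos_power v)
    have "uscal E = 0" unfolding Eh by (intro unitz_of_ideal) (simp add: h_def)
    then have E: "unitz_of (upart E) = E" by (rule unitz_of_upart)
    have "(norm (unitz_of c * v ^ n))\<^sup>2 = norm (v ^ n * (h * v ^ n))"
      unfolding cstar_identity[symmetric]
      by (simp add: adj_mult adj_power cstar_pos_hermitian[OF v] h_def unitz_of_simps mult.assoc)
    also have "v ^ n * (h * v ^ n) = h * v ^ (2 * n)"
      unfolding mult_2 power_add by (metis hvk mult.assoc)
    also have "norm \<dots> \<le> 1 / (real (2 * n) + 1)"
      unfolding v_def by (rule norm_mult_power_1_minus_le(2)[OF h nh])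
    also have "\<dots> \<le> 1 / (real n + 1)" by (simp add: frac_le)
    finally have "(norm (unitz_of c * v ^ n))\<^sup>2 < \<epsilon>\<^sup>2" using n by simp
    then have "norm (unitz_of c * v ^ n) < \<epsilon>" using \<epsilon> by (simp add: power2_less_imp_less)
    moreover have "unitz_of c * v ^ n = unitz_of (c - c * upart E)"
      unfolding unitz_of_simps E by (simp add: E_def right_diff_distrib)
    ultimately show ?thesis
      using nE E norm_unitz_of by metis
  qed
  define t where "t = norm c + 1"
  have t: "t > 0" "norm c \<le> t" by (simp_all add: t_def add_nonneg_pos)
  have "norm ((1/t) *\<^sub>R c) \<le> 1" using t by simp
  then obtain e where e: "norm e \<le> 1" "norm ((1/t) *\<^sub>R c - (1/t) *\<^sub>R c * e) < \<epsilon> / t"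
    using unit[of "(1/t) *\<^sub>R c" "\<epsilon> / t"] t assms by auto
  have "(1/t) *\<^sub>R c - (1/t) *\<^sub>R c * e = (1/t) *\<^sub>R (c - c * e)" by (simp add: scaleR_diff_right)
  then have "norm (c - c * e) / t < \<epsilon> / t" using e(2) t by simp
  then have "norm (c - c * e) < \<epsilon>" using t by (simp add: divide_less_cancel)
  then show ?thesis using that e(1) by blast
qed

section \<open>Existence of states\<close>

text \<open>
  A sublinear functional dominates a linear one: a minimal sublinear functional \<open>q\<close> below it
  exists by Zorn's lemma, and minimality against \<open>slide q y\<close> makes \<open>q\<close> additive.
\<close>

definition sublinear :: "('a::real_vector \<Rightarrow> real) \<Rightarrow> bool" where
  "sublinear q \<longleftrightarrow> (\<forall>x y. q (x + y) \<le> q x + q y) \<and> (\<forall>t>0. \<forall>x. q (t *\<^sub>R x) \<le> t * q x)"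

lemma sublinearD:
  assumes "sublinear q"
  shows "q (x + y) \<le> q x + q y" "q 0 = 0" "t \<ge> 0 \<Longrightarrow> q (t *\<^sub>R x) = t * q x" "- q (- x) \<le> q x"
proof -
  show add: "q (x + y) \<le> q x + q y" for x y using assms by (simp add: sublinear_def)
  have hom: "q (t *\<^sub>R x) \<le> t * q x" if "t > 0" for t x using assms that by (simp add: sublinear_def)
  show z: "q 0 = 0" using add[of 0 0] hom[of "1/2" 0] by simp
  show "q (t *\<^sub>R x) = t * q x" if t: "t \<ge> 0" for t x
  proof (cases "t = 0")
    case False
    then have "q x \<le> (1/t) * q (t *\<^sub>R x)" using hom[of "1/t" "t *\<^sub>R x"] t by simp
    then show ?thesis using False t hom[of t x] by (simp add: field_simps)
  qed (simp add: z)
  show "- q (- x) \<le> q x" using add[of x "- x"] z by simp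
qed

text \<open>
  The largest sublinear functional below \<open>q\<close> whose value at \<open>- y\<close> is at most \<open>- q y\<close>.
\<close>

definition slide :: "('a::real_vector \<Rightarrow> real) \<Rightarrow> 'a \<Rightarrow> 'a \<Rightarrow> real" where
  "slide q y x = (INF t\<in>{0..}. q (x + t *\<^sub>R y) - t * q y)"

lemma slide_le:
  assumes "sublinear q" "t \<ge> 0" shows "slide q y x \<le> q (x + t *\<^sub>R y) - t * q y"
  unfolding slide_def
proof (rule cINF_lower)
  show "bdd_below ((\<lambda>t. q (x + t *\<^sub>R y) - t * q y) ` {0..})"
  proof (rule bdd_belowI2[of _ "- q (- x)"])
    fix t :: real assume "t \<in> {0..}"
    then show "- q (- x) \<le> q (x + t *\<^sub>R y) - t * q y"
      using sublinearD(1)[OF assms(1), of "x + t *\<^sub>R y" "- x"] sublinearD(3)[OF assms(1), of t y] by simp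
  qed
qed (use assms in simp)

lemma sublinear_slide:
  assumes q: "sublinear q" shows "sublinear (slide q y)"
  unfolding sublinear_def
proof (intro conjI allI impI)
  fix x x'
  have "slide q y (x + x') - (q (x + t *\<^sub>R y) - t * q y) \<le> q (x' + s *\<^sub>R y) - s * q y"
    if "t \<ge> 0" "s \<ge> 0" for s t
  proof -
    have "q (x + x' + (t + s) *\<^sub>R y) \<le> q (x + t *\<^sub>R y) + q (x' + s *\<^sub>R y)"
      using sublinearD(1)[OF q, of "x + t *\<^sub>R y" "x' + s *\<^sub>R y"] by (simp add: algebra_simps)
    then show ?thesis using slide_le[OF q, of "t + s" y "x + x'"] that by (simp add: algebra_simps)
  qed
  then have "slide q y (x + x') - (q (x + t *\<^sub>R y) - t * q y) \<le> slide q y x'" if "t \<ge> 0" for t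
    unfolding slide_def[of q y x'] using that by (intro cINF_greatest) auto
  then have "slide q y (x + x') - slide q y x' \<le> q (x + t *\<^sub>R y) - t * q y" if "t \<ge> 0" for t
    using that by (simp add: algebra_simps)
  then have "slide q y (x + x') - slide q y x' \<le> slide q y x"
    unfolding slide_def[of q y x] by (intro cINF_greatest) auto
  then show "slide q y (x + x') \<le> slide q y x + slide q y x'" by simp
next
  fix r :: real and x assume r: "r > 0"
  have "slide q y (r *\<^sub>R x) / r \<le> q (x + t *\<^sub>R y) - t * q y" if "t \<ge> 0" for t
  proof -
    have e: "r *\<^sub>R x + (r * t) *\<^sub>R y = r *\<^sub>R (x + t *\<^sub>R y)" by (simp add: scaleR_add_right)
    have "slide q y (r *\<^sub>R x) \<le> q (r *\<^sub>R (x + t *\<^sub>R y)) - r * t * q y"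
      using slide_le[OF q, of "r * t" y "r *\<^sub>R x"] r that unfolding e by simp
    also have "q (r *\<^sub>R (x + t *\<^sub>R y)) = r * q (x + t *\<^sub>R y)"
      using r by (intro sublinearD(3)[OF q]) simp
    finally have "slide q y (r *\<^sub>R x) \<le> r * (q (x + t *\<^sub>R y) - t * q y)"
      by (simp add: algebra_simps)
    then show ?thesis using r by (simp add: field_simps)
  qed
  then have "slide q y (r *\<^sub>R x) / r \<le> slide q y x"
    unfolding slide_def[of q y x] by (intro cINF_greatest) auto
  then show "slide q y (r *\<^sub>R x) \<le> r * slide q y x" using r by (simp add: field_simps)
qed

lemma linear_below_sublinear:
  assumes p: "sublinear p"
  obtains f where "linear f" "\<And>x. f x \<le> p x"
proof -
  define A where "A = {q. sublinear q \<and> (\<forall>x. q x \<le> p x)}"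
  define P where "P q r \<longleftrightarrow> (\<forall>x. r x \<le> q x)" for q r :: "'a \<Rightarrow> real"
  have "\<exists>m\<in>A. \<forall>q\<in>A. P m q \<longrightarrow> q = m"
  proof (rule predicate_Zorn)
    show "partial_order_on A (relation_of P A)"
      by (rule partial_order_on_relation_ofI) (auto simp: P_def fun_eq_iff intro: order_trans antisym)
  next
    fix C assume C: "C \<in> Chains (relation_of P A)"
    then have CA: "C \<subseteq> A" and tot: "\<And>q r. q \<in> C \<Longrightarrow> r \<in> C \<Longrightarrow> P q r \<or> P r q"
      by (auto simp: Chains_def relation_of_def)
    show "\<exists>u\<in>A. \<forall>q\<in>C. P q u"
    proof (cases "C = {}")
      case True
      then show ?thesis using p by (auto simp: A_def)
    next
      case False
      define u where "u x = (INF q\<in>C. q x)" for x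
      have lower: "u x \<le> q x" if "q \<in> C" for q x
        unfolding u_def
      proof (rule cINF_lower[OF bdd_belowI2[of _ "- p (- x)"] that])
        fix r assume "r \<in> C"
        then have "r \<in> A" using CA by blast
        then show "- p (- x) \<le> r x" using sublinearD(4)[of r x] unfolding A_def
          by (metis (mono_tags, lifting) mem_Collect_eq neg_le_iff_le order_trans)
      qed
      have "u (x + y) \<le> u x + u y" for x y
      proof -
        have *: "u (x + y) \<le> q x + r y" if qr: "q \<in> C" "r \<in> C" for q r
        proof -
          obtain s where s: "s \<in> C" "s x \<le> q x" "s y \<le> r y"
            using tot[OF qr] qr unfolding P_def by blast
          then have "s (x + y) \<le> s x + s y" using CA by (auto simp: A_def sublinear_def)
          then show ?thesis using lower[OF s(1), of "x + y"] s by linarith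
        qed
        have "u (x + y) - q x \<le> u y" if "q \<in> C" for q
          unfolding u_def[of y] using False *[OF that] by (intro cINF_greatest) (auto simp: algebra_simps)
        then have "u (x + y) - u y \<le> u x"
          unfolding u_def[of x] using False by (intro cINF_greatest) (auto simp: algebra_simps)
        then show ?thesis by simp
      qed
      moreover have "u (t *\<^sub>R x) \<le> t * u x" if t: "t > 0" for t x
      proof -
        have "u (t *\<^sub>R x) / t \<le> q x" if "q \<in> C" for q
        proof -
          have "q (t *\<^sub>R x) \<le> t * q x" using that CA t by (auto simp: A_def sublinear_def)
          then have "u (t *\<^sub>R x) \<le> t * q x" using lower[OF that, of "t *\<^sub>R x"] by linarith
          then show ?thesis using t by (simp add: field_simps)
        qed
        then have "u (t *\<^sub>R x) / t \<le> u x" unfolding u_def[of x] using False by (intro cINF_greatest) auto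
        then show ?thesis using t by (simp add: field_simps)
      qed
      ultimately have "sublinear u" by (simp add: sublinear_def)
      moreover obtain q where q: "q \<in> C" using False by blast
      moreover have "u x \<le> p x" for x
      proof -
        have "q x \<le> p x" using q CA by (auto simp: A_def)
        then show ?thesis using lower[OF q, of x] by linarith
      qed
      ultimately show ?thesis using lower by (auto simp: A_def P_def)
    qed
  qed
  then obtain q where q: "sublinear q" "\<And>x. q x \<le> p x" and
    min: "\<And>r. sublinear r \<Longrightarrow> (\<And>x. r x \<le> q x) \<Longrightarrow> r = q"
    by (auto simp: A_def P_def) (meson order_trans)
  have "slide q y = q" for y
    using slide_le[OF q(1), of 0] by (intro min sublinear_slide q) simp
  then have "q x + q y \<le> q (x + y)" for x y
    using slide_le[OF q(1), of 1 y x] by simp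
  then have add: "q (x + y) = q x + q y" for x y
    using sublinearD(1)[OF q(1)] by (simp add: antisym)
  have neg: "q (- x) = - q x" for x using add[of x "- x"] sublinearD(2)[OF q(1)] by simp
  have "linear q"
  proof (rule linearI[OF add])
    show "q (t *\<^sub>R x) = t *\<^sub>R q x" for t x
    proof (cases "t \<ge> 0")
      case False
      then have "q ((- t) *\<^sub>R x) = - t * q x" by (intro sublinearD(3)[OF q(1)]) simp
      then show ?thesis using neg[of "t *\<^sub>R x"] by simp
    qed (simp add: sublinearD(3)[OF q(1)])
  qed
  then show ?thesis using that q(2) by blast
qed

text \<open>A linear functional below \<open>slide norm x\<close> is at most \<open>- norm x\<close> at \<open>- x\<close>.\<close>

lemma norming_functional:
  fixes x :: "'a::real_normed_vector"
  obtains f where "linear f" "\<And>y. f y \<le> norm y" "f x = norm x"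
proof -
  have n: "sublinear (norm :: 'a \<Rightarrow> real)" by (simp add: sublinear_def norm_triangle_ineq)
  obtain f where f: "linear f" "\<And>y. f y \<le> slide norm x y"
    using linear_below_sublinear[OF sublinear_slide[OF n]] by blast
  have le: "f y \<le> norm y" for y using f(2)[of y] slide_le[OF n, of 0 x y] by simp
  have "- f x \<le> - norm x"
    using f(2)[of "- x"] slide_le[OF n, of 1 x "- x"] linear_neg[OF f(1), of x] by simp
  then show ?thesis using that[OF f(1) le] le[of x] by simp
qed

text \<open>
  A real functional \<open>f\<close> of norm one on the unitization with \<open>f (1 + a) = norm (1 + a) = 1 + norm a\<close>
  has \<open>f 1 = 1\<close> and \<open>f a = norm a\<close>.  Norm one and \<open>f 1 = 1\<close> force positivity, because
  \<open>norm (t - b) \<le> t\<close> for positive \<open>b\<close>, and force the complexification to be real on hermitian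
  elements.
\<close>

lemma cstar_state_exists:
  fixes a :: "'a::cstar_algebra"
  assumes a: "cstar_pos a" "a \<noteq> 0"
  obtains \<phi> where "cstar_state \<phi>" "\<phi> a = complex_of_real (norm a)"
proof -
  let ?a = "unitz_of a"
  have pa: "cstar_pos ?a" using a by (simp add: cstar_pos_unitz_of)
  define N where "N = norm (1 + ?a)"
  have "cstar_pos (1 + ?a)" by (intro cstar_pos_add cstar_pos_one pa)
  then have N1: "1 \<le> N"
    using cstar_le_norm[OF cstar_pos_one, of "1 + ?a"] pa by (simp add: cstar_le_def N_def)
  have "norm (N *\<^sub>R 1 - (1 + ?a)) \<le> N"
    unfolding N_def using \<open>cstar_pos (1 + ?a)\<close>
    by (intro hermitian_square_norm_diff_le) (simp_all add: cstar_pos_iff_hermitian_square)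
  then have "cstar_pos (N *\<^sub>R 1 - (1 + ?a))"
    unfolding cstar_pos_iff_hermitian_square hermitian_square_iff
    using \<open>cstar_pos (1 + ?a)\<close> N1 hermitian_square_norm_diff_le[of "1 + ?a"]
    by (intro conjI exI[of _ N])
       (simp_all add: adj_diff adj_scaleR cstar_pos_hermitian N_def add.commute)
  then have "?a \<preceq> (N - 1) *\<^sub>R 1" by (simp add: cstar_le_def algebra_simps)
  then have "norm a \<le> N - 1" using norm_le_of_cstar_le_scaleR[OF pa, of "N - 1" 1] N1 by simp
  obtain f where f: "linear f" "\<And>y. f y \<le> norm y" "f (1 + ?a) = N"
    unfolding N_def using norming_functional by blast
  have f1: "f 1 = 1" and fa: "f ?a = norm a"
    using f(2)[of 1] f(2)[of ?a] f(3) \<open>norm a \<le> N - 1\<close> linear_add[OF f(1), of 1 ?a] by simp_all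
  have f_pos: "f b \<ge> 0" if "cstar_pos b" for b
  proof -
    have "norm (norm b *\<^sub>R 1 - b) \<le> norm b"
      using that by (intro hermitian_square_norm_diff_le) (simp_all add: cstar_pos_iff_hermitian_square)
    then show ?thesis
      using f(2)[of "norm b *\<^sub>R 1 - b"] f1 linear_diff[OF f(1)] linear_scale[OF f(1)] by simp
  qed
  have f_skew: "f (\<i> *\<^sub>C b) = 0" if b: "adj b = b" for b
  proof (rule ccontr)
    assume nz: "f (\<i> *\<^sub>C b) \<noteq> 0"
    define \<beta> where "\<beta> = f (\<i> *\<^sub>C b)"
    \<comment> \<open>The square of \<open>t + \<beta>\<close> is at most \<open>t\<^sup>2 + norm b\<^sup>2\<close>; this \<open>t\<close> violates the bound.\<close>
    define t where "t = ((norm b)\<^sup>2 + 1) / (2 * \<beta>)"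
    have "(f (t *\<^sub>R 1 + \<i> *\<^sub>C b))\<^sup>2 \<le> (norm (t *\<^sub>R 1 + \<i> *\<^sub>C b))\<^sup>2"
    proof (rule power2_le_iff_abs_le[THEN iffD2])
      show "\<bar>f (t *\<^sub>R 1 + \<i> *\<^sub>C b)\<bar> \<le> norm (t *\<^sub>R 1 + \<i> *\<^sub>C b)"
        using f(2)[of "t *\<^sub>R 1 + \<i> *\<^sub>C b"] f(2)[of "- (t *\<^sub>R 1 + \<i> *\<^sub>C b)"] linear_neg[OF f(1)]
        by (smt (verit) norm_minus_cancel)
    qed simp
    also have "\<dots> = norm (adj (t *\<^sub>R 1 + \<i> *\<^sub>C b) * (t *\<^sub>R 1 + \<i> *\<^sub>C b))" by (rule cstar_identity[symmetric])
    also have "adj (t *\<^sub>R 1 + \<i> *\<^sub>C b) * (t *\<^sub>R 1 + \<i> *\<^sub>C b) = (t * t) *\<^sub>R 1 + b * b"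
      using b by (simp add: adj_add adj_scaleR adj_scaleC scaleC_minus_left algebra_simps
          scaleC_mult_left scaleC_mult_right scaleC_scaleC scaleC_diff_right scaleC_scaleR)
    also have "norm \<dots> \<le> t * t + (norm b)\<^sup>2"
      using norm_triangle_ineq[of "(t * t) *\<^sub>R 1" "b * b"] hermitian_norm_square[OF b] by simp
    also have "f (t *\<^sub>R 1 + \<i> *\<^sub>C b) = t + \<beta>"
      using linear_add[OF f(1)] linear_scale[OF f(1)] f1 by (simp add: \<beta>_def)
    finally have "2 * t * \<beta> + \<beta>\<^sup>2 \<le> (norm b)\<^sup>2" by (simp add: power2_eq_square algebra_simps)
    moreover have "2 * t * \<beta> = (norm b)\<^sup>2 + 1" using nz by (simp add: t_def \<beta>_def)
    ultimately show False using zero_le_power2[of \<beta>] by linarith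
  qed
  define \<phi> where "\<phi> x = Complex (f (unitz_of x)) (- f (\<i> *\<^sub>C unitz_of x))" for x
  have lin: "\<phi> (x + y) = \<phi> x + \<phi> y" for x y
    by (simp add: \<phi>_def unitz_of_simps scaleC_add_right linear_add[OF f(1)] complex_eq_iff)
  have scal: "\<phi> (c *\<^sub>C x) = c * \<phi> x" for c x
  proof -
    have e: "f (d *\<^sub>C y) = Re d * f y + Im d * f (\<i> *\<^sub>C y)" for d y
    proof -
      have "d *\<^sub>C y = Re d *\<^sub>R y + Im d *\<^sub>R (\<i> *\<^sub>C y)"
        unfolding scaleC_of_real[symmetric] scaleC_scaleC scaleC_add_left[symmetric]
        by (metis complex_eq mult.commute)
      then show ?thesis using linear_add[OF f(1)] linear_scale[OF f(1)] by simp
    qed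
    show ?thesis
      by (simp add: \<phi>_def unitz_of_simps scaleC_scaleC complex_eq_iff e[of c] e[of "\<i> * c"] algebra_simps)
  qed
  have bound: "cmod (\<phi> x) \<le> norm x" for x
  proof (cases "\<phi> x = 0")
    case False
    define c where "c = cnj (sgn (\<phi> x))"
    have "\<phi> (c *\<^sub>C x) = cmod (\<phi> x)"
      unfolding scal c_def using False
      by (simp add: sgn_eq complex_norm_square[symmetric] mult.commute field_simps power2_eq_square)
    then have "cmod (\<phi> x) = f (unitz_of (c *\<^sub>C x))" by (simp add: \<phi>_def complex_eq_iff)
    also have "\<dots> \<le> norm (c *\<^sub>C x)" using f(2)[of "unitz_of (c *\<^sub>C x)"] by simp
    also have "\<dots> = norm x" using False by (simp add: norm_scaleC c_def norm_sgn)
    finally show ?thesis .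
  qed simp
  have bl: "bounded_linear \<phi>"
    by (rule bounded_linear_intro[where K=1])
       (use lin bound scal[of "complex_of_real r" for r] in \<open>simp_all add: scaleC_of_real scaleR_conv_of_real\<close>)
  have phi_pos: "\<phi> b = complex_of_real (f (unitz_of b))" if "cstar_pos b" for b
    using f_skew[of "unitz_of b"] cstar_pos_hermitian[OF that]
    by (simp add: \<phi>_def complex_eq_iff unitz_of_simps(4)[symmetric])
  have pa': "\<phi> a = complex_of_real (norm a)" using phi_pos[OF a(1)] fa by simp
  have "onorm \<phi> = 1"
  proof (rule antisym)
    show "onorm \<phi> \<le> 1" using bound by (intro onorm_bound) simp_all
    show "1 \<le> onorm \<phi>" using onorm[OF bl, of a] pa' a(2) by simp
  qed
  then have "cstar_state \<phi>"
    unfolding cstar_state_def using bl scal phi_pos f_pos[OF cstar_pos_unitz_of[THEN iffD2]]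
    by (auto simp: nonneg_Reals_of_real_iff)
  then show ?thesis using that pa' by blast
qed

section \<open>The Cauchy-Schwarz inequality for states\<close>

lemma cstar_stateD:
  assumes "cstar_state \<phi>"
  shows "bounded_linear \<phi>" "\<phi> (c *\<^sub>C a) = c * \<phi> a" "cmod (\<phi> a) \<le> norm a"
    "cstar_pos b \<Longrightarrow> \<phi> b = complex_of_real (Re (\<phi> b))" "cstar_pos b \<Longrightarrow> 0 \<le> Re (\<phi> b)"
proof -
  show bl: "bounded_linear \<phi>" and "\<phi> (c *\<^sub>C a) = c * \<phi> a" using assms by (auto simp: cstar_state_def)
  show "cmod (\<phi> a) \<le> norm a" using onorm[OF bl, of a] assms by (simp add: cstar_state_def)
  assume "cstar_pos b"
  then have "\<phi> b \<in> \<real>\<^sub>\<ge>\<^sub>0" using assms by (auto simp: cstar_state_def)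
  then show "\<phi> b = complex_of_real (Re (\<phi> b))" "0 \<le> Re (\<phi> b)"
    by (auto simp: complex_nonneg_Reals_iff complex_eq_iff)
qed

lemma cstar_state_Cauchy_Schwarz:
  assumes \<phi>: "cstar_state \<phi>"
  shows "(cmod (\<phi> (adj a * b)))\<^sup>2 \<le> Re (\<phi> (adj a * a)) * Re (\<phi> (adj b * b))"
proof -
  have lin: "linear \<phi>" using cstar_stateD(1)[OF \<phi>] by (rule bounded_linear.linear)
  define A B where "A = Re (\<phi> (adj a * a))" and "B = Re (\<phi> (adj b * b))"
  define z where "z = \<phi> (adj a * b)"
  define r where "r = cmod z"
  have A: "A \<ge> 0" and B: "B \<ge> 0"
    unfolding A_def B_def by (intro cstar_stateD(5)[OF \<phi>] cstar_pos_adj_mult)+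
  have conj: "\<phi> (adj b * a) = cnj z"
  proof -
    have real: "Im (\<phi> (adj x * x)) = 0" for x
      using cstar_stateD(4)[OF \<phi> cstar_pos_adj_mult, of x] by (metis Im_complex_of_real)
    have "Im (\<phi> (adj a * b)) + Im (\<phi> (adj b * a)) = 0"
      using real[of "a + b"] real[of a] real[of b]
      by (simp add: adj_add algebra_simps linear_add[OF lin])
    moreover have "Re (\<phi> (adj a * b)) - Re (\<phi> (adj b * a)) = 0"
      using real[of "a + \<i> *\<^sub>C b"] real[of a] real[of b]
      by (simp add: adj_add adj_scaleC algebra_simps linear_add[OF lin] scaleC_mult_left scaleC_mult_right
          cstar_stateD(2)[OF \<phi>] scaleC_scaleC)
    ultimately show ?thesis by (simp add: z_def complex_eq_iff)
  qed
  have quad: "0 \<le> s\<^sup>2 * A - 2 * s * t * r + t\<^sup>2 * B" for s t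
  proof (cases "z = 0")
    case True
    then show ?thesis using A B by (simp add: r_def)
  next
    case False
    define u where "u = cnj (sgn z)"
    have u: "u * z = r" "cnj u * cnj z = r" "u * cnj u = 1"
      using False
      by (simp_all add: u_def r_def sgn_eq complex_norm_square[symmetric] field_simps power2_eq_square)
    let ?c = "complex_of_real s *\<^sub>C a - (complex_of_real t * u) *\<^sub>C b"
    have "\<phi> (adj ?c * ?c) = s\<^sup>2 * \<phi> (adj a * a) - s * t * (u * z) - s * t * (cnj u * cnj z)
        + t\<^sup>2 * (u * cnj u) * \<phi> (adj b * b)"
      by (simp add: adj_diff adj_scaleC algebra_simps linear_add[OF lin] linear_diff[OF lin] scaleC_mult_left scaleC_mult_right
          cstar_stateD(2)[OF \<phi>] scaleC_scaleC conj z_def[symmetric] power2_eq_square)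
    then have "Re (\<phi> (adj ?c * ?c)) = s\<^sup>2 * A - 2 * s * t * r + t\<^sup>2 * B"
      unfolding u by (simp add: A_def B_def power2_eq_square)
    then show ?thesis using cstar_stateD(5)[OF \<phi> cstar_pos_adj_mult, of ?c] by simp
  qed
  have "r\<^sup>2 \<le> A * B"
  proof (cases "B = 0")
    case True
    then have "2 * s * r \<le> A" for s using quad[of 1 s] by simp
    from this[of "(A + 1) / (2 * r)"] have "r = 0" by (cases "r = 0") simp_all
    then show ?thesis using A B by simp
  next
    case False
    have "0 \<le> B * (A * B - r\<^sup>2)" using quad[of B r] by (simp add: power2_eq_square algebra_simps)
    then show ?thesis using False B by (simp add: zero_le_mult_iff)
  qed
  then show ?thesis by (simp add: r_def z_def A_def B_def)
qed

text \<open>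
  In a unital algebra this is the Cauchy-Schwarz inequality for the pair \<open>adj c\<close>, \<open>1\<close>; in general an
  approximate unit stands in for 1.  The bound by \<open>c * adj c\<close> rather than \<open>adj c * c\<close> is the one that
  matches the series \<open>ip x x\<^sub>i * ip x\<^sub>i x\<close> of an admissible system.
\<close>

lemma cstar_state_norm_square_le:
  assumes \<phi>: "cstar_state \<phi>" shows "(cmod (\<phi> c))\<^sup>2 \<le> Re (\<phi> (c * adj c))"
proof -
  have lin: "linear \<phi>" using cstar_stateD(1)[OF \<phi>] by (rule bounded_linear.linear)
  define R where "R = Re (\<phi> (c * adj c))"
  have R: "R \<ge> 0" unfolding R_def by (intro cstar_stateD(5)[OF \<phi>] cstar_pos_mult_adj)
  have "cmod (\<phi> c) \<le> sqrt R"
  proof (rule field_le_epsilon)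
    fix \<epsilon> :: real assume "\<epsilon> > 0"
    then obtain e where e: "norm e \<le> 1" "norm (c - c * e) < \<epsilon>" using approximate_right_unit by metis
    have "Re (\<phi> (adj e * e)) \<le> norm (adj e * e)"
      using abs_Re_le_cmod[of "\<phi> (adj e * e)"] cstar_stateD(3)[OF \<phi>, of "adj e * e"] by linarith
    then have "Re (\<phi> (adj e * e)) \<le> 1" using e(1) by (simp add: cstar_identity power_le_one order_trans)
    then have "R * Re (\<phi> (adj e * e)) \<le> R" using R by (simp add: mult_left_le)
    then have "(cmod (\<phi> (c * e)))\<^sup>2 \<le> R"
      using cstar_state_Cauchy_Schwarz[OF \<phi>, of "adj c" e] by (simp add: adj_adj R_def)
    then have "cmod (\<phi> (c * e)) \<le> sqrt R" by (rule real_le_rsqrt)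
    moreover have "cmod (\<phi> c) \<le> cmod (\<phi> (c * e)) + cmod (\<phi> (c - c * e))"
      using norm_triangle_ineq[of "\<phi> (c * e)" "\<phi> (c - c * e)"] by (simp add: linear_diff[OF lin])
    ultimately show "cmod (\<phi> c) \<le> sqrt R + \<epsilon>"
      using cstar_stateD(3)[OF \<phi>, of "c - c * e"] e(2) by linarith
  qed
  then have "(cmod (\<phi> c))\<^sup>2 \<le> (sqrt R)\<^sup>2" by (intro power_mono) simp_all
  then show ?thesis using R by (simp add: R_def)
qed

section \<open>Algebra-valued positive forms and Hilbert modules\<close>

locale pos_form =
  fixes act :: "'n::complex_banach \<Rightarrow> 'a::cstar_algebra \<Rightarrow> 'n"
    and B :: "'n \<Rightarrow> 'n \<Rightarrow> 'a"
  assumes form_add_right: "B x (y + z) = B x y + B x z"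
    and form_act_right: "B x (act y a) = B x y * a"
    and form_adj: "adj (B x y) = B y x"
    and form_pos: "cstar_pos (B x x)"
begin

lemma form_diff_right: "B x (y - z) = B x y - B x z"
  using form_add_right[of x "y - z" z] by simp

lemma form_add_left: "B (x + y) z = B x z + B y z"
  using arg_cong[OF form_add_right[of z x y], of adj] by (simp add: adj_add form_adj)

lemma form_diff_left: "B (x - y) z = B x z - B y z"
  using form_add_left[of "x - y" y z] by simp

lemma form_act_left: "B (act x a) y = adj a * B x y"
  using arg_cong[OF form_act_right[of y x a], of adj] by (simp add: adj_mult form_adj)

text \<open>Expand the value of the form at \<open>x - y b\<close> with \<open>b\<close> a multiple of \<open>B y x\<close>.\<close>

lemma form_Cauchy_Schwarz: "B x y * B y x \<preceq> norm (B y y) *\<^sub>R B x x"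
proof -
  define P where "P = B x y * B y x"
  have le: "cstar_pos (N *\<^sub>R B x x - P)" if N: "N > 0" "norm (B y y) \<le> N" for N
  proof -
    define b where "b = (1/N) *\<^sub>R B y x"
    have ab: "adj b = (1/N) *\<^sub>R B x y" by (simp add: b_def adj_scaleR form_adj)
    have "B (x - act y b) (x - act y b) = B x x - (2/N) *\<^sub>R P + adj b * B y y * b"
      by (simp add: form_diff_left form_diff_right form_act_left form_act_right ab)
         (simp add: b_def P_def algebra_simps scaleR_add_left[symmetric])
    moreover have "adj b * B y y * b \<preceq> N *\<^sub>R (adj b * b)"
      by (rule cstar_conj_le[OF form_pos N(2)])
    moreover have "N *\<^sub>R (adj b * b) = (1/N) *\<^sub>R P"
      using N(1) unfolding ab by (simp add: b_def P_def)
    ultimately have "cstar_pos (B x x - (2/N) *\<^sub>R P + (1/N) *\<^sub>R P)"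
      using cstar_pos_add[OF form_pos[of "x - act y b"], of "(1/N) *\<^sub>R P - adj b * B y y * b"]
      by (simp add: cstar_le_def)
    also have "B x x - (2/N) *\<^sub>R P + (1/N) *\<^sub>R P = B x x - (1/N) *\<^sub>R P"
    proof -
      have "(2/N) *\<^sub>R P = (1/N) *\<^sub>R P + (1/N) *\<^sub>R P" by (simp add: scaleR_add_left[symmetric])
      then show ?thesis by simp
    qed
    finally have "cstar_pos (N *\<^sub>R (B x x - (1/N) *\<^sub>R P))"
      using N(1) by (intro cstar_pos_scaleR) simp_all
    then show ?thesis using N(1) by (simp add: scaleR_diff_right)
  qed
  have "cstar_pos (norm (B y y) *\<^sub>R B x x - P)"
  proof (rule cstar_pos_limit)
    have "(\<lambda>n. norm (B y y) + 1 / real (Suc n)) \<longlonglongrightarrow> norm (B y y) + 0"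
      by (intro tendsto_add tendsto_const LIMSEQ_Suc[OF lim_1_over_n])
    then show "(\<lambda>n. (norm (B y y) + 1 / real (Suc n)) *\<^sub>R B x x - P) \<longlonglongrightarrow> norm (B y y) *\<^sub>R B x x - P"
      by (intro tendsto_intros) simp
    show "\<forall>\<^sub>F n in sequentially. cstar_pos ((norm (B y y) + 1 / real (Suc n)) *\<^sub>R B x x - P)"
      by (intro always_eventually allI le) (simp_all add: add_nonneg_pos)
  qed simp
  then show ?thesis by (simp add: cstar_le_def P_def)
qed

lemma form_norm_Cauchy_Schwarz: "(norm (B x y))\<^sup>2 \<le> norm (B x x) * norm (B y y)"
proof -
  have e: "B x y * B y x = B x y * adj (B x y)" by (simp add: form_adj)
  have "norm (B x y * B y x) \<le> norm (B y y) * norm (B x x)"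
    by (rule norm_le_of_cstar_le_scaleR[OF _ form_Cauchy_Schwarz]) (simp_all add: e cstar_pos_mult_adj)
  then show ?thesis by (simp add: e cstar_identity' mult.commute)
qed

lemma form_parallelogram: "B (x + y) (x + y) \<preceq> 2 *\<^sub>R B x x + 2 *\<^sub>R B y y"
    "B (x - y) (x - y) \<preceq> 2 *\<^sub>R B x x + 2 *\<^sub>R B y y"
proof -
  have "2 *\<^sub>R B x x + 2 *\<^sub>R B y y - B (x + y) (x + y) = B (x - y) (x - y)"
    "2 *\<^sub>R B x x + 2 *\<^sub>R B y y - B (x - y) (x - y) = B (x + y) (x + y)"
    by (simp_all add: form_add_left form_add_right form_diff_left form_diff_right scaleR_2)
  then show "B (x + y) (x + y) \<preceq> 2 *\<^sub>R B x x + 2 *\<^sub>R B y y"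
    "B (x - y) (x - y) \<preceq> 2 *\<^sub>R B x x + 2 *\<^sub>R B y y"
    unfolding cstar_le_def using form_pos by metis+
qed

end

context hilbert_module
begin

sublocale pos_form act ip
  by unfold_locales (rule ip_add_right ip_act_right ip_adj ip_pos)+

lemma norm_square: "(norm x)\<^sup>2 = norm (ip x x)"
  by (simp add: norm_ip)

lemma norm_ip_le: "norm (ip x y) \<le> norm x * norm y"
proof (rule power2_le_imp_le)
  show "(norm (ip x y))\<^sup>2 \<le> (norm x * norm y)\<^sup>2"
    using form_norm_Cauchy_Schwarz[of x y] by (simp add: power_mult_distrib norm_square)
qed simp

lemma ip_scaleR_right: "ip x (r *\<^sub>R y) = r *\<^sub>R ip x y"
  using ip_scaleC_right[of x "complex_of_real r" y] by (simp add: scaleC_of_real)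

lemma ip_scaleR_left: "ip (r *\<^sub>R x) y = r *\<^sub>R ip x y"
  using arg_cong[OF ip_scaleR_right[of y r x], of adj] by (simp add: adj_scaleR ip_adj)

lemma bounded_linear_ip_right: "bounded_linear (ip x)"
  by (rule bounded_linear_intro[where K="norm x"])
     (simp_all add: ip_add_right ip_scaleR_right norm_ip_le mult.commute[of _ "norm x"])

lemma bounded_linear_ip_left: "bounded_linear (\<lambda>x. ip x y)"
  by (rule bounded_linear_intro[where K="norm y"])
     (simp_all add: form_add_left ip_scaleR_left norm_ip_le)

lemmas ip_sum_right = linear_sum[OF bounded_linear.linear[OF bounded_linear_ip_right]]
lemmas ip_zero_right [simp] = linear_0[OF bounded_linear.linear[OF bounded_linear_ip_right]]
lemmas ip_zero_left [simp] = linear_0[OF bounded_linear.linear[OF bounded_linear_ip_left]]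

lemma norm_act_le: "norm (act x a) \<le> norm x * norm a"
proof (rule power2_le_imp_le)
  have "norm (ip (act x a) (act x a)) = norm (adj a * (ip x x * a))"
    by (simp add: form_act_left form_act_right mult.assoc)
  also have "\<dots> \<le> norm a * (norm (ip x x) * norm a)"
    using norm_mult_ineq[of "adj a" "ip x x * a"] mult_left_mono[OF norm_mult_ineq[of "ip x x" a] norm_ge_zero[of a]]
    by simp
  finally show "(norm (act x a))\<^sup>2 \<le> (norm x * norm a)\<^sup>2"
    unfolding norm_square power_mult_distrib by (simp add: power2_eq_square mult_ac)
qed simp

lemma act_scaleR_left: "act (r *\<^sub>R x) a = r *\<^sub>R act x a"
  using act_scaleC_left[of "complex_of_real r" x a] by (simp add: scaleC_of_real)

lemma bounded_linear_act_left: "bounded_linear (\<lambda>x. act x a)"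
  by (rule bounded_linear_intro[where K="norm a"]) (simp_all add: act_add_left act_scaleR_left norm_act_le)

text \<open>The form \<open>x, y \<mapsto> ip x f * ip f y\<close> of the rank one operator of \<open>f\<close>, and finite sums of these.\<close>

lemma pos_form_rank_one_sum: "pos_form act (\<lambda>x y. \<Sum>j\<in>A. ip x (f j) * ip (f j) y)"
proof
  show "cstar_pos (\<Sum>j\<in>A. ip x (f j) * ip (f j) x)" for x
    by (intro cstar_pos_sum) (metis cstar_pos_mult_adj ip_adj)
qed (simp_all add: ip_add_right ip_act_right adj_sum adj_mult ip_adj distrib_left sum.distrib
    sum_distrib_right mult.assoc)

lemma pos_form_rank_one: "pos_form act (\<lambda>x y. ip x f * ip f y)"
  using pos_form_rank_one_sum[of "\<lambda>_. f" "{()}"] by simp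

lemma rank_one_pos: "cstar_pos (ip x f * ip f x)"
  by (metis cstar_pos_mult_adj ip_adj)

end

section \<open>Admissible systems\<close>

lemma cstar_pos_suminf:
  assumes "summable f" "\<And>i. cstar_pos (f i)" shows "cstar_pos (suminf f)"
  using summable_LIMSEQ[OF assms(1)] by (rule cstar_pos_limit) (simp_all add: cstar_pos_sum assms(2))

lemma state_square_sum_le:
  assumes \<phi>: "cstar_state \<phi>" and s: "summable (\<lambda>i. c i * adj (c i))"
  shows "summable (\<lambda>i. (cmod (\<phi> (c i)))\<^sup>2)"
    "(\<Sum>i. (cmod (\<phi> (c i)))\<^sup>2) \<le> norm (\<Sum>i. c i * adj (c i))"
proof -
  have bl: "bounded_linear (\<lambda>x. Re (\<phi> x))"
    by (rule bounded_linear_compose[OF bounded_linear_Re cstar_stateD(1)[OF \<phi>]])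
  have s': "summable (\<lambda>i. Re (\<phi> (c i * adj (c i))))" by (rule bounded_linear.summable[OF bl s])
  show sq: "summable (\<lambda>i. (cmod (\<phi> (c i)))\<^sup>2)"
    by (rule summable_comparison_test'[OF s', of 0]) (simp add: cstar_state_norm_square_le[OF \<phi>])
  have "(\<Sum>i. (cmod (\<phi> (c i)))\<^sup>2) \<le> (\<Sum>i. Re (\<phi> (c i * adj (c i))))"
    by (intro suminf_le cstar_state_norm_square_le[OF \<phi>] sq s')
  also have "\<dots> = Re (\<phi> (\<Sum>i. c i * adj (c i)))" by (rule bounded_linear.suminf[OF bl s, symmetric])
  also have "\<dots> \<le> norm (\<Sum>i. c i * adj (c i))"
    using complex_Re_le_cmod cstar_stateD(3)[OF \<phi>] order_trans by blast
  finally show "(\<Sum>i. (cmod (\<phi> (c i)))\<^sup>2) \<le> norm (\<Sum>i. c i * adj (c i))" .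
qed

context hilbert_module
begin

text \<open>
  The norm of the tail bounds the sum of the squares \<open>(cmod (\<phi> (ip x (X i))))\<^sup>2\<close>, \<open>i \<ge> m\<close>, for all
  states \<open>\<phi>\<close> simultaneously.
\<close>

definition tail :: "(nat \<Rightarrow> 'n) \<Rightarrow> nat \<Rightarrow> 'n \<Rightarrow> 'a" where
  "tail X m x = (\<Sum>i. ip x (X (i + m)) * ip (X (i + m)) x)"

context
  fixes X assumes X: "admissible_system ip X"
begin

lemma summable_rank_one: "summable (\<lambda>i. ip x (X (i + m)) * ip (X (i + m)) x)"
  using X summable_ignore_initial_segment unfolding admissible_system_def by blast

lemma tail_pos: "cstar_pos (tail X m x)"
  unfolding tail_def by (intro cstar_pos_suminf summable_rank_one rank_one_pos)

lemma norm_tail_le: "norm (tail X m x) \<le> (norm x)\<^sup>2"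
proof -
  have "tail X 0 x = tail X m x + (\<Sum>i<m. ip x (X i) * ip (X i) x)"
    using suminf_split_initial_segment[OF summable_rank_one[of x 0], of m] by (simp add: tail_def)
  then have "tail X m x \<preceq> tail X 0 x" by (simp add: cstar_le_def cstar_pos_sum rank_one_pos)
  moreover have "tail X 0 x \<preceq> ip x x" using X by (simp add: admissible_system_def tail_def)
  ultimately show ?thesis
    unfolding norm_square using cstar_le_norm[OF tail_pos] cstar_le_trans by blast
qed

lemma norm_tail_add_le:
  "norm (tail X m (x + y)) \<le> 2 * norm (tail X m x) + 2 * norm (tail X m y)"
  "norm (tail X m (x - y)) \<le> 2 * norm (tail X m x) + 2 * norm (tail X m y)"
proof -
  let ?g = "\<lambda>x i. ip x (X (i + m)) * ip (X (i + m)) x"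
  have *: "norm (tail X m z) \<le> 2 * norm (tail X m x) + 2 * norm (tail X m y)"
    if z: "\<And>i. ?g z i \<preceq> 2 *\<^sub>R ?g x i + 2 *\<^sub>R ?g y i" for z
  proof -
    have s: "summable (\<lambda>i. 2 *\<^sub>R ?g x i)" "summable (\<lambda>i. 2 *\<^sub>R ?g y i)"
      by (intro summable_scaleR_right summable_rank_one)+
    have "cstar_pos (\<Sum>i. 2 *\<^sub>R ?g x i + 2 *\<^sub>R ?g y i - ?g z i)"
      using z by (intro cstar_pos_suminf summable_diff summable_add s summable_rank_one) (simp add: cstar_le_def)
    also have "(\<Sum>i. 2 *\<^sub>R ?g x i + 2 *\<^sub>R ?g y i - ?g z i) = 2 *\<^sub>R tail X m x + 2 *\<^sub>R tail X m y - tail X m z"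
      unfolding tail_def
      by (simp add: suminf_diff[symmetric] suminf_add[symmetric] suminf_scaleR_right summable_add s
          summable_rank_one summable_scaleR_right)
    finally have "norm (tail X m z) \<le> norm (2 *\<^sub>R tail X m x + 2 *\<^sub>R tail X m y)"
      using cstar_le_norm[OF tail_pos] by (simp add: cstar_le_def)
    then show ?thesis using norm_triangle_ineq[of "2 *\<^sub>R tail X m x" "2 *\<^sub>R tail X m y"] by simp
  qed
  show "norm (tail X m (x + y)) \<le> 2 * norm (tail X m x) + 2 * norm (tail X m y)"
    by (rule *) (rule pos_form.form_parallelogram(1)[OF pos_form_rank_one])
  show "norm (tail X m (x - y)) \<le> 2 * norm (tail X m x) + 2 * norm (tail X m y)"
    by (rule *) (rule pos_form.form_parallelogram(2)[OF pos_form_rank_one])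
qed

text \<open>
  The factor \<open>2^s\<close> is harmless: below, the number \<open>s\<close> of summands is fixed before \<open>m\<close> is chosen.
\<close>

lemma norm_tail_sum_le:
  "norm (tail X m (\<Sum>k<s. y k)) \<le> 2 ^ s * (\<Sum>k<s. norm (tail X m (y k)))" for s :: nat
proof (induction s)
  case 0
  then show ?case by (simp add: tail_def)
next
  case (Suc s)
  have "norm (tail X m (\<Sum>k<Suc s. y k)) \<le> 2 * norm (tail X m (\<Sum>k<s. y k)) + 2 * norm (tail X m (y s))"
    using norm_tail_add_le(1) by simp
  also have "\<dots> \<le> 2 * (2 ^ s * (\<Sum>k<s. norm (tail X m (y k)))) + 2 ^ Suc s * norm (tail X m (y s))"
    using Suc by (intro add_mono mult_left_mono mult_right_mono) simp_all
  also have "\<dots> = 2 ^ Suc s * (\<Sum>k<Suc s. norm (tail X m (y k)))" by (simp add: algebra_simps)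
  finally show ?case .
qed

text \<open>
  The coefficient \<open>a\<close> factors out of the tail, \<open>tail X m (z a) = adj a * tail X m z * a\<close>, so the tails
  of all \<open>z a\<close> with bounded \<open>a\<close> are uniformly small.
\<close>

lemma norm_tail_act_le: "norm (tail X m (act z a)) \<le> (norm a)\<^sup>2 * norm (tail X m z)"
proof -
  have "tail X m (act z a) = (\<Sum>i. adj a * (ip z (X (i + m)) * ip (X (i + m)) z * a))"
    unfolding tail_def by (simp add: form_act_left form_act_right mult.assoc)
  also have "\<dots> = adj a * (tail X m z * a)"
    unfolding tail_def
    by (simp add: suminf_mult suminf_mult2 summable_rank_one summable_mult2)
  finally have "norm (tail X m (act z a)) \<le> norm a * (norm (tail X m z) * norm a)"
    using norm_mult_ineq[of "adj a" "tail X m z * a"]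
      mult_left_mono[OF norm_mult_ineq[of "tail X m z" a] norm_ge_zero[of a]] by simp
  then show ?thesis by (simp add: power2_eq_square mult_ac)
qed

lemma tail_tendsto_0: "\<tau> > 0 \<Longrightarrow> \<exists>m. \<forall>n\<ge>m. norm (tail X n x) < \<tau>"
  using suminf_exist_split[OF _ summable_rank_one[of x 0], of \<tau>] by (simp add: tail_def)

lemma state_tail_bound:
  assumes "cstar_state \<phi>"
  shows "summable (\<lambda>i. (cmod (\<phi> (ip x (X (i + m)))))\<^sup>2)"
    "(\<Sum>i. (cmod (\<phi> (ip x (X (i + m)))))\<^sup>2) \<le> norm (tail X m x)"
  using state_square_sum_le[OF assms, of "\<lambda>i. ip x (X (i + m))"] summable_rank_one[of x m]
  by (simp_all add: ip_adj tail_def)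

lemma d_XPhi_ge:
  assumes \<Phi>: "\<And>k. cstar_state (\<Phi> k)"
  shows "cmod (\<Phi> k (ip (x - y) (X k))) \<le> d_XPhi ip X \<Phi> x y"
  unfolding d_XPhi_def
proof (rule real_le_rsqrt)
  let ?D = "\<lambda>k. \<Sum>i. (cmod (\<Phi> k (ip (x - y) (X (i + k)))))\<^sup>2"
  have "(cmod (\<Phi> k (ip (x - y) (X k))))\<^sup>2 \<le> ?D k"
    using sum_le_suminf[OF state_tail_bound(1)[OF \<Phi>], of "{0}"] by simp
  also have "\<dots> \<le> (SUP k. ?D k)"
    by (intro cSUP_upper bdd_aboveI2[of _ _ "(norm (x - y))\<^sup>2"]
        order_trans[OF state_tail_bound(2)[OF \<Phi>] norm_tail_le]) simp
  finally show "(cmod (\<Phi> k (ip (x - y) (X k))))\<^sup>2 \<le> (SUP k. ?D k)" .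
qed

end
end

section \<open>Precompact sets are totally bounded\<close>

text \<open>Bounded finite families of complex numbers: quantize the coordinates.\<close>

lemma finite_net:
  fixes g :: "'z \<Rightarrow> 'i \<Rightarrow> complex"
  assumes I: "finite I" and B: "\<And>x i. x \<in> Z \<Longrightarrow> i \<in> I \<Longrightarrow> cmod (g x i) \<le> B" and \<eta>: "\<eta> > 0"
  shows "\<exists>F. finite F \<and> F \<subseteq> Z \<and> (\<forall>x\<in>Z. \<exists>y\<in>F. \<forall>i\<in>I. cmod (g y i - g x i) < \<eta>)"
proof -
  define q where "q x = restrict (\<lambda>i. (\<lfloor>Re (g x i) * (2/\<eta>)\<rfloor>, \<lfloor>Im (g x i) * (2/\<eta>)\<rfloor>)) I" for x
  define K where "K = \<lceil>B * (2/\<eta>)\<rceil> + 1"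
  have fl0: "\<lfloor>u\<rfloor> \<in> {- (\<lceil>v\<rceil> + 1)..\<lceil>v\<rceil> + 1}" if "\<bar>u\<bar> \<le> v" for u v :: real
    using that unfolding atLeastAtMost_iff by (intro conjI; linarith)
  have fl: "\<lfloor>r * (2/\<eta>)\<rfloor> \<in> {-K..K}" if "\<bar>r\<bar> \<le> B" for r
  proof -
    have "\<bar>r * (2/\<eta>)\<bar> \<le> B * (2/\<eta>)"
      using that \<eta> by (simp add: abs_mult divide_right_mono)
    then show ?thesis unfolding K_def by (rule fl0)
  qed
  have "q x \<in> PiE I (\<lambda>_. {-K..K} \<times> {-K..K})" if "x \<in> Z" for x
    using fl[OF order_trans[OF abs_Re_le_cmod B[OF that]]] fl[OF order_trans[OF abs_Im_le_cmod B[OF that]]]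
    unfolding q_def by (intro restrict_PiE_iff[THEN iffD2]) simp
  then have "finite (q ` Z)"
    by (intro finite_subset[OF _ finite_PiE[OF I, of "\<lambda>_. {-K..K} \<times> {-K..K}"]]) auto
  then obtain F where F: "finite F" "F \<subseteq> Z" "q ` Z = q ` F"
    using finite_subset_image[of "q ` Z" q Z] by auto
  have close: "\<bar>r - s\<bar> < \<eta> / 2" if "\<lfloor>r * (2/\<eta>)\<rfloor> = \<lfloor>s * (2/\<eta>)\<rfloor>" for r s :: real
  proof -
    define c where "c = 2/\<eta>"
    have c: "c > 0" "1 / c = \<eta> / 2" using \<eta> by (simp_all add: c_def)
    have "\<bar>r * c - s * c\<bar> < 1" using that unfolding c_def by linarith
    moreover have "\<bar>r * c - s * c\<bar> = \<bar>r - s\<bar> * c"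
      using c(1) by (simp add: abs_mult left_diff_distrib[symmetric])
    ultimately have "\<bar>r - s\<bar> < 1 / c" using c(1) by (simp add: pos_less_divide_eq)
    then show ?thesis by (simp add: c(2))
  qed
  have "\<exists>y\<in>F. \<forall>i\<in>I. cmod (g y i - g x i) < \<eta>" if "x \<in> Z" for x
  proof -
    have "q x \<in> q ` F" using that F(3) by blast
    then obtain y where y: "y \<in> F" "q x = q y" by blast
    have "cmod (g y i - g x i) < \<eta>" if "i \<in> I" for i
    proof -
      have "q x i = q y i" using y by simp
      then have "\<lfloor>Re (g y i) * (2/\<eta>)\<rfloor> = \<lfloor>Re (g x i) * (2/\<eta>)\<rfloor>" "\<lfloor>Im (g y i) * (2/\<eta>)\<rfloor> = \<lfloor>Im (g x i) * (2/\<eta>)\<rfloor>"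
        using that by (simp_all add: q_def)
      then have "\<bar>Re (g y i) - Re (g x i)\<bar> < \<eta> / 2" "\<bar>Im (g y i) - Im (g x i)\<bar> < \<eta> / 2"
        by (blast intro: close)+
      then show ?thesis using cmod_le[of "g y i - g x i"] by simp
    qed
    then show ?thesis using y(1) by blast
  qed
  then show ?thesis using F by blast
qed

context hilbert_module
begin

text \<open>
  Points of \<open>Z\<close> are close to combinations of \<open>z 0, \<dots>, z (s - 1)\<close> with bounded coefficients, and the
  tails of finitely many vectors are small simultaneously.
\<close>

lemma precompact_uniform_tail:
  assumes pre: "A_precompact act Z" and X: "admissible_system ip X" and \<tau>: "\<tau> > 0"
  obtains m where "\<And>n x. n \<ge> m \<Longrightarrow> x \<in> Z \<Longrightarrow> norm (tail X n x) \<le> \<tau>"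
proof -
  define \<delta> where "\<delta> = sqrt (\<tau> / 4)"
  have \<delta>: "\<delta> > 0" "\<delta>\<^sup>2 = \<tau> / 4" using \<tau> by (simp_all add: \<delta>_def)
  have "\<exists>M>0. \<exists>(s::nat) z. \<forall>x\<in>Z. \<exists>a. (\<forall>k<s. norm (a k) \<le> M) \<and> norm (x - (\<Sum>k<s. act (z k) (a k))) < \<delta>"
    using pre \<delta>(1) by (simp add: A_precompact_def)
  then obtain M and s :: nat and z where M: "M > 0" and
    approx: "\<And>x. x \<in> Z \<Longrightarrow> \<exists>a. (\<forall>k<s. norm (a k) \<le> M) \<and> norm (x - (\<Sum>k<s. act (z k) (a k))) < \<delta>"
    by blast
  \<comment> \<open>Chosen so that \<open>2^s\<close> times the sum of \<open>s\<close> terms, each at most \<open>M\<^sup>2 * \<tau>'\<close>, is at most \<open>\<tau> / 4\<close>.\<close>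
  define \<tau>' where "\<tau>' = \<tau> / (4 * 2 ^ s * (real s + 1) * M\<^sup>2)"
  have "4 * 2 ^ s * (real s + 1) * M\<^sup>2 > 0" using M by (simp add: add_nonneg_pos)
  then have M': "4 * (2 ^ s * ((real s + 1) * (M\<^sup>2 * \<tau>'))) = \<tau>" using M by (simp add: \<tau>'_def)
  have \<tau>': "\<tau>' > 0" using \<tau> M by (simp add: \<tau>'_def add_nonneg_pos)
  have "\<forall>k. \<exists>m. \<forall>n\<ge>m. norm (tail X n (z k)) < \<tau>'" using tail_tendsto_0[OF X \<tau>'] by blast
  then obtain m where m: "\<And>k n. n \<ge> m k \<Longrightarrow> norm (tail X n (z k)) < \<tau>'" by metis
  define m0 where "m0 = (\<Sum>k<s. m k)"
  have "norm (tail X n x) \<le> \<tau>" if n: "n \<ge> m0" and x: "x \<in> Z" for n x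
  proof -
    obtain a where a: "\<And>k. k < s \<Longrightarrow> norm (a k) \<le> M" "norm (x - (\<Sum>k<s. act (z k) (a k))) < \<delta>"
      using approx[OF x] by blast
    let ?y = "\<Sum>k<s. act (z k) (a k)"
    have "norm (tail X n (act (z k) (a k))) \<le> M\<^sup>2 * \<tau>'" if k: "k < s" for k
    proof -
      have "m k \<le> m0" unfolding m0_def by (rule member_le_sum) (use k in auto)
      then have "norm (tail X n (z k)) \<le> \<tau>'" using m[of k n] n by simp
      then have "(norm (a k))\<^sup>2 * norm (tail X n (z k)) \<le> M\<^sup>2 * \<tau>'"
        using a(1)[OF k] by (intro mult_mono power_mono) simp_all
      then show ?thesis using norm_tail_act_le[OF X, of n "z k" "a k"] by linarith
    qed
    then have "(\<Sum>k<s. norm (tail X n (act (z k) (a k)))) \<le> real s * (M\<^sup>2 * \<tau>')"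
      using sum_bounded_above[of "{..<s}" "\<lambda>k. norm (tail X n (act (z k) (a k)))" "M\<^sup>2 * \<tau>'"] by simp
    then have "norm (tail X n ?y) \<le> 2 ^ s * (real s * (M\<^sup>2 * \<tau>'))"
      using norm_tail_sum_le[OF X, of n "\<lambda>k. act (z k) (a k)" s]
      by (meson mult_left_mono order_trans zero_le_numeral zero_le_power)
    also have "\<dots> \<le> 2 ^ s * ((real s + 1) * (M\<^sup>2 * \<tau>'))"
      using \<tau>' by (intro mult_left_mono mult_right_mono) simp_all
    also have "\<dots> = \<tau> / 4" using M' by simp
    finally have 1: "norm (tail X n ?y) \<le> \<tau> / 4" .
    have "norm (tail X n (x - ?y)) \<le> \<delta>\<^sup>2"
      using norm_tail_le[OF X, of n "x - ?y"] power_mono[OF less_imp_le[OF a(2)], of 2] by simp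
    then show ?thesis
      using 1 norm_tail_add_le(1)[OF X, of n "x - ?y" ?y] by (simp add: \<delta>(2))
  qed
  then show ?thesis using that by blast
qed

text \<open>
  Beyond some \<open>m\<close> the tails of all differences are small, whatever the state; what remains are the
  finitely many coordinates \<open>\<Phi> k (ip x (X (i + k)))\<close> with \<open>k, i < m\<close>, which are bounded on \<open>Z\<close>.
\<close>

lemma totally_bounded_of_precompact:
  assumes pre: "A_precompact act Z" shows "NN_totally_bounded ip Z"
  unfolding NN_totally_bounded_def
proof (intro allI impI, elim conjE)
  fix X and \<Phi> :: "nat \<Rightarrow> 'a \<Rightarrow> complex" and \<epsilon> :: real
  assume X: "admissible_system ip X" and \<Phi>: "\<forall>k. cstar_state (\<Phi> k)" and \<epsilon>: "\<epsilon> > 0"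
  obtain m where m: "\<And>n x. n \<ge> m \<Longrightarrow> x \<in> Z \<Longrightarrow> norm (tail X n x) \<le> \<epsilon>\<^sup>2 / 16"
    using precompact_uniform_tail[OF pre X, of "\<epsilon>\<^sup>2 / 16"] \<epsilon> by auto
  define \<eta> where "\<eta> = \<epsilon> / (2 * sqrt (real m + 1))"
  have \<eta>: "\<eta> > 0" using \<epsilon> by (simp add: \<eta>_def add_nonneg_pos)
  obtain R where R: "\<And>x. x \<in> Z \<Longrightarrow> norm x \<le> R" using pre unfolding A_precompact_def bounded_iff by blast
  define g where "g x = (\<lambda>(k, i). \<Phi> k (ip x (X (i + k))))" for x
  have g_le: "cmod (g x p) \<le> R" if "x \<in> Z" "p \<in> {..<m} \<times> {..<m}" for x p
  proof -
    obtain k i where p: "p = (k, i)" by (cases p)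
    have "cmod (g x p) \<le> norm (ip x (X (i + k)))" by (simp add: g_def p cstar_stateD(3)[OF \<Phi>[rule_format]])
    also have "\<dots> \<le> norm x * norm (X (i + k))" by (rule norm_ip_le)
    also have "\<dots> \<le> norm x" using X by (simp add: admissible_system_def mult_left_le)
    finally show ?thesis using R[OF that(1)] by linarith
  qed
  have "\<exists>F. finite F \<and> F \<subseteq> Z \<and> (\<forall>x\<in>Z. \<exists>y\<in>F. \<forall>p\<in>{..<m} \<times> {..<m}. cmod (g y p - g x p) < \<eta>)"
    by (rule finite_net[OF _ g_le \<eta>]) simp
  then obtain F where F: "finite F" "F \<subseteq> Z"
      "\<And>x. x \<in> Z \<Longrightarrow> \<exists>y\<in>F. \<forall>p\<in>{..<m} \<times> {..<m}. cmod (g y p - g x p) < \<eta>"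
    by blast
  have "Z \<subseteq> (\<Union>y\<in>F. {x \<in> Z. d_XPhi ip X \<Phi> y x < \<epsilon>})"
  proof
    fix x assume x: "x \<in> Z"
    obtain y where y: "y \<in> F" "\<And>k i. k < m \<Longrightarrow> i < m \<Longrightarrow> cmod (g y (k, i) - g x (k, i)) < \<eta>"
      using F(3)[OF x] by auto
    have yZ: "y \<in> Z" using y F by blast
    let ?c = "\<lambda>k i. (cmod (\<Phi> k (ip (y - x) (X (i + k)))))\<^sup>2"
    have tail_le: "norm (tail X n (y - x)) \<le> \<epsilon>\<^sup>2 / 4" if "n \<ge> m" for n
      using norm_tail_add_le(2)[OF X, of n y x] m[OF that x] m[OF that yZ] by simp
    have "(\<Sum>i. ?c k i) \<le> \<epsilon>\<^sup>2 / 2" for k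
    proof (cases "k < m")
      case False
      then have "norm (tail X k (y - x)) \<le> \<epsilon>\<^sup>2 / 4" by (intro tail_le) simp
      then show ?thesis
        using state_tail_bound(2)[OF X \<Phi>[rule_format], of k "y - x" k] zero_le_power2[of \<epsilon>] by linarith
    next
      case True
      have "?c k i \<le> \<eta>\<^sup>2" if "i < m" for i
      proof -
        have "\<Phi> k (ip (y - x) (X (i + k))) = g y (k, i) - g x (k, i)"
          using bounded_linear.linear[OF cstar_stateD(1)[OF \<Phi>[rule_format]], of k, THEN linear_diff]
          by (simp add: g_def form_diff_left)
        then show ?thesis using y(2)[OF True that] by (simp add: power_mono)
      qed
      then have "(\<Sum>i<m. ?c k i) \<le> real m * \<eta>\<^sup>2"
        using sum_bounded_above[of "{..<m}" "?c k" "\<eta>\<^sup>2"] by simp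
      also have "\<dots> \<le> (real m + 1) * \<eta>\<^sup>2" by (intro mult_right_mono) simp_all
      also have "\<dots> = \<epsilon>\<^sup>2 / 4"
      proof -
        have "c * (\<epsilon> / (2 * sqrt c))\<^sup>2 = \<epsilon>\<^sup>2 / 4" if "c > 0" for c
          using that by (simp add: power_divide power_mult_distrib)
        then show ?thesis unfolding \<eta>_def by (simp add: add_nonneg_pos)
      qed
      finally have "(\<Sum>i<m. ?c k i) \<le> \<epsilon>\<^sup>2 / 4" .
      moreover have "(\<Sum>i. ?c k (i + m)) \<le> \<epsilon>\<^sup>2 / 4"
        using state_tail_bound(2)[OF X \<Phi>[rule_format], of k "y - x" "m + k"] tail_le[of "m + k"]
        by (simp add: add.assoc)
      moreover have "(\<Sum>i. ?c k i) = (\<Sum>i. ?c k (i + m)) + (\<Sum>i<m. ?c k i)"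
        by (rule suminf_split_initial_segment[OF state_tail_bound(1)[OF X \<Phi>[rule_format]]])
      ultimately show ?thesis by simp
    qed
    then have "(SUP k. \<Sum>i. ?c k i) \<le> \<epsilon>\<^sup>2 / 2" by (intro cSUP_least) simp_all
    also have "\<dots> < \<epsilon>\<^sup>2" using \<epsilon> by simp
    finally have "sqrt (SUP k. \<Sum>i. ?c k i) < sqrt (\<epsilon>\<^sup>2)" by (rule real_sqrt_less_mono)
    then have "d_XPhi ip X \<Phi> y x < \<epsilon>" using \<epsilon> by (simp add: d_XPhi_def)
    then show "x \<in> (\<Union>y\<in>F. {x \<in> Z. d_XPhi ip X \<Phi> y x < \<epsilon>})" using x y(1) by blast
  qed
  then show "\<exists>F. finite F \<and> F \<subseteq> Z \<and> Z \<subseteq> (\<Union>z\<in>F. {y \<in> Z. d_XPhi ip X \<Phi> z y < \<epsilon>})"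
    using F by blast
qed

end

section \<open>Frames of countably generated modules\<close>

context hilbert_module
begin

text \<open>The form of the identity minus the sum of the rank one operators of \<open>f 0, \<dots>, f (n - 1)\<close>.\<close>

definition residual :: "(nat \<Rightarrow> 'n) \<Rightarrow> nat \<Rightarrow> 'n \<Rightarrow> 'n \<Rightarrow> 'a" where
  "residual f n x y = ip x y - (\<Sum>j<n. ip x (f j) * ip (f j) y)"

definition Bessel :: "(nat \<Rightarrow> 'n) \<Rightarrow> nat \<Rightarrow> bool" where
  "Bessel f n \<longleftrightarrow> (\<forall>x. cstar_pos (residual f n x x))"

lemma residual_Suc: "residual f (Suc n) x y = residual f n x y - ip x (f n) * ip (f n) y"
  by (simp add: residual_def)

lemma residual_cong: "(\<And>j. j < n \<Longrightarrow> f j = g j) \<Longrightarrow> residual f n x y = residual g n x y"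
  by (simp add: residual_def)

lemma pos_form_residual:
  assumes "Bessel f n" shows "pos_form act (residual f n)"
proof
  show "cstar_pos (residual f n x x)" for x using assms by (simp add: Bessel_def)
qed (simp_all add: residual_def ip_add_right ip_act_right adj_diff adj_sum adj_mult ip_adj
    distrib_left sum.distrib sum_distrib_right left_diff_distrib mult.assoc)

lemma residual_le: "residual f (n + k) x x \<preceq> residual f n x x"
proof (induction k)
  case (Suc k)
  have "residual f (n + Suc k) x x \<preceq> residual f (n + k) x x"
    by (simp add: residual_Suc cstar_le_def rank_one_pos)
  then show ?case using Suc cstar_le_trans by blast
qed simp

end

locale unital_hilbert_module = hilbert_module act ip
  for act :: "'n::complex_banach \<Rightarrow> 'a::unital_cstar_algebra \<Rightarrow> 'n" and ip
begin

text \<open>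
  One step of a Gram-Schmidt procedure.  Write \<open>R\<close> for the residual operator, \<open>w = ip h (R h)\<close> and
  \<open>q\<close> for the sum of the powers \<open>(1 - w)^k\<close> with \<open>k < m\<close>, an approximate inverse of \<open>w\<close>.  The new
  vector is \<open>R h\<close> times the square root of \<open>q\<close>.  It preserves the Bessel inequality by the
  Cauchy-Schwarz argument, as \<open>w q \<le> 1\<close>, and the residual at \<open>h\<close> becomes
  \<open>w - w q w = w (1 - w)^m\<close>, which is small.
\<close>

lemma Bessel_extend:
  assumes bes: "Bessel f n" and h: "norm h \<le> 1"
  obtains g where "Bessel (f(n := g)) (Suc n)"
    "norm (residual (f(n := g)) (Suc n) h h) \<le> 1 / (real m + 1)"
proof -
  let ?R = "residual f n"
  interpret R: pos_form act ?R by (rule pos_form_residual[OF bes])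
  define w where "w = ?R h h"
  have w: "cstar_pos w" unfolding w_def by (rule R.form_pos)
  have "w \<preceq> ip h h" unfolding w_def using residual_le[of f 0 n h] by (simp add: residual_def)
  then have nw: "norm w \<le> 1"
    using cstar_le_norm[OF w] norm_square[of h] power_le_one[OF norm_ge_zero h, of 2] by force
  define v where "v = 1 - w"
  have v: "cstar_pos v" unfolding v_def using w nw by (intro cstar_pos_1_minus) (simp_all add: cstar_pos_hermitian)
  define q where "q = (\<Sum>k<m. v ^ k)"
  have q: "cstar_pos q" unfolding q_def by (intro cstar_pos_sum cstar_pos_power v)
  have wv: "v ^ k * w = w * v ^ k" for k
    by (rule power_commuting_commutes) (simp add: v_def left_diff_distrib right_diff_distrib)
  have qw: "q * w = w * q" unfolding q_def by (simp add: sum_distrib_left sum_distrib_right wv)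
  have wq: "w * q = 1 - v ^ m" unfolding q_def v_def by (rule sum_power_1_minus)
  have qv: "q * v ^ m = v ^ m * q"
    unfolding q_def by (simp add: sum_distrib_left sum_distrib_right power_add[symmetric] add.commute)
  obtain c where c: "cstar_pos c" "q = c * c" using cstar_pos_root[OF q] by metis
  define r where "r = h - (\<Sum>j<n. act (f j) (ip (f j) h))"
  have ip_r: "ip x r = ?R x h" for x
    by (simp add: r_def residual_def form_diff_right ip_sum_right ip_act_right)
  define g where "g = act r c"
  have ip_g: "ip x g = ?R x h * c" "ip g x = c * ?R h x" for x
  proof -
    show 1: "ip x g = ?R x h * c" for x by (simp add: g_def ip_act_right ip_r)
    show "ip g x = c * ?R h x"
      using arg_cong[OF 1[of x], of adj] by (simp add: ip_adj adj_mult R.form_adj cstar_pos_hermitian[OF c(1)])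
  qed
  have res: "residual (f(n := g)) (Suc n) x y = ?R x y - ?R x h * q * ?R h y" for x y
  proof -
    have "residual (f(n := g)) n x y = ?R x y" by (rule residual_cong) simp
    then show ?thesis by (simp add: residual_Suc ip_g c(2) mult.assoc)
  qed
  have "Bessel (f(n := g)) (Suc n)"
    unfolding Bessel_def
  proof
    fix x
    let ?b = "q * ?R h x"
    have ab: "adj ?b = ?R x h * q" by (simp add: adj_mult R.form_adj cstar_pos_hermitian[OF q])
    have "?R (x - act h ?b) (x - act h ?b) =
        ?R x x - ?R x h * q * ?R h x - ?R x h * (q - q * w * q) * ?R h x"
      by (simp add: R.form_diff_left R.form_diff_right R.form_act_left R.form_act_right ab w_def[symmetric])
         (simp add: left_diff_distrib right_diff_distrib mult.assoc)
    then have "?R x x - ?R x h * q * ?R h x =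
        ?R (x - act h ?b) (x - act h ?b) + ?R x h * (q - q * w * q) * ?R h x" by simp
    moreover have "q - q * w * q = q * v ^ m" by (simp add: mult.assoc wq right_diff_distrib)
    moreover have "cstar_pos (q * v ^ m)"
      by (intro cstar_pos_commuting_mult q cstar_pos_power v qv)
    then have "cstar_pos (?R x h * (q * v ^ m) * ?R h x)"
      using cstar_pos_conj[of "q * v ^ m" "?R h x"] by (simp add: R.form_adj)
    ultimately show "cstar_pos (residual (f(n := g)) (Suc n) x x)"
      unfolding res by (simp add: cstar_pos_add R.form_pos)
  qed
  moreover have "residual (f(n := g)) (Suc n) h h = w * v ^ m"
    unfolding res w_def[symmetric]
    by (simp add: qw[symmetric] wq mult.assoc[symmetric] left_diff_distrib right_diff_distrib)
       (simp add: qw wq left_diff_distrib wv)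
  then have "norm (residual (f(n := g)) (Suc n) h h) \<le> 1 / (real m + 1)"
    using norm_mult_power_1_minus_le(2)[OF w nw, of m] by (simp add: v_def)
  ultimately show ?thesis using that by blast
qed

lemma Bessel_sequence:
  assumes h: "\<And>n::nat. norm (h n) \<le> 1"
  obtains f where "\<And>n. Bessel f n" "\<And>n. norm (residual f (Suc n) (h n) (h n)) \<le> 1 / (real n + 1)"
proof -
  define P where "P f n g \<longleftrightarrow> (Bessel f n \<longrightarrow> Bessel (f(n := g)) (Suc n) \<and>
    norm (residual (f(n := g)) (Suc n) (h n) (h n)) \<le> 1 / (real n + 1))" for f g n
  have "\<exists>f. \<forall>n. P f n (f n)"
  proof (rule dependent_wellorder_choice)
    fix n :: nat and g and f f' :: "nat \<Rightarrow> 'n"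
    assume e: "\<And>j. j < n \<Longrightarrow> f j = f' j"
    then have "residual f n x y = residual f' n x y"
      "residual (f(n := g)) (Suc n) x y = residual (f'(n := g)) (Suc n) x y" for x y
      by (auto intro!: residual_cong)
    then show "P f n g = P f' n g" by (simp add: P_def Bessel_def)
  next
    fix n :: nat and f :: "nat \<Rightarrow> 'n"
    show "\<exists>g. P f n g"
    proof (cases "Bessel f n")
      case True
      then show ?thesis unfolding P_def using Bessel_extend[OF _ h[of n], of f n] by metis
    qed (simp add: P_def)
  qed
  then obtain f where f: "\<And>n. P f n (f n)" by blast
  have B: "Bessel f n" for n
  proof (induction n)
    case 0 then show ?case by (simp add: Bessel_def residual_def ip_pos)
  next
    case (Suc n) then show ?case using f[of n] by (simp add: P_def)
  qed
  then show ?thesis using that[of f] f by (simp add: P_def)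
qed

text \<open>
  The residuals decrease and tend to zero at every generator, as each generator is visited
  infinitely often; the vectors with this property form a closed submodule.
\<close>

lemma Parseval_sequence:
  assumes G: "countable G" "closure {(\<Sum>g\<in>F. act g (a g)) | F a. finite F \<and> F \<subseteq> G} = UNIV"
  obtains f where "\<And>n. Bessel f n" "\<And>x. (\<lambda>n. residual f n x x) \<longlonglongrightarrow> 0"
proof -
  \<comment> \<open>Every generator occurs as \<open>e n\<close> for infinitely many \<open>n\<close>, through the second component of the
    pairing; the vector 0 is adjoined because \<open>G\<close> may be empty.\<close>
  define e where "e n = from_nat_into (insert 0 G) (fst (prod_decode n))" for n
  define h where "h n = (1 / (1 + norm (e n))) *\<^sub>R e n" for n
  have "norm (h n) \<le> 1" for n
  proof -
    have "1 + norm (e n) > 0" by (simp add: add_pos_nonneg)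
    then show ?thesis by (simp add: h_def)
  qed
  then obtain f where B: "\<And>n. Bessel f n" and
    small: "\<And>n. norm (residual f (Suc n) (h n) (h n)) \<le> 1 / (real n + 1)"
    using Bessel_sequence by metis
  define C where "C = {x. (\<lambda>n. norm (residual f n x x)) \<longlonglongrightarrow> 0}"
  have mono: "norm (residual f N x x) \<le> norm (residual f n x x)" if "n \<le> N" for n N x
    using cstar_le_norm[OF _ residual_le[of f n "N - n" x]] that B by (simp add: Bessel_def)
  have le: "norm (residual f n x x) \<le> (norm x)\<^sup>2" for n x
    using mono[of 0 n x] by (simp add: norm_square) (simp add: residual_def)
  have par: "norm (residual f n (x + y) (x + y)) \<le> 2 * norm (residual f n x x) + 2 * norm (residual f n y y)" for n x y
  proof -
    interpret R: pos_form act "residual f n" by (rule pos_form_residual[OF B])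
    show ?thesis
      using cstar_le_norm[OF R.form_pos R.form_parallelogram(1), of x y]
        norm_triangle_ineq[of "2 *\<^sub>R residual f n x x" "2 *\<^sub>R residual f n y y"] by simp
  qed
  have C_I: "x \<in> C" if "\<And>\<epsilon>. \<epsilon> > 0 \<Longrightarrow> \<exists>n. norm (residual f n x x) < \<epsilon>" for x
  proof -
    have "\<exists>n0. \<forall>n\<ge>n0. norm (residual f n x x) < \<epsilon>" if "\<epsilon> > 0" for \<epsilon>
      using \<open>\<And>\<epsilon>. \<epsilon> > 0 \<Longrightarrow> \<exists>n. norm (residual f n x x) < \<epsilon>\<close>[OF that] mono le_less_trans by blast
    then show ?thesis by (simp add: C_def LIMSEQ_iff)
  qed
  have C_D: "\<exists>n. \<forall>N\<ge>n. norm (residual f N x x) < \<epsilon>" if "x \<in> C" "\<epsilon> > 0" for x \<epsilon>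
    using that by (simp add: C_def LIMSEQ_iff)
  have gen: "g \<in> C" if gG: "g \<in> G" for g
  proof (rule C_I)
    fix \<epsilon> :: real assume \<epsilon>: "\<epsilon> > 0"
    obtain k where k: "from_nat_into (insert 0 G) k = g"
      using from_nat_into_surj[of "insert 0 G" g] G(1) gG by auto
    define s where "s = 1 + norm g"
    have s: "s > 0" by (simp add: s_def add_pos_nonneg)
    obtain l :: nat where l: "s\<^sup>2 / \<epsilon> < real l" using reals_Archimedean2 by blast
    define n where "n = prod_encode (k, l)"
    have "l \<le> n" unfolding n_def by (rule le_prod_encode_2)
    have "h n = (1/s) *\<^sub>R g" by (simp add: h_def e_def n_def k s_def)
    then have "residual f (Suc n) (h n) (h n) = (1/s)\<^sup>2 *\<^sub>R residual f (Suc n) g g"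
      by (simp add: residual_def ip_scaleR_left ip_scaleR_right scaleR_diff_right scaleR_sum_right
          power2_eq_square del: sum.lessThan_Suc)
    then have "norm (residual f (Suc n) g g) / s\<^sup>2 \<le> 1 / (real n + 1)"
      using small[of n] by (simp add: power_divide)
    then have "norm (residual f (Suc n) g g) \<le> s\<^sup>2 / (real n + 1)"
      using s by (simp add: pos_divide_le_eq)
    also have "\<dots> < \<epsilon>"
    proof -
      have "s\<^sup>2 / \<epsilon> < real n + 1" using l \<open>l \<le> n\<close> by linarith
      then show ?thesis using \<epsilon> by (simp add: divide_simps mult.commute add_nonneg_pos split: if_splits)
    qed
    finally show "\<exists>n. norm (residual f n g g) < \<epsilon>" by blast
  qed
  have C_act: "act x a \<in> C" if "x \<in> C" for x a
  proof -
    have "norm (residual f n (act x a) (act x a)) \<le> norm a * norm a * norm (residual f n x x)" for n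
    proof -
      interpret R: pos_form act "residual f n" by (rule pos_form_residual[OF B])
      have "residual f n (act x a) (act x a) = adj a * (residual f n x x * a)"
        by (simp add: R.form_act_left R.form_act_right mult.assoc)
      then show ?thesis
        using norm_mult_ineq[of "adj a" "residual f n x x * a"]
          mult_left_mono[OF norm_mult_ineq[of "residual f n x x" a] norm_ge_zero[of a]] by (simp add: mult_ac)
    qed
    moreover have lim: "(\<lambda>n. norm a * norm a * norm (residual f n x x)) \<longlonglongrightarrow> 0"
      using that unfolding C_def by (intro tendsto_mult_right_zero) simp
    ultimately show ?thesis unfolding C_def mem_Collect_eq
      by (intro Lim_null_comparison[OF _ lim]) simp
  qed
  have C_add: "x + y \<in> C" if "x \<in> C" "y \<in> C" for x y
  proof (rule C_I)
    fix \<epsilon> :: real assume "\<epsilon> > 0"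
    then have "\<epsilon> / 4 > 0" by simp
    from C_D[OF that(1) this] C_D[OF that(2) this] obtain n where
      "norm (residual f n x x) < \<epsilon> / 4" "norm (residual f n y y) < \<epsilon> / 4"
      by (metis linorder_le_cases order_refl)
    then show "\<exists>n. norm (residual f n (x + y) (x + y)) < \<epsilon>"
      using par[of n x y] by (intro exI[of _ n]) linarith
  qed
  have zero: "0 \<in> C" by (simp add: C_def residual_def)
  have "(\<Sum>g\<in>F. act g (a g)) \<in> C" if "finite F" "F \<subseteq> G" for F a
    using that by (induction F rule: finite_induct) (auto simp: zero intro!: C_add C_act[OF gen])
  then have sub: "{(\<Sum>g\<in>F. act g (a g)) | F a. finite F \<and> F \<subseteq> G} \<subseteq> C" by blast
  have all: "x \<in> C" for x
  proof (rule C_I)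
    fix \<epsilon> :: real assume \<epsilon>: "\<epsilon> > 0"
    have "x \<in> closure C" using closure_mono[OF sub] G(2) by blast
    moreover have "sqrt (\<epsilon> / 4) > 0" using \<epsilon> by simp
    ultimately obtain y where y: "y \<in> C" "dist y x < sqrt (\<epsilon> / 4)"
      unfolding closure_approachable by blast
    have "\<epsilon> / 4 > 0" using \<epsilon> by simp
    from C_D[OF y(1) this] obtain n where n: "norm (residual f n y y) < \<epsilon> / 4" by blast
    have "(norm (x - y))\<^sup>2 < (sqrt (\<epsilon> / 4))\<^sup>2"
      using y(2) by (intro power_strict_mono) (simp_all add: dist_norm norm_minus_commute)
    then have "norm (residual f n (x - y) (x - y)) < \<epsilon> / 4" using le[of n "x - y"] \<epsilon> by simp
    then have "norm (residual f n x x) < \<epsilon>" using par[of n "x - y" y] n by simp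
    then show "\<exists>n. norm (residual f n x x) < \<epsilon>" by blast
  qed
  have "(\<lambda>n. residual f n x x) \<longlonglongrightarrow> 0" for x
    using all[of x] unfolding C_def mem_Collect_eq by (rule tendsto_norm_zero_cancel)
  then show ?thesis using that B by blast
qed

text \<open>
  A finite sum over \<open>F \<supseteq> {..<n}\<close> lies between the \<open>n\<close>-th partial sum and \<open>ip x x\<close>, so convergence of
  the partial sums implies unordered convergence.
\<close>

lemma Parseval_frame:
  assumes G: "countable G" "closure {(\<Sum>g\<in>F. act g (a g)) | F a. finite F \<and> F \<subseteq> G} = UNIV"
  shows "\<exists>f::nat \<Rightarrow> 'n. \<forall>x. ((\<lambda>j. ip x (f j) * ip (f j) x) has_sum ip x x) UNIV"
proof -
  obtain f where B: "\<And>n. Bessel f n" and lim: "\<And>x. (\<lambda>n. residual f n x x) \<longlonglongrightarrow> 0"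
    using Parseval_sequence[OF G] by metis
  have "((\<lambda>j. ip x (f j) * ip (f j) x) has_sum ip x x) UNIV" for x
    unfolding has_sum_def tendsto_iff
  proof (intro allI impI)
    fix \<epsilon> :: real assume "\<epsilon> > 0"
    then obtain n where n: "norm (residual f n x x) < \<epsilon>"
      using lim[of x] unfolding LIMSEQ_iff by (metis diff_zero order_refl)
    let ?S = "\<lambda>F. \<Sum>j\<in>F. ip x (f j) * ip (f j) x"
    have "dist (?S F) (ip x x) < \<epsilon>" if F: "finite F" "{..<n} \<subseteq> F" for F
    proof -
      obtain N where "F \<subseteq> {..<N}" using finite_nat_iff_bounded F(1) by blast
      then have "?S F \<preceq> ?S {..<N}" by (intro cstar_le_sum_subset) (simp_all add: rank_one_pos)
      then have "cstar_pos (ip x x - ?S F)"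
        using cstar_pos_add[of "?S {..<N} - ?S F" "residual f N x x"] B[of N]
        by (simp add: cstar_le_def Bessel_def residual_def)
      moreover have "?S {..<n} \<preceq> ?S F" using F by (intro cstar_le_sum_subset) (simp_all add: rank_one_pos)
      then have "ip x x - ?S F \<preceq> residual f n x x" by (simp add: cstar_le_def residual_def)
      ultimately have "norm (ip x x - ?S F) < \<epsilon>" using cstar_le_norm n le_less_trans by blast
      then show ?thesis by (simp add: dist_norm norm_minus_commute)
    qed
    then show "\<forall>\<^sub>F F in finite_subsets_at_top UNIV. dist (?S F) (ip x x) < \<epsilon>"
      unfolding eventually_finite_subsets_at_top by (intro exI[of _ "{..<n}"]) auto
  qed
  then show ?thesis by blast
qed

end

text \<open>
  A module over a C*-algebra is also one over the unitization, with the same inner products.  This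
  supplies the unit that the polynomials of the Gram-Schmidt step require.
\<close>

context hilbert_module
begin

definition unitz_act :: "'n \<Rightarrow> 'a unitz \<Rightarrow> 'n" where
  "unitz_act x u = act x (upart u) + uscal u *\<^sub>C x"

definition unitz_ip :: "'n \<Rightarrow> 'n \<Rightarrow> 'a unitz" where
  "unitz_ip x y = unitz_of (ip x y)"

lemma unital_hilbert_module_unitz: "unital_hilbert_module unitz_act unitz_ip"
proof -
  have "hilbert_module unitz_act unitz_ip"
  proof
    fix x y z :: 'n and a b :: "'a unitz" and c :: complex
    show "unitz_act (x + y) a = unitz_act x a + unitz_act y a"
      "unitz_act x (a + b) = unitz_act x a + unitz_act x b"
      by (simp_all add: unitz_act_def act_add_left act_add_right scaleC_add_left scaleC_add_right)
    show "unitz_act x (a * b) = unitz_act (unitz_act x a) b"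
      by (simp add: unitz_act_def act_add_left act_add_right act_mult act_scaleC_left act_scaleC_right
          scaleC_add_right scaleC_scaleC mult.commute add.assoc)
    show "unitz_act (c *\<^sub>C x) a = c *\<^sub>C unitz_act x a" "unitz_act x (c *\<^sub>C a) = c *\<^sub>C unitz_act x a"
      by (simp_all add: unitz_act_def act_scaleC_left act_scaleC_right scaleC_add_right scaleC_scaleC mult.commute)
    show "unitz_ip x (y + z) = unitz_ip x y + unitz_ip x z" "unitz_ip x (c *\<^sub>C y) = c *\<^sub>C unitz_ip x y"
      by (simp_all add: unitz_ip_def ip_add_right ip_scaleC_right unitz_of_simps)
    show "unitz_ip x (unitz_act y a) = unitz_ip x y * a"
      by (intro unitz.expand) (simp add: unitz_ip_def unitz_act_def ip_add_right ip_act_right ip_scaleC_right)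
    show "adj (unitz_ip x y) = unitz_ip y x"
      by (simp add: unitz_ip_def unitz_of_simps(4)[symmetric] ip_adj)
    show "cstar_pos (unitz_ip x x)" by (simp add: unitz_ip_def cstar_pos_unitz_of ip_pos)
    show "x = 0" if "unitz_ip x x = 0"
      using that ip_definite[of x] unitz_of_eq_iff[of "ip x x" 0] by (simp add: unitz_ip_def)
    show "norm x = sqrt (norm (unitz_ip x x))" by (simp add: unitz_ip_def norm_ip)
  qed
  then show ?thesis by (simp add: unital_hilbert_module_def)
qed

theorem standard_frame_of_countably_generated:
  assumes "countably_generated_module act"
  shows "\<exists>f::nat \<Rightarrow> 'n. standard_frame ip UNIV f"
proof -
  interpret U: unital_hilbert_module unitz_act unitz_ip by (rule unital_hilbert_module_unitz)
  obtain G where G: "countable G" "closure {(\<Sum>g\<in>F. act g (a g)) | F a. finite F \<and> F \<subseteq> G} = UNIV"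
    using assms unfolding countably_generated_module_def by blast
  have "{(\<Sum>g\<in>F. act g (a g)) | F a. finite F \<and> F \<subseteq> G}
      \<subseteq> {(\<Sum>g\<in>F. unitz_act g (a g)) | F a. finite F \<and> F \<subseteq> G}"
  proof clarify
    fix F a assume "finite F" "F \<subseteq> G"
    then show "\<exists>F' b. (\<Sum>g\<in>F. act g (a g)) = (\<Sum>g\<in>F'. unitz_act g (b g)) \<and> finite F' \<and> F' \<subseteq> G"
      by (intro exI[of _ F] exI[of _ "\<lambda>g. unitz_of (a g)"]) (simp add: unitz_act_def)
  qed
  from closure_mono[OF this] G(2)
  have "closure {(\<Sum>g\<in>F. unitz_act g (a g)) | F a. finite F \<and> F \<subseteq> G} = UNIV" by auto
  from U.Parseval_frame[OF G(1) this] obtain f :: "nat \<Rightarrow> 'n" where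
    f: "\<And>x. ((\<lambda>j. unitz_ip x (f j) * unitz_ip (f j) x) has_sum unitz_ip x x) UNIV"
    by blast
  have "((\<lambda>j. ip x (f j) * ip (f j) x) has_sum ip x x) UNIV" for x
    using has_sum_bounded_linear[OF bounded_linear_upart f[of x]] by (simp add: unitz_ip_def o_def)
  then have "(\<lambda>j. ip x (f j) * ip (f j) x) summable_on UNIV"
    "(\<Sum>\<^sub>\<infinity>j. ip x (f j) * ip (f j) x) = ip x x" for x
    by (auto simp: summable_on_def infsumI)
  then have "standard_frame ip UNIV f"
    unfolding standard_frame_def by (intro exI[of _ "1::real"] conjI allI) simp_all
  then show ?thesis by blast
qed

end

section \<open>Totally bounded sets are bounded\<close>

context hilbert_module
begin

lemma admissible_systemI:
  assumes "\<And>i. norm (X i) \<le> 1" "\<And>x. summable (\<lambda>i. ip x (X i) * ip (X i) x)"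
    and le: "\<And>x n. (\<Sum>i<n. ip x (X i) * ip (X i) x) \<preceq> ip x x"
  shows "admissible_system ip X"
proof -
  have "(\<Sum>i. ip x (X i) * ip (X i) x) \<preceq> ip x x" for x
  proof -
    have "(\<lambda>n. ip x x - (\<Sum>i<n. ip x (X i) * ip (X i) x)) \<longlonglongrightarrow> ip x x - (\<Sum>i. ip x (X i) * ip (X i) x)"
      by (intro tendsto_intros summable_LIMSEQ assms(2))
    then show ?thesis
      unfolding cstar_le_def by (rule cstar_pos_limit) (use le in \<open>auto simp: cstar_le_def\<close>)
  qed
  then show ?thesis using assms by (simp add: admissible_system_def)
qed

text \<open>
  The pseudometric dominates its diagonal terms \<open>i = k\<close>.  This is the only consequence of total
  boundedness that the converse uses; there both the vectors \<open>X k\<close> and the states \<open>\<Phi> k\<close> are adapted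
  to the points \<open>z k\<close>.
\<close>

lemma totally_bounded_diagonal:
  assumes tb: "NN_totally_bounded ip Z" and X: "admissible_system ip X" and \<Phi>: "\<And>k. cstar_state (\<Phi> k)"
    and z: "\<And>k. z k \<in> Z" and \<epsilon>: "\<epsilon> > 0"
  shows "\<exists>F. finite F \<and> F \<subseteq> Z \<and> (\<forall>k. \<exists>y\<in>F. cmod (\<Phi> k (ip (z k) (X k))) < norm (ip y (X k)) + \<epsilon>)"
proof -
  obtain F where F: "finite F" "F \<subseteq> Z" "Z \<subseteq> (\<Union>y\<in>F. {x \<in> Z. d_XPhi ip X \<Phi> y x < \<epsilon>})"
    using tb X \<Phi> \<epsilon> unfolding NN_totally_bounded_def by meson
  have "\<exists>y\<in>F. cmod (\<Phi> k (ip (z k) (X k))) < norm (ip y (X k)) + \<epsilon>" for k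
  proof -
    obtain y where y: "y \<in> F" "d_XPhi ip X \<Phi> y (z k) < \<epsilon>" using F(3) z[of k] by blast
    have "\<Phi> k (ip (z k) (X k)) = \<Phi> k (ip y (X k)) - \<Phi> k (ip (y - z k) (X k))"
      using linear_diff[OF bounded_linear.linear[OF cstar_stateD(1)[OF \<Phi>[of k]]]]
      by (simp add: form_diff_left)
    then have "cmod (\<Phi> k (ip (z k) (X k))) \<le> cmod (\<Phi> k (ip y (X k))) + cmod (\<Phi> k (ip (y - z k) (X k)))"
      by (simp add: norm_triangle_ineq4)
    then have "cmod (\<Phi> k (ip (z k) (X k))) < norm (ip y (X k)) + \<epsilon>"
      using d_XPhi_ge[of X \<Phi>, OF X \<Phi>, of k y "z k"] y(2) cstar_stateD(3)[OF \<Phi>, of k "ip y (X k)"] by linarith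
    then show ?thesis using y(1) by blast
  qed
  then show ?thesis using F by blast
qed

text \<open>
  If \<open>norm (z k) > 4^k\<close>, then the multiple \<open>X k\<close> of \<open>z k\<close> of norm \<open>2^-(k+1)\<close> pairs with \<open>z k\<close> to an
  element of norm greater than \<open>2^k / 2\<close>, while it pairs boundedly with any fixed vector.
\<close>

lemma bounded_of_totally_bounded:
  assumes tb: "NN_totally_bounded ip Z" shows "bounded Z"
proof (rule ccontr)
  assume "\<not> bounded Z"
  then have "\<forall>k::nat. \<exists>x\<in>Z. 4 ^ k < norm x" unfolding bounded_iff by (meson not_le)
  then obtain z where z: "\<And>k. z k \<in> Z" "\<And>k::nat. 4 ^ k < norm (z k)" by metis
  have zp: "norm (z k) > 0" for k using z(2)[of k] by (smt (verit) zero_less_power)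
  define X where "X k = ((1/2) ^ Suc k / norm (z k)) *\<^sub>R z k" for k
  have nX: "norm (X k) = (1/2) ^ Suc k" for k using zp[of k] by (simp add: X_def)
  have X1: "norm (X k) \<le> 1" for k unfolding nX by (intro power_le_one) simp_all
  let ?g = "\<lambda>x k. ip x (X k) * ip (X k) x"
  have g_le: "?g x k \<preceq> ((1/4) ^ Suc k) *\<^sub>R ip x x" for x k
  proof -
    have "norm (ip (X k) (X k)) = (1/4) ^ Suc k"
      unfolding norm_square[symmetric] nX by (simp add: power_mult_distrib[symmetric] power2_eq_square)
    then show ?thesis using form_Cauchy_Schwarz[of x "X k"] by (simp only:)
  qed
  have X: "admissible_system ip X"
  proof (rule admissible_systemI[OF X1])
    fix x
    have "norm (?g x k) \<le> norm (ip x x) * (1/4) ^ k" for k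
    proof -
      have "norm (?g x k) \<le> (1/4) ^ Suc k * norm (ip x x)"
        by (rule norm_le_of_cstar_le_scaleR[OF rank_one_pos g_le]) simp
      also have "\<dots> \<le> norm (ip x x) * (1/4) ^ k" by (simp add: mult_left_le)
      finally show ?thesis .
    qed
    then show "summable (?g x)"
      by (intro summable_comparison_test'[OF summable_mult[OF summable_geometric], of "1/4" 0]) simp_all
    fix n
    have "(\<Sum>k<n. ?g x k) \<preceq> (\<Sum>k<n. ((1/4) ^ Suc k) *\<^sub>R ip x x)" by (intro cstar_le_sum g_le)
    also have "(\<Sum>k<n. ((1/4) ^ Suc k) *\<^sub>R ip x x) = (\<Sum>k<n. (1/4::real) ^ Suc k) *\<^sub>R ip x x"
      by (rule scaleR_sum_left[symmetric])
    finally have 1: "(\<Sum>k<n. ?g x k) \<preceq> (\<Sum>k<n. (1/4::real) ^ Suc k) *\<^sub>R ip x x" .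
    have "3 * (\<Sum>k<n. (1/4::real) ^ Suc k) = 1 - (1/4) ^ n" by (induction n) simp_all
    then have "(\<Sum>k<n. (1/4::real) ^ Suc k) \<le> 1" using zero_le_power[of "1/4::real" n] by linarith
    then have "(\<Sum>k<n. (1/4::real) ^ Suc k) *\<^sub>R ip x x \<preceq> 1 *\<^sub>R ip x x"
      by (intro cstar_le_scaleR_left ip_pos)
    then show "(\<Sum>k<n. ?g x k) \<preceq> ip x x" using cstar_le_trans[OF 1] by simp
  qed
  have "\<exists>\<phi>. cstar_state \<phi> \<and> \<phi> (ip (z k) (z k)) = complex_of_real (norm (ip (z k) (z k)))" for k
    using cstar_state_exists[OF ip_pos, of "z k"] zp[of k] ip_definite[of "z k"] by (metis less_irrefl norm_zero)
  then obtain \<Phi> where \<Phi>: "\<And>k. cstar_state (\<Phi> k)"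
    "\<And>k. \<Phi> k (ip (z k) (z k)) = complex_of_real (norm (ip (z k) (z k)))" by metis
  have big: "2 ^ k / 2 < cmod (\<Phi> k (ip (z k) (X k)))" for k
  proof -
    have "\<Phi> k (ip (z k) (X k)) = complex_of_real (((1/2) ^ Suc k / norm (z k)) * (norm (z k))\<^sup>2)"
      unfolding X_def ip_scaleR_right
      using linear_scale[OF bounded_linear.linear[OF cstar_stateD(1)[OF \<Phi>(1)[of k]]]]
      by (simp add: \<Phi>(2) norm_square scaleR_conv_of_real)
    then have "cmod (\<Phi> k (ip (z k) (X k))) = \<bar>((1/2) ^ Suc k / norm (z k)) * (norm (z k))\<^sup>2\<bar>"
      by (simp only: norm_of_real)
    then have "cmod (\<Phi> k (ip (z k) (X k))) = (1/2) ^ Suc k * norm (z k)"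
      using zp[of k] by (simp add: power2_eq_square)
    moreover have "(1/2::real) ^ Suc k * 4 ^ k = 2 ^ k / 2"
      by (simp add: power_mult_distrib[symmetric])
    ultimately show ?thesis using z(2)[of k] by (metis half_gt_zero_iff mult_strict_left_mono zero_less_one zero_less_power)
  qed
  obtain F where F: "finite F" "\<And>k. \<exists>y\<in>F. cmod (\<Phi> k (ip (z k) (X k))) < norm (ip y (X k)) + 1"
    using totally_bounded_diagonal[where z=z and \<Phi>=\<Phi>, OF tb X \<Phi>(1) z(1) zero_less_one] by blast
  obtain k :: nat where k: "2 * ((\<Sum>y\<in>F. norm y) + 1) < 2 ^ k" using real_arch_pow[of 2] by auto
  obtain y where y: "y \<in> F" "cmod (\<Phi> k (ip (z k) (X k))) < norm (ip y (X k)) + 1" using F(2) by blast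
  have "norm (ip y (X k)) \<le> norm y * norm (X k)" by (rule norm_ip_le)
  also have "\<dots> \<le> norm y" using X1[of k] by (simp add: mult_left_le)
  also have "\<dots> \<le> (\<Sum>y\<in>F. norm y)" using F(1) y(1) by (intro member_le_sum) simp_all
  finally have "cmod (\<Phi> k (ip (z k) (X k))) < (\<Sum>y\<in>F. norm y) + 1" using y(2) by linarith
  moreover have "(\<Sum>y\<in>F. norm y) + 1 < 2 ^ k / 2" using k by simp
  ultimately show False using big[of k] by linarith
qed

end

section \<open>Unordered sums and frames\<close>

lemma summable_on_Cauchy:
  fixes f :: "'i \<Rightarrow> 'b::banach"
  assumes "\<And>\<epsilon>. \<epsilon> > 0 \<Longrightarrow> \<exists>F. finite F \<and> F \<subseteq> J \<and> (\<forall>A. finite A \<longrightarrow> A \<subseteq> J - F \<longrightarrow> norm (sum f A) < \<epsilon>)"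
  shows "f summable_on J"
proof -
  have "\<exists>P. eventually P (finite_subsets_at_top J) \<and> (\<forall>A B. P A \<and> P B \<longrightarrow> dist (sum f A) (sum f B) < \<epsilon>)"
    if "\<epsilon> > 0" for \<epsilon>
  proof -
    have "\<epsilon> / 2 > 0" using that by simp
    from assms[OF this] obtain F where F: "finite F" "F \<subseteq> J"
      "\<And>A. finite A \<Longrightarrow> A \<subseteq> J - F \<Longrightarrow> norm (sum f A) < \<epsilon> / 2" by blast
    let ?P = "\<lambda>A. finite A \<and> F \<subseteq> A \<and> A \<subseteq> J"
    have "dist (sum f A) (sum f B) < \<epsilon>" if "?P A" "?P B" for A B
    proof -
      have "sum f A - sum f B = sum f (A - F) - sum f (B - F)"
        using that by (simp add: sum_diff)
      moreover have "norm (sum f (A - F)) < \<epsilon> / 2" "norm (sum f (B - F)) < \<epsilon> / 2"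
        by (rule F(3); use that in auto)+
      ultimately show ?thesis
        using norm_triangle_ineq4[of "sum f (A - F)" "sum f (B - F)"] by (simp add: dist_norm)
    qed
    moreover have "eventually ?P (finite_subsets_at_top J)"
      unfolding eventually_finite_subsets_at_top using F(1,2) by (intro exI[of _ F]) blast
    ultimately show ?thesis by (intro exI[of _ ?P]) simp
  qed
  then have "cauchy_filter (filtermap (sum f) (finite_subsets_at_top J))"
    by (simp add: cauchy_filter_metric_filtermap)
  moreover have "complete (UNIV::'b set)"
    by (meson Cauchy_convergent UNIV_I complete_def convergent_def)
  ultimately obtain L where "(sum f \<longlongrightarrow> L) (finite_subsets_at_top J)"
    using complete_uniform[where S=UNIV] by (force simp add: filterlim_def)
  then show ?thesis using summable_on_def has_sum_def by blast
qed

lemma summable_on_tail: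
  fixes f :: "'i \<Rightarrow> 'b::banach"
  assumes "f summable_on J" "\<epsilon> > 0"
  obtains F where "finite F" "F \<subseteq> J" "\<And>A. finite A \<Longrightarrow> A \<subseteq> J - F \<Longrightarrow> norm (sum f A) < \<epsilon>"
proof -
  obtain L where "(f has_sum L) J" using assms(1) by (auto simp: summable_on_def)
  then have "\<forall>\<^sub>F A in finite_subsets_at_top J. dist (sum f A) L < \<epsilon> / 2"
    using half_gt_zero[OF assms(2)] unfolding has_sum_def tendsto_iff by blast
  then have "\<exists>F. finite F \<and> F \<subseteq> J \<and> (\<forall>A. finite A \<and> F \<subseteq> A \<and> A \<subseteq> J \<longrightarrow> dist (sum f A) L < \<epsilon> / 2)"
    unfolding eventually_finite_subsets_at_top .
  then obtain F where F: "finite F" "F \<subseteq> J"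
    "\<And>A. finite A \<Longrightarrow> F \<subseteq> A \<Longrightarrow> A \<subseteq> J \<Longrightarrow> dist (sum f A) L < \<epsilon> / 2"
    by metis
  have "norm (sum f A) < \<epsilon>" if "finite A" "A \<subseteq> J - F" for A
  proof -
    have "sum f (F \<union> A) = sum f F + sum f A" using that F(1) by (intro sum.union_disjoint) auto
    then have "norm (sum f A) = dist (sum f (F \<union> A)) (sum f F)" by (simp add: dist_norm)
    also have "\<dots> \<le> dist (sum f (F \<union> A)) L + dist (sum f F) L" by (rule dist_triangle2)
    also have "\<dots> < \<epsilon> / 2 + \<epsilon> / 2" using that F by (intro add_strict_mono F(3)) auto
    finally show ?thesis by simp
  qed
  then show ?thesis using that F by blast
qed

lemma has_sum_norm_diff_le:
  fixes f :: "'i \<Rightarrow> 'b::real_normed_vector"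
  assumes "(f has_sum L) J" "finite A" "A \<subseteq> J"
    and "\<And>B. finite B \<Longrightarrow> B \<subseteq> J - A \<Longrightarrow> norm (sum f B) \<le> t"
  shows "norm (L - sum f A) \<le> t"
proof (rule tendsto_upperbound)
  show "((\<lambda>F. norm (sum f F - sum f A)) \<longlongrightarrow> norm (L - sum f A)) (finite_subsets_at_top J)"
    using assms(1) unfolding has_sum_def by (intro tendsto_intros)
  show "\<forall>\<^sub>F F in finite_subsets_at_top J. norm (sum f F - sum f A) \<le> t"
    unfolding eventually_finite_subsets_at_top
  proof (intro exI[of _ A] conjI assms(2,3) allI impI)
    fix F assume "finite F \<and> A \<subseteq> F \<and> F \<subseteq> J"
    then show "norm (sum f F - sum f A) \<le> t"
      using assms(4)[of "F - A"] by (auto simp: sum_diff)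
  qed
qed simp

locale framed_module = hilbert_module act ip
  for act :: "'n::complex_banach \<Rightarrow> 'a::cstar_algebra \<Rightarrow> 'n" and ip +
  fixes J :: "'j set" and f :: "'j \<Rightarrow> 'n" and c1 c2 :: real
  assumes c1: "c1 > 0" and c2: "c2 > 0"
    and frame_summable: "(\<lambda>j. ip x (f j) * ip (f j) x) summable_on J"
    and frame_lower: "c1 *\<^sub>R ip x x \<preceq> (\<Sum>\<^sub>\<infinity>j\<in>J. ip x (f j) * ip (f j) x)"
    and frame_upper: "(\<Sum>\<^sub>\<infinity>j\<in>J. ip x (f j) * ip (f j) x) \<preceq> c2 *\<^sub>R ip x x"
begin

definition fsum :: "'j set \<Rightarrow> 'n \<Rightarrow> 'n \<Rightarrow> 'a" where
  "fsum A x y = (\<Sum>j\<in>A. ip x (f j) * ip (f j) y)"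

sublocale fsum: pos_form act "fsum A" for A
  unfolding fsum_def by (rule pos_form_rank_one_sum)

text \<open>Partial sums of the frame operator; its form is \<open>fsum A\<close>.\<close>

definition synth :: "'j set \<Rightarrow> 'n \<Rightarrow> 'n" where
  "synth A x = (\<Sum>j\<in>A. act (f j) (ip (f j) x))"

lemma ip_synth: "ip x (synth A y) = fsum A x y"
  by (simp add: synth_def fsum_def ip_sum_right ip_act_right)

lemma frame_Bessel:
  assumes "finite A" "A \<subseteq> J" shows "fsum A x x \<preceq> c2 *\<^sub>R ip x x"
proof -
  let ?S = "\<Sum>\<^sub>\<infinity>j\<in>J. ip x (f j) * ip (f j) x"
  have "((\<lambda>F. fsum F x x - fsum A x x) \<longlongrightarrow> ?S - fsum A x x) (finite_subsets_at_top J)"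
    using has_sum_infsum[OF frame_summable[of x]] unfolding has_sum_def fsum_def by (intro tendsto_intros)
  moreover have "\<forall>\<^sub>F F in finite_subsets_at_top J. cstar_pos (fsum F x x - fsum A x x)"
    unfolding eventually_finite_subsets_at_top using assms
    by (intro exI[of _ A]) (auto simp: fsum_def cstar_le_def[symmetric] rank_one_pos intro!: cstar_le_sum_subset)
  ultimately have "fsum A x x \<preceq> ?S" unfolding cstar_le_def
    by (rule cstar_pos_limit[OF _ finite_subsets_at_top_neq_bot])
  then show ?thesis using frame_upper cstar_le_trans by blast
qed

lemma norm_fsum_le:
  assumes "finite A" "A \<subseteq> J" shows "norm (fsum A x x) \<le> c2 * (norm x)\<^sup>2"
  using norm_le_of_cstar_le_scaleR[OF fsum.form_pos frame_Bessel[OF assms]] c2 by (simp add: norm_square)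

text \<open>Cauchy-Schwarz for \<open>fsum A\<close>, applied to \<open>v = synth A x\<close> and \<open>x\<close>, since \<open>ip v v = fsum A v x\<close>.\<close>

lemma norm_synth_le:
  assumes "finite A" "A \<subseteq> J" shows "(norm (synth A x))\<^sup>2 \<le> c2 * norm (fsum A x x)"
proof (cases "synth A x = 0")
  case False
  let ?v = "synth A x"
  have "(norm ?v)\<^sup>2 * (norm ?v)\<^sup>2 = (norm (fsum A ?v x))\<^sup>2"
    using norm_square[of ?v] by (simp add: ip_synth power2_eq_square)
  also have "\<dots> \<le> norm (fsum A ?v ?v) * norm (fsum A x x)" by (rule fsum.form_norm_Cauchy_Schwarz)
  also have "\<dots> \<le> (c2 * (norm ?v)\<^sup>2) * norm (fsum A x x)"
    by (intro mult_right_mono norm_fsum_le assms) simp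
  finally have "(norm ?v)\<^sup>2 * (norm ?v)\<^sup>2 \<le> (c2 * norm (fsum A x x)) * (norm ?v)\<^sup>2" by (simp only: mult_ac)
  moreover have "(norm ?v)\<^sup>2 > 0" using False by simp
  ultimately show ?thesis by (rule mult_right_le_imp_le)
qed (use c2 in simp)

end

context framed_module
begin

text \<open>
  Otherwise there are disjoint finite blocks \<open>B k\<close> of indices and points \<open>z k\<close> of \<open>Z\<close> whose block
  sums stay large.  The vectors \<open>synth (B k) (z k)\<close>, suitably scaled, form an admissible system by
  the Cauchy-Schwarz inequality, and \<open>z k\<close> pairs with the \<open>k\<close>-th of them to the block sum.  The
  pairings of a fixed vector with an admissible system tend to zero, so the points \<open>z k\<close> have no
  finite net.
\<close>

lemma totally_bounded_uniform_tail:
  assumes tb: "NN_totally_bounded ip Z" and \<epsilon>: "\<epsilon> > 0"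
  shows "\<exists>A. finite A \<and> A \<subseteq> J \<and> (\<forall>z\<in>Z. \<forall>B. finite B \<longrightarrow> B \<subseteq> J - A \<longrightarrow> norm (fsum B z z) < \<epsilon>)"
proof (rule ccontr)
  assume no: "\<not> ?thesis"
  have "\<exists>z B. finite A \<and> A \<subseteq> J \<longrightarrow> z \<in> Z \<and> finite B \<and> B \<subseteq> J - A \<and> \<epsilon> \<le> norm (fsum B z z)" for A
    using no by (meson not_le)
  then obtain zz BB where zB: "\<And>A. finite A \<and> A \<subseteq> J \<Longrightarrow>
      zz A \<in> Z \<and> finite (BB A) \<and> BB A \<subseteq> J - A \<and> \<epsilon> \<le> norm (fsum (BB A) (zz A) (zz A))" by metis
  define A where "A = rec_nat {} (\<lambda>_ S. S \<union> BB S)"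
  have A_Suc: "A (Suc k) = A k \<union> BB (A k)" for k by (simp add: A_def)
  have AJ: "finite (A k) \<and> A k \<subseteq> J" for k
  proof (induction k)
    case 0 then show ?case by (simp add: A_def)
  next
    case (Suc k) then show ?case using zB[OF Suc] unfolding A_Suc by blast
  qed
  define z B where "z k = zz (A k)" and "B k = BB (A k)" for k
  have z: "z k \<in> Z" and B: "finite (B k)" "B k \<subseteq> J" "B k \<inter> A k = {}" and
    big: "\<epsilon> \<le> norm (fsum (B k) (z k) (z k))" for k
    using zB[OF AJ[of k]] by (auto simp: z_def B_def)
  have A_mono: "A k \<subseteq> A l" if "k \<le> l" for k l
    using that by (rule lift_Suc_mono_le[of A, rotated]) (auto simp: A_Suc)
  have disj': "B k \<inter> B l = {}" if "k < l" for k l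
    using A_mono[of "Suc k" l] that B(3)[of l] by (auto simp: A_Suc B_def)
  have disj: "B k \<inter> B l = {}" if "k \<noteq> l" for k l
    using that disj'[of k l] disj'[of l k] by (cases k l rule: linorder_cases) auto
  obtain R where R: "R > 0" "\<And>x. x \<in> Z \<Longrightarrow> norm x \<le> R"
    using bounded_of_totally_bounded[OF tb] unfolding bounded_pos by blast
  \<comment> \<open>Both \<open>norm (X k) \<le> 1\<close> and the Bessel bound come from \<open>c\<^sup>2 * (c2 * R\<^sup>2) = 1 / c2\<close>.\<close>
  define c where "c = 1 / (c2 * R)"
  have c: "c > 0" using R c2 by (simp add: c_def)
  have cc: "c\<^sup>2 * (c2 * R\<^sup>2) = 1 / c2" using R c2 by (simp add: c_def power2_eq_square)
  have zz_le: "norm (fsum (B k) (z k) (z k)) \<le> c2 * R\<^sup>2" for k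
  proof -
    have "c2 * (norm (z k))\<^sup>2 \<le> c2 * R\<^sup>2" using R(2)[OF z[of k]] c2 by (intro mult_left_mono power_mono) simp_all
    then show ?thesis using norm_fsum_le[OF B(1,2), of k "z k"] by linarith
  qed
  define X where "X k = c *\<^sub>R synth (B k) (z k)" for k
  have ip_X: "ip x (X k) = c *\<^sub>R fsum (B k) x (z k)" for x k
    by (simp add: X_def ip_scaleR_right ip_synth)
  have X1: "norm (X k) \<le> 1" for k
  proof -
    have "(norm (X k))\<^sup>2 = c\<^sup>2 * (norm (synth (B k) (z k)))\<^sup>2" by (simp add: X_def power_mult_distrib)
    also have "\<dots> \<le> c\<^sup>2 * (c2 * (c2 * R\<^sup>2))"
      using norm_synth_le[OF B(1,2), of k "z k"] zz_le[of k] c2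
      by (intro mult_left_mono) (auto intro: order_trans mult_left_mono)
    also have "\<dots> = c2 * (c\<^sup>2 * (c2 * R\<^sup>2))" by (simp add: mult_ac)
    also have "\<dots> = 1" unfolding cc using c2 by simp
    finally show ?thesis by (simp add: power2_le_iff_abs_le abs_square_le_1)
  qed
  let ?g = "\<lambda>x k. ip x (X k) * ip (X k) x"
  have block: "(\<Sum>k\<in>K. ?g x k) \<preceq> (1 / c2) *\<^sub>R fsum (\<Union>k\<in>K. B k) x x" if K: "finite K" for K x
  proof -
    have "?g x k \<preceq> (1 / c2) *\<^sub>R fsum (B k) x x" for k
    proof -
      have "ip (X k) x = c *\<^sub>R fsum (B k) (z k) x"
        using arg_cong[OF ip_X[of x k], of adj] by (simp add: ip_adj adj_scaleR fsum.form_adj)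
      then have "?g x k = c\<^sup>2 *\<^sub>R (fsum (B k) x (z k) * fsum (B k) (z k) x)"
        by (simp add: ip_X power2_eq_square)
      also have "\<dots> \<preceq> c\<^sup>2 *\<^sub>R (norm (fsum (B k) (z k) (z k)) *\<^sub>R fsum (B k) x x)"
        by (intro cstar_le_scaleR fsum.form_Cauchy_Schwarz) simp
      finally have 1: "?g x k \<preceq> (c\<^sup>2 * norm (fsum (B k) (z k) (z k))) *\<^sub>R fsum (B k) x x" by simp
      have "c\<^sup>2 * norm (fsum (B k) (z k) (z k)) \<le> 1 / c2"
        unfolding cc[symmetric] by (intro mult_left_mono zz_le) simp
      then show ?thesis using cstar_le_trans[OF 1] cstar_le_scaleR_left[OF fsum.form_pos] by blast
    qed
    then have "(\<Sum>k\<in>K. ?g x k) \<preceq> (\<Sum>k\<in>K. (1 / c2) *\<^sub>R fsum (B k) x x)" by (intro cstar_le_sum)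
    also have "(\<Sum>k\<in>K. (1 / c2) *\<^sub>R fsum (B k) x x) = (1 / c2) *\<^sub>R fsum (\<Union>k\<in>K. B k) x x"
      unfolding fsum_def scaleR_sum_right[symmetric] using K B(1) disj
      by (subst sum.UNION_disjoint) auto
    finally show ?thesis .
  qed
  have X: "admissible_system ip X"
  proof (rule admissible_systemI[OF X1])
    fix x
    show "summable (?g x)"
      unfolding summable_Cauchy
    proof (intro allI impI)
      fix e :: real assume "e > 0"
      then have "c2 * e > 0" using c2 by simp
      from summable_on_tail[OF frame_summable this] obtain F where F: "finite F" "F \<subseteq> J"
        "\<And>A. finite A \<Longrightarrow> A \<subseteq> J - F \<Longrightarrow> norm (\<Sum>j\<in>A. ip x (f j) * ip (f j) x) < c2 * e" by blast
      \<comment> \<open>Disjointness leaves only finitely many blocks that meet \<open>F\<close>.\<close>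
      have "finite {k. j \<in> B k}" for j
      proof -
        have "{k. j \<in> B k} \<subseteq> {SOME k. j \<in> B k}" using disj by (smt (verit) disjoint_iff insert_iff mem_Collect_eq someI subsetI)
        then show ?thesis by (rule finite_subset) simp
      qed
      then have "finite (\<Union>j\<in>F. {k. j \<in> B k})" using F(1) by blast
      then obtain N where N: "(\<Union>j\<in>F. {k. j \<in> B k}) \<subseteq> {..<N}" using finite_nat_iff_bounded by blast
      have "norm (\<Sum>k\<in>{m..<n}. ?g x k) < e" if "m \<ge> N" for m n
      proof -
        let ?U = "\<Union>k\<in>{m..<n}. B k"
        have "?U \<subseteq> J - F"
        proof
          fix j assume "j \<in> ?U"
          then obtain k where k: "m \<le> k" "j \<in> B k" by auto
          then have "j \<notin> F" using N that by fastforce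
          then show "j \<in> J - F" using k B(2)[of k] by blast
        qed
        then have "norm (fsum ?U x x) < c2 * e" unfolding fsum_def using B(1) by (intro F(3)) auto
        moreover have "norm (\<Sum>k\<in>{m..<n}. ?g x k) \<le> (1 / c2) * norm (fsum ?U x x)"
          using c2 by (intro norm_le_of_cstar_le_scaleR block cstar_pos_sum rank_one_pos) simp_all
        moreover have "(1 / c2) * N < e" if "N < c2 * e" for N
          using that c2 by (simp add: pos_divide_less_eq mult.commute)
        ultimately show ?thesis by (meson le_less_trans)
      qed
      then show "\<exists>N. \<forall>m\<ge>N. \<forall>n. norm (\<Sum>k\<in>{m..<n}. ?g x k) < e" by blast
    qed
    fix n
    have "(\<Sum>k<n. ?g x k) \<preceq> (1 / c2) *\<^sub>R fsum (\<Union>k<n. B k) x x" by (rule block) simp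
    moreover have "(1 / c2) *\<^sub>R fsum (\<Union>k<n. B k) x x \<preceq> (1 / c2) *\<^sub>R (c2 *\<^sub>R ip x x)"
      using B c2 by (intro cstar_le_scaleR frame_Bessel) auto
    ultimately show "(\<Sum>k<n. ?g x k) \<preceq> ip x x" using c2 cstar_le_trans by fastforce
  qed
  let ?s = "\<lambda>k. fsum (B k) (z k) (z k)"
  have "\<exists>\<phi>. cstar_state \<phi> \<and> \<phi> (?s k) = complex_of_real (norm (?s k))" for k
    using cstar_state_exists[OF fsum.form_pos, of "B k" "z k"] big[of k] \<epsilon> by (metis norm_zero not_le)
  then obtain \<Phi> where \<Phi>: "\<And>k. cstar_state (\<Phi> k)" "\<And>k. \<Phi> k (?s k) = complex_of_real (norm (?s k))"
    by metis
  have pairing: "c * \<epsilon> \<le> cmod (\<Phi> k (ip (z k) (X k)))" for k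
  proof -
    have "\<Phi> k (ip (z k) (X k)) = complex_of_real (c * norm (?s k))"
      unfolding ip_X using linear_scale[OF bounded_linear.linear[OF cstar_stateD(1)[OF \<Phi>(1)[of k]]]]
      by (simp add: \<Phi>(2) scaleR_conv_of_real)
    then have "cmod (\<Phi> k (ip (z k) (X k))) = c * norm (?s k)" using c by (simp only: norm_of_real) simp
    then show ?thesis using big[of k] c by simp
  qed
  have c\<epsilon>: "c * \<epsilon> / 2 > 0" using c \<epsilon> by simp
  obtain F where F: "finite F" "\<And>k. \<exists>y\<in>F. cmod (\<Phi> k (ip (z k) (X k))) < norm (ip y (X k)) + c * \<epsilon> / 2"
    using totally_bounded_diagonal[where z=z and \<Phi>=\<Phi>, OF tb X \<Phi>(1) z c\<epsilon>] by blast
  have "\<forall>\<^sub>F k in sequentially. norm (ip y (X k)) < c * \<epsilon> / 2" for y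
  proof -
    have "?g y \<longlonglongrightarrow> 0" using X by (intro summable_LIMSEQ_zero) (simp add: admissible_system_def)
    from order_tendstoD(2)[OF tendsto_norm_zero[OF this], of "(c * \<epsilon> / 2)\<^sup>2"]
    have "\<forall>\<^sub>F k in sequentially. norm (?g y k) < (c * \<epsilon> / 2)\<^sup>2"
      using zero_less_power[OF c\<epsilon>, of 2] by simp
    moreover have "norm (?g y k) = (norm (ip y (X k)))\<^sup>2" for k
      using cstar_identity'[of "ip y (X k)"] by (simp add: ip_adj)
    ultimately show ?thesis using c\<epsilon>
      by (auto elim!: eventually_mono dest!: power2_less_imp_less)
  qed
  then have "\<forall>\<^sub>F k in sequentially. \<forall>y\<in>F. norm (ip y (X k)) < c * \<epsilon> / 2"
    using F(1) by (simp add: eventually_ball_finite)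
  then obtain k where "\<forall>y\<in>F. norm (ip y (X k)) < c * \<epsilon> / 2"
    using eventually_happens' sequentially_bot by blast
  then show False using F(2)[of k] pairing[of k] by fastforce
qed

section \<open>The frame operator and the converse\<close>

definition frame_op :: "'n \<Rightarrow> 'n" where
  "frame_op x = (\<Sum>\<^sub>\<infinity>j\<in>J. act (f j) (ip (f j) x))"

lemma frame_op_has_sum: "((\<lambda>j. act (f j) (ip (f j) x)) has_sum frame_op x) J"
  unfolding frame_op_def
proof (rule has_sum_infsum, rule summable_on_Cauchy)
  fix \<epsilon> :: real assume \<epsilon>: "\<epsilon> > 0"
  then have "\<epsilon>\<^sup>2 / c2 > 0" using c2 by simp
  from summable_on_tail[OF frame_summable this] obtain F where F: "finite F" "F \<subseteq> J"
    "\<And>A. finite A \<Longrightarrow> A \<subseteq> J - F \<Longrightarrow> norm (fsum A x x) < \<epsilon>\<^sup>2 / c2" unfolding fsum_def by blast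
  have "norm (synth A x) < \<epsilon>" if A: "finite A" "A \<subseteq> J - F" for A
  proof -
    have "(norm (synth A x))\<^sup>2 \<le> c2 * norm (fsum A x x)" using A by (intro norm_synth_le) auto
    also have "\<dots> < \<epsilon>\<^sup>2" using F(3)[OF A] c2 by (simp add: pos_less_divide_eq mult.commute)
    finally show ?thesis using \<epsilon> by (simp add: power2_less_imp_less)
  qed
  then show "\<exists>F. finite F \<and> F \<subseteq> J \<and> (\<forall>A. finite A \<longrightarrow> A \<subseteq> J - F \<longrightarrow> norm (\<Sum>j\<in>A. act (f j) (ip (f j) x)) < \<epsilon>)"
    using F(1,2) unfolding synth_def by blast
qed

lemma ip_frame_op_has_sum: "((\<lambda>j. ip y (f j) * ip (f j) x) has_sum ip y (frame_op x)) J"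
  using has_sum_bounded_linear[OF bounded_linear_ip_right frame_op_has_sum] by (simp add: ip_act_right)

lemma ip_frame_op_adj: "adj (ip x (frame_op y)) = ip y (frame_op x)"
proof (rule has_sum_unique[OF _ ip_frame_op_has_sum])
  show "((\<lambda>j. ip y (f j) * ip (f j) x) has_sum adj (ip x (frame_op y))) J"
    using has_sum_bounded_linear[OF bounded_linear_adj ip_frame_op_has_sum[of x y]]
    by (simp add: adj_mult ip_adj)
qed

lemma frame_op_add: "frame_op (x + y) = frame_op x + frame_op y"
  using has_sum_add[OF frame_op_has_sum[of x] frame_op_has_sum[of y]]
  by (intro has_sum_unique[OF frame_op_has_sum]) (simp add: ip_add_right act_add_right)

lemma frame_op_act: "frame_op (act x a) = act (frame_op x) a"
  using has_sum_bounded_linear[OF bounded_linear_act_left frame_op_has_sum[of x], of a]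
  by (intro has_sum_unique[OF frame_op_has_sum]) (simp add: ip_act_right act_mult)

lemma frame_op_bounds: "c1 *\<^sub>R ip x x \<preceq> ip x (frame_op x)" "ip x (frame_op x) \<preceq> c2 *\<^sub>R ip x x"
  using frame_lower[of x] frame_upper[of x] infsumI[OF ip_frame_op_has_sum[of x x]] by simp_all

lemma norm_frame_op_diff_le:
  assumes "finite A" "A \<subseteq> J" "t \<ge> 0"
    and "\<And>B. finite B \<Longrightarrow> B \<subseteq> J - A \<Longrightarrow> norm (fsum B x x) \<le> t\<^sup>2 / c2"
  shows "norm (frame_op x - synth A x) \<le> t"
  unfolding synth_def
proof (rule has_sum_norm_diff_le[OF frame_op_has_sum assms(1,2)])
  fix B assume B: "finite B" "B \<subseteq> J - A"
  have "(norm (synth B x))\<^sup>2 \<le> c2 * norm (fsum B x x)" using B by (intro norm_synth_le) auto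
  also have "\<dots> \<le> t\<^sup>2" using assms(4)[OF B] c2 by (simp add: pos_le_divide_eq mult.commute)
  finally show "norm (\<Sum>j\<in>B. act (f j) (ip (f j) x)) \<le> t"
    using assms(3) unfolding synth_def by (rule power2_le_imp_le)
qed

lemma norm_frame_op_le: "norm (frame_op x) \<le> c2 * norm x"
proof -
  have "norm (frame_op x - synth {} x) \<le> c2 * norm x"
  proof (rule norm_frame_op_diff_le)
    fix B assume "finite B" "B \<subseteq> J - {}"
    then have "norm (fsum B x x) \<le> c2 * (norm x)\<^sup>2" by (intro norm_fsum_le) auto
    then show "norm (fsum B x x) \<le> (c2 * norm x)\<^sup>2 / c2" using c2 by (simp add: power2_eq_square mult_ac)
  qed (use c2 in auto)
  then show ?thesis by (simp add: synth_def)
qed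

text \<open>
  The operator \<open>1 - frame_op / c2\<close> is positive and at most \<open>\<kappa>\<close>; apply the Cauchy-Schwarz inequality
  to its form.
\<close>

lemma frame_op_contraction:
  obtains \<kappa> where "0 \<le> \<kappa>" "\<kappa> < 1" "\<And>x. norm (x - (1/c2) *\<^sub>R frame_op x) \<le> \<kappa> * norm x"
proof -
  define \<kappa> where "\<kappa> = max 0 (1 - c1 / c2)"
  have \<kappa>: "0 \<le> \<kappa>" "\<kappa> < 1" using c1 c2 by (simp_all add: \<kappa>_def)
  define T where "T x = x - (1/c2) *\<^sub>R frame_op x" for x
  have T: "ip x (T y) = ip x y - (1/c2) *\<^sub>R ip x (frame_op y)" for x y
    by (simp add: T_def form_diff_right ip_scaleR_right)
  interpret T: pos_form act "\<lambda>x y. ip x (T y)"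
  proof
    show "cstar_pos (ip x (T x))" for x
    proof -
      have "(1/c2) *\<^sub>R ip x (frame_op x) \<preceq> (1/c2) *\<^sub>R (c2 *\<^sub>R ip x x)"
        using c2 by (intro cstar_le_scaleR frame_op_bounds) simp
      then show ?thesis using c2 by (simp add: T cstar_le_def)
    qed
  qed (simp_all add: T ip_add_right ip_act_right frame_op_add frame_op_act scaleR_add_right adj_diff
      adj_scaleR ip_adj ip_frame_op_adj[unfolded ip_adj] left_diff_distrib)
  have Tk: "norm (ip x (T x)) \<le> \<kappa> * (norm x)\<^sup>2" for x
  proof -
    have "(1/c2) *\<^sub>R (c1 *\<^sub>R ip x x) \<preceq> (1/c2) *\<^sub>R ip x (frame_op x)"
      using c2 by (intro cstar_le_scaleR frame_op_bounds) simp
    then have "ip x (T x) \<preceq> (1 - c1 / c2) *\<^sub>R ip x x"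
      by (simp add: T cstar_le_def algebra_simps)
    also have "\<dots> \<preceq> \<kappa> *\<^sub>R ip x x" by (intro cstar_le_scaleR_left ip_pos) (simp add: \<kappa>_def)
    finally (cstar_le_trans) have "norm (ip x (T x)) \<le> \<kappa> * norm (ip x x)"
      by (rule norm_le_of_cstar_le_scaleR[OF T.form_pos _ \<kappa>(1)])
    then show ?thesis by (simp add: norm_square)
  qed
  have "norm (T x) \<le> \<kappa> * norm x" for x
  proof (cases "T x = 0")
    case False
    have "((norm (T x))\<^sup>2)\<^sup>2 \<le> norm (ip (T x) (T (T x))) * norm (ip x (T x))"
      using T.form_norm_Cauchy_Schwarz[of "T x" x] by (simp add: norm_square)
    also have "\<dots> \<le> (\<kappa> * (norm (T x))\<^sup>2) * (\<kappa> * (norm x)\<^sup>2)"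
      using \<kappa>(1) by (intro mult_mono Tk) simp_all
    also have "\<dots> = (norm (T x) * (\<kappa> * norm x))\<^sup>2" by (simp add: power2_eq_square mult_ac)
    finally have "(norm (T x))\<^sup>2 \<le> norm (T x) * (\<kappa> * norm x)"
      by (rule power2_le_imp_le) (simp add: \<kappa>(1))
    then show ?thesis using False by (simp add: power2_eq_square)
  qed (simp add: \<kappa>(1))
  then show ?thesis using that \<kappa> unfolding T_def by blast
qed

text \<open>
  Partial sums of the Neumann series of the inverse of \<open>frame_op\<close>, which are module maps.
\<close>

lemma frame_op_approximate_inverse:
  assumes \<kappa>: "0 \<le> \<kappa>" "\<And>x. norm (x - (1/c2) *\<^sub>R frame_op x) \<le> \<kappa> * norm x"
  shows "\<exists>P K. K \<ge> 0 \<and> (\<forall>x y. P (x + y) = P x + P y) \<and> (\<forall>x a. P (act x a) = act (P x) a) \<and>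
    (\<forall>x. norm (P x) \<le> K * norm x) \<and> (\<forall>x. norm (x - P (frame_op x)) \<le> \<kappa> ^ n * norm x)"
proof (induction n)
  case 0
  have "act 0 a = 0" for a by (rule linear_0[OF bounded_linear.linear[OF bounded_linear_act_left]])
  then show ?case by (intro exI[of _ "\<lambda>_. 0"] exI[of _ 0]) simp
next
  case (Suc n)
  then obtain P K where P: "K \<ge> 0" "\<And>x y. P (x + y) = P x + P y" "\<And>x a. P (act x a) = act (P x) a"
    "\<And>x. norm (P x) \<le> K * norm x" "\<And>x. norm (x - P (frame_op x)) \<le> \<kappa> ^ n * norm x" by blast
  define Q where "Q y = P y + (1/c2) *\<^sub>R (y - frame_op (P y))" for y
  have act_diff: "act (x - y) a = act x a - act y a" for x y a
    using act_add_left[of "x - y" y a] by simp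
  have frame_diff: "frame_op (x - y) = frame_op x - frame_op y" for x y
    using frame_op_add[of "x - y" y] by simp
  have "Q (x + y) = Q x + Q y" for x y
    by (simp add: Q_def P(2) frame_op_add scaleR_add_right scaleR_diff_right)
  moreover have "Q (act x a) = act (Q x) a" for x a
    by (simp add: Q_def P(3) frame_op_act act_add_left act_scaleR_left act_diff)
  moreover have "norm (Q x) \<le> (K + (1/c2) * (1 + c2 * K)) * norm x" for x
  proof -
    have "norm (frame_op (P x)) \<le> c2 * (K * norm x)"
      using norm_frame_op_le[of "P x"] P(4)[of x] c2 by (meson mult_left_mono less_imp_le order_trans)
    then have "norm (x - frame_op (P x)) \<le> (1 + c2 * K) * norm x"
      using norm_triangle_ineq4[of x "frame_op (P x)"] by (simp add: algebra_simps)
    then have "norm ((1/c2) *\<^sub>R (x - frame_op (P x))) \<le> (1/c2) * ((1 + c2 * K) * norm x)"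
      using c2 by (simp add: divide_right_mono)
    then have "norm (Q x) \<le> K * norm x + (1/c2) * ((1 + c2 * K) * norm x)"
      unfolding Q_def by (intro order_trans[OF norm_triangle_ineq] add_mono P(4))
    then show ?thesis by (simp add: distrib_right)
  qed
  moreover have "norm (x - Q (frame_op x)) \<le> \<kappa> ^ Suc n * norm x" for x
  proof -
    let ?d = "x - P (frame_op x)"
    have e: "x - Q (frame_op x) = ?d - (1/c2) *\<^sub>R frame_op ?d" by (simp add: Q_def frame_diff)
    have "norm (x - Q (frame_op x)) \<le> \<kappa> * norm ?d" unfolding e by (rule \<kappa>(2))
    also have "\<dots> \<le> \<kappa> * (\<kappa> ^ n * norm x)" by (intro mult_left_mono P(5) \<kappa>)
    finally show ?thesis by (simp add: mult.assoc)
  qed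
  moreover have "K + (1/c2) * (1 + c2 * K) \<ge> 0" using P(1) c2 by simp
  ultimately show ?case by blast
qed

text \<open>
  With \<open>P\<close> an approximate inverse of the frame operator, \<open>z\<close> is close to \<open>P (frame_op z)\<close>, and
  \<open>frame_op z\<close> is close, uniformly on \<open>Z\<close>, to a finite combination of frame vectors \<open>f j\<close> with the
  bounded coefficients \<open>ip (f j) z\<close>.  So \<open>z\<close> is close to the same combination of the vectors
  \<open>P (f j)\<close>.
\<close>

theorem precompact_of_totally_bounded:
  assumes tb: "NN_totally_bounded ip Z" shows "A_precompact act Z"
  unfolding A_precompact_def
proof (intro conjI allI impI)
  show "bounded Z" by (rule bounded_of_totally_bounded[OF tb])
  then obtain R where R: "R > 0" "\<And>x. x \<in> Z \<Longrightarrow> norm x \<le> R" unfolding bounded_pos by blast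
  fix \<epsilon> :: real assume \<epsilon>: "\<epsilon> > 0"
  obtain \<kappa> where \<kappa>: "0 \<le> \<kappa>" "\<kappa> < 1" "\<And>x. norm (x - (1/c2) *\<^sub>R frame_op x) \<le> \<kappa> * norm x"
    using frame_op_contraction by metis
  have "\<epsilon> / (2 * R) > 0" using \<epsilon> R by simp
  then obtain n where n: "\<kappa> ^ n < \<epsilon> / (2 * R)" using real_arch_pow_inv \<kappa>(2) by blast
  obtain P K where P: "K \<ge> 0" "\<And>x y. P (x + y) = P x + P y" "\<And>x a. P (act x a) = act (P x) a"
    "\<And>x. norm (P x) \<le> K * norm x" "\<And>x. norm (x - P (frame_op x)) \<le> \<kappa> ^ n * norm x"
    using frame_op_approximate_inverse[OF \<kappa>(1,3), of n] by blast
  define t where "t = \<epsilon> / (2 * (K + 1))"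
  have t: "t > 0" "K * t < \<epsilon> / 2"
    using \<epsilon> P(1) by (simp_all add: t_def field_simps)
  have "t\<^sup>2 / c2 > 0" using t c2 by simp
  from totally_bounded_uniform_tail[OF tb this]
  obtain A where A12: "finite A" "A \<subseteq> J"
    and A3: "\<forall>z\<in>Z. \<forall>B. finite B \<longrightarrow> B \<subseteq> J - A \<longrightarrow> norm (fsum B z z) < t\<^sup>2 / c2"
    by (elim exE conjE)
  have A: "finite A" "A \<subseteq> J"
    "\<And>z B. z \<in> Z \<Longrightarrow> finite B \<Longrightarrow> B \<subseteq> J - A \<Longrightarrow> norm (fsum B z z) < t\<^sup>2 / c2"
    using A12 A3 by simp_all
  obtain h where h: "bij_betw h {..<card A} A"
    using ex_bij_betw_nat_finite[OF A(1)] by (auto simp: atLeast0LessThan)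
  define M where "M = 1 + (\<Sum>j\<in>A. norm (f j)) * R"
  have M: "M > 0" unfolding M_def using R(1) by (intro add_pos_nonneg mult_nonneg_nonneg sum_nonneg) simp_all
  have P0: "P 0 = 0" using P(2)[of 0 0] by simp
  have P_sum: "P (sum u C) = (\<Sum>j\<in>C. P (u j))" if "finite C" for u :: "'j \<Rightarrow> 'n" and C
    using that by (induction C rule: finite_induct) (simp_all add: P0 P(2))
  have "\<exists>a. (\<forall>k<card A. norm (a k) \<le> M) \<and> norm (x - (\<Sum>k<card A. act (P (f (h k))) (a k))) < \<epsilon>"
    if x: "x \<in> Z" for x
  proof (intro exI[of _ "\<lambda>k. ip (f (h k)) x"] conjI allI impI)
    fix k assume "k < card A"
    then have "h k \<in> A" using h by (auto simp: bij_betw_def)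
    then have "norm (f (h k)) \<le> (\<Sum>j\<in>A. norm (f j))" using A(1) by (intro member_le_sum) simp_all
    then have "norm (f (h k)) * norm x \<le> (\<Sum>j\<in>A. norm (f j)) * R"
      using R(2)[OF x] R(1) by (intro mult_mono sum_nonneg) simp_all
    then show "norm (ip (f (h k)) x) \<le> M" using norm_ip_le[of "f (h k)" x] by (simp add: M_def)
  next
    have "(\<Sum>k<card A. act (P (f (h k))) (ip (f (h k)) x)) = (\<Sum>j\<in>A. act (P (f j)) (ip (f j) x))"
      by (rule sum.reindex_bij_betw[OF h])
    also have "\<dots> = P (synth A x)" by (simp add: synth_def P_sum[OF A(1)] P(3))
    finally have e: "(\<Sum>k<card A. act (P (f (h k))) (ip (f (h k)) x)) = P (synth A x)" .
    have "norm (frame_op x - synth A x) \<le> t"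
    proof (rule norm_frame_op_diff_le[OF A(1,2)])
      show "norm (fsum B x x) \<le> t\<^sup>2 / c2" if "finite B" "B \<subseteq> J - A" for B
        using A(3)[OF x that] by simp
    qed (use t in simp)
    then have "norm (P (frame_op x - synth A x)) \<le> K * t"
      using P(4)[of "frame_op x - synth A x"] P(1) by (meson mult_left_mono order_trans)
    moreover have "norm (x - P (frame_op x)) < \<epsilon> / 2"
    proof -
      have "\<kappa> ^ n * norm x \<le> \<kappa> ^ n * R" using R(2)[OF x] \<kappa>(1) by (intro mult_left_mono) simp_all
      also have "\<dots> < \<epsilon> / (2 * R) * R" using n R(1) by (intro mult_strict_right_mono)
      also have "\<dots> = \<epsilon> / 2" using R(1) by simp
      finally show ?thesis using P(5)[of x] by linarith
    qed
    moreover have d: "x - P (synth A x) = (x - P (frame_op x)) + P (frame_op x - synth A x)"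
      using P(2)[of "frame_op x - synth A x" "synth A x"] by simp
    ultimately have "norm (x - P (synth A x)) < \<epsilon>"
      unfolding d using norm_triangle_ineq[of "x - P (frame_op x)" "P (frame_op x - synth A x)"] t(2) by linarith
    then show "norm (x - (\<Sum>k<card A. act (P (f (h k))) (ip (f (h k)) x))) < \<epsilon>" by (simp add: e)
  qed
  then show "\<exists>M>0. \<exists>(s::nat) z. \<forall>x\<in>Z. \<exists>a. (\<forall>k<s. norm (a k) \<le> M) \<and>
      norm (x - (\<Sum>k<s. act (z k) (a k))) < \<epsilon>"
    using M by (intro exI[of _ M] conjI exI[of _ "card A"] exI[of _ "\<lambda>k. P (f (h k))"]) blast+
qed

end

theorem theorem4p4:
  fixes act :: "'n::complex_banach \<Rightarrow> 'a::cstar_algebra \<Rightarrow> 'n"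
    and ip :: "'n \<Rightarrow> 'n \<Rightarrow> 'a"
    and Z :: "'n set"
  assumes "hilbert_module act ip"
  shows "(A_precompact act Z \<longrightarrow> NN_totally_bounded ip Z)
    \<and> ((\<exists>(J::'j set) f. standard_frame ip J f) \<longrightarrow>
         NN_totally_bounded ip Z \<longrightarrow> A_precompact act Z)
    \<and> (countably_generated_module act \<longrightarrow>
         (\<exists>f::nat \<Rightarrow> 'n. standard_frame ip UNIV f))"
proof -
  interpret hilbert_module act ip by (rule assms)
  show ?thesis
  proof (intro conjI impI)
    assume "A_precompact act Z"
    then show "NN_totally_bounded ip Z" by (rule totally_bounded_of_precompact)
  next
    assume "\<exists>(J::'j set) f. standard_frame ip J f" and tb: "NN_totally_bounded ip Z"
    then obtain J :: "'j set" and f c1 c2 where "framed_module act ip J f c1 c2"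
      unfolding standard_frame_def framed_module_def framed_module_axioms_def using assms by blast
    then show "A_precompact act Z" using tb by (rule framed_module.precompact_of_totally_bounded)
  next
    assume "countably_generated_module act"
    then show "\<exists>f::nat \<Rightarrow> 'n. standard_frame ip UNIV f" by (rule standard_frame_of_countably_generated)
  qed
qed

end
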